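(* The measure $\omega$ is the unique positive translation invariant Borel measure on $\overline{\mathcal{R}}$ such that, for every $f,g\in A^2(\Delta)$, $$\langle f,g\rangle_{A^2(\Delta)}=\Big\langle\frac{\Gamma(z+1)}{2^z}M_\Delta(f),\ \frac{\Gamma(z+1)}{2^z}M_\Delta(g)\Big\rangle_{L^2(\overline{\mathcal{R}},d\omega)}.$$
   Context: $\Delta=\{\zeta\in\mathbf{C}:|\zeta-1|<1\}$; $A^2(\Delta)$ is the (unweighted) Bergman space of holomorphic functions on $\Delta$ square integrable with respect to Lebesgue measure $dA$, with norm $\|f\|_{A^2(\Delta)}^2=\frac1\pi\iint_\Delta|f|^2\,dA$ and inner product $\langle f,g\rangle_{A^2(\Delta)}=\frac1\pi\iint_\Delta f\,\overline g\,dA$. $\mathcal{R}=\{z\in\mathbf{C}:\Re z>0\}$ and $\overline{\mathcal{R}}$ is its closure. For $f\in A^2(\Delta)$ and $z\in\mathcal{R}$, the Mellin--Bergman transform is $M_\Delta f(z)=\frac1\pi\iint_\Delta f(\zeta)\,\overline{\zeta}^{\,z-1}\,dA(\zeta)$ (principal branch of powers). With $z=x+iy$, $\omega=\sum_{n=0}^{+\infty}\frac{2^n}{n!}\,\delta_{n/2}(x)\otimes dy$ on $\overline{\mathcal{R}}$. A positive Borel measure $\mu$ on $\overline{\mathcal{R}}$ is called translation invariant if $d\mu(x+iy)=d\nu(x)\otimes dy$ with $\nu$ a positive Borel measure on $[0,+\infty)$. On the imaginary axis, the functions $\frac{\Gamma(z+1)}{2^z}M_\Delta(f)(z)$ are understood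 as their boundary values (limits in $L^2(\mathbf{R},dy)$ of the restrictions to $\Re z=x$ as $x\to0^+$).
   Formalization: The inner product of L²(dω) is taken with a factor 1/(2π), i.e. (1/2π)∫F·conj(G) dω; without it the identity fails for f=g=1, where the left side is 1 and the right side is 2π. *)

theory Defs
  imports "HOL-Probability.Probability"
begin

abbreviation Delta :: "complex set" where
  "Delta \<equiv> ball 1 1"

definition right_half_plane :: "complex set" where
  "right_half_plane = {z. Re z > 0}"

definition borel_on :: "'a::topological_space set \<Rightarrow> 'a measure" where
  "borel_on S = restrict_space borel S"

definition square_integrable :: "'a measure \<Rightarrow> ('a \<Rightarrow> complex) \<Rightarrow> bool" where
  "square_integrable M F \<longleftrightarrow>
     F \<in> borel_measurable M \<and> integrable M (\<lambda>z. (cmod (F z))\<^sup>2)"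

text \<open>Elements of the Bergman space are represented by functions on the whole plane; only
  their values on the disc are ever used.\<close>

definition bergman_space :: "(complex \<Rightarrow> complex) set" where
  "bergman_space =
     {f. f holomorphic_on Delta \<and> set_integrable lborel Delta (\<lambda>\<zeta>. (cmod (f \<zeta>))\<^sup>2)}"

definition bergman_inner :: "(complex \<Rightarrow> complex) \<Rightarrow> (complex \<Rightarrow> complex) \<Rightarrow> complex" where
  "bergman_inner f g = 1 / of_real pi * (LINT \<zeta>:Delta|lborel. f \<zeta> * cnj (g \<zeta>))"

definition mellin_bergman :: "(complex \<Rightarrow> complex) \<Rightarrow> complex \<Rightarrow> complex" where
  "mellin_bergman f z =
     1 / of_real pi * (LINT \<zeta>:Delta|lborel. f \<zeta> * cnj \<zeta> powr (z - 1))"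

definition weighted_mellin :: "(complex \<Rightarrow> complex) \<Rightarrow> complex \<Rightarrow> complex" where
  "weighted_mellin f z = Gamma (z + 1) / 2 powr z * mellin_bergman f z"

definition is_boundary_value :: "(complex \<Rightarrow> complex) \<Rightarrow> (real \<Rightarrow> complex) \<Rightarrow> bool" where
  "is_boundary_value F b \<longleftrightarrow>
     square_integrable lborel b \<and>
     (\<forall>\<^sub>F x in at_right 0. square_integrable lborel (\<lambda>y. F (Complex x y))) \<and>
     ((\<lambda>x. LINT y|lborel. (cmod (F (Complex x y) - b y))\<^sup>2) \<longlongrightarrow> 0) (at_right 0)"

text \<open>A boundary value is determined only almost everywhere. The choice made here does not
  matter, since all measures considered below restrict to a multiple of Lebesgue measure on
  the imaginary axis.\<close>

definition boundary_extension :: "(complex \<Rightarrow> complex) \<Rightarrow> complex \<Rightarrow> complex" where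
  "boundary_extension F z =
     (if Re z > 0 then F z else (SOME b. is_boundary_value F b) (Im z))"

text \<open>The factor \<open>1 / (2 * pi)\<close> is the usual normalization of Lebesgue measure on vertical
  lines. It is forced by the normalization of the measure \<open>omega\<close> defined below: for the
  constant function 1 on the disc, which has Bergman norm 1, the integral of the squared modulus
  of \<open>Gamma (z + 1) / 2 powr z\<close> with respect to \<open>omega\<close> is \<open>2 * pi\<close>.\<close>

definition L2_inner :: "complex measure \<Rightarrow> (complex \<Rightarrow> complex) \<Rightarrow> (complex \<Rightarrow> complex) \<Rightarrow> complex" where
  "L2_inner M F G = 1 / of_real (2 * pi) * (LINT z|M. F z * cnj (G z))"

text \<open>The measure \<open>\<nu>(dx) \<otimes> dy\<close>. No finiteness of \<open>\<nu>\<close> is needed for the product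
  measure, since Lebesgue measure, the second factor, is sigma-finite.\<close>

definition vertical_product :: "real measure \<Rightarrow> complex measure" where
  "vertical_product \<nu> =
     distr (\<nu> \<Otimes>\<^sub>M lborel) (borel_on (closure right_half_plane)) (\<lambda>(x, y). Complex x y)"

definition translation_invariant :: "complex measure \<Rightarrow> bool" where
  "translation_invariant \<mu> \<longleftrightarrow>
     (\<exists>\<nu>. sets \<nu> = sets (borel_on {0..}) \<and> \<mu> = vertical_product \<nu>)"

definition omega_base :: "real measure" where
  "omega_base = measure_of {0..} (sets (borel_on {0..}))
     (\<lambda>A. \<Sum>n. ennreal (2 ^ n / fact n) * emeasure (return (borel_on {0..}) (real n / 2)) A)"

definition omega :: "complex measure" where
  "omega = vertical_product omega_base"

definition bergman_isometric :: "complex measure \<Rightarrow> bool" where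
  "bergman_isometric \<mu> \<longleftrightarrow>
     (\<forall>f\<in>bergman_space. \<forall>g\<in>bergman_space.
        square_integrable \<mu> (boundary_extension (weighted_mellin f)) \<and>
        square_integrable \<mu> (boundary_extension (weighted_mellin g)) \<and>
        bergman_inner f g =
          L2_inner \<mu> (boundary_extension (weighted_mellin f))
                      (boundary_extension (weighted_mellin g)))"

lemma space_borel_on [simp]: "space (borel_on S) = S"
  by (simp add: borel_on_def space_restrict_space)

lemma sets_omega_base [simp]: "sets omega_base = sets (borel_on {0..})"
  using sets.sets_measure_of_eq[of "borel_on {0..}"]
  by (simp add: omega_base_def)

lemma emeasure_omega_base:
  assumes "A \<in> sets (borel_on {0..})"
  shows "emeasure omega_base A = (\<Sum>n. ennreal (2 ^ n / fact n) * indicator A (real n / 2))"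
proof -
  let ?N = "borel_on {0..} :: real measure"
  let ?m = "\<lambda>A. \<Sum>n. ennreal (2 ^ n / fact n) * emeasure (return ?N (real n / 2)) A"
  have "countably_additive (sets ?N) ?m"
  proof (rule countably_additiveI)
    fix B :: "nat \<Rightarrow> real set"
    assume B: "range B \<subseteq> sets ?N" "disjoint_family B"
    have "(\<Sum>i. ?m (B i)) =
        (\<Sum>n. \<Sum>i. ennreal (2 ^ n / fact n) * emeasure (return ?N (real n / 2)) (B i))"
      using nn_integral_suminf[of "\<lambda>i n. ennreal (2 ^ n / fact n) *
          emeasure (return ?N (real n / 2)) (B i)" "count_space UNIV"]
      by (simp add: nn_integral_count_space_nat)
    also have "\<dots> = ?m (\<Union>i. B i)"
      using suminf_emeasure[of B "return ?N _"] B
      by (simp del: emeasure_return)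
    finally show "(\<Sum>i. ?m (B i)) = ?m (\<Union>i. B i)" .
  qed
  then have "emeasure omega_base A = ?m A"
    using assms sets.space_closed[of ?N]
    by (intro emeasure_measure_of[OF omega_base_def])
       (simp_all add: positive_def del: emeasure_return)
  also have "\<dots> = (\<Sum>n. ennreal (2 ^ n / fact n) * indicator A (real n / 2))"
    using assms by simp
  finally show ?thesis .
qed

lemma closure_right_half_plane: "closure right_half_plane = {z. Re z \<ge> 0}"
  using closure_halfspace_gt[of "1 :: complex" 0]
  by (simp add: right_half_plane_def inner_complex_def)

lemma measurable_Complex_borel_on:
  assumes [measurable_cong]: "sets \<nu> = sets (borel_on {0..})"
  shows "(\<lambda>(x, y). Complex x y) \<in>
    \<nu> \<Otimes>\<^sub>M lborel \<rightarrow>\<^sub>M borel_on (closure right_half_plane)"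
proof -
  have sp: "space \<nu> = {0..}"
    using sets_eq_imp_space_eq[OF assms] by simp
  have [measurable]: "(\<lambda>x. x) \<in> borel_on {0..} \<rightarrow>\<^sub>M (borel :: real measure)"
    by (simp add: borel_on_def measurable_restrict_space1)
  have [measurable]: "fst \<in> \<nu> \<Otimes>\<^sub>M lborel \<rightarrow>\<^sub>M (borel :: real measure)"
    by (rule measurable_compose[OF measurable_fst, of "\<lambda>x. x"]) measurable
  have "(\<lambda>p. of_real (fst p) + \<i> * of_real (snd p)) \<in>
      borel_measurable (\<nu> \<Otimes>\<^sub>M (lborel :: real measure))"
    by measurable
  then have "(\<lambda>(x, y). Complex x y) \<in> borel_measurable (\<nu> \<Otimes>\<^sub>M lborel)"
    by (simp only: case_prod_unfold Complex_eq)
  then show ?thesis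
    unfolding borel_on_def
    by (intro measurable_restrict_space2)
       (auto simp: closure_right_half_plane space_pair_measure sp)
qed

lemma emeasure_vertical_product_times:
  assumes "sets \<nu> = sets (borel_on {0..})"
    and "A \<in> sets (borel_on {0..})" and "B \<in> sets borel"
  shows "emeasure (vertical_product \<nu>) {z. Re z \<in> A \<and> Im z \<in> B} =
    emeasure \<nu> A * emeasure lborel B"
proof -
  have A: "A \<in> sets borel" "A \<subseteq> {0..}"
    using assms(2) by (auto simp: borel_on_def sets_restrict_space_iff)
  have "{z. Re z \<in> A \<and> Im z \<in> B} = Re -` A \<inter> Im -` B"
    by auto
  also have "\<dots> \<in> sets borel"
    using A assms(3) measurable_sets_borel[of Re borel A] measurable_sets_borel[of Im borel B]
    by auto
  finally have "{z. Re z \<in> A \<and> Im z \<in> B} \<in> sets (borel_on (closure right_half_plane))"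
    using A unfolding borel_on_def
    by (subst sets_restrict_space_iff) (auto simp: closure_right_half_plane)
  moreover have "(\<lambda>(x, y). Complex x y) -` {z. Re z \<in> A \<and> Im z \<in> B} \<inter>
      space (\<nu> \<Otimes>\<^sub>M lborel) = A \<times> B"
    using A sets_eq_imp_space_eq[OF assms(1)] by (auto simp: space_pair_measure)
  ultimately show ?thesis
    using assms unfolding vertical_product_def
    by (subst emeasure_distr)
       (simp_all add: measurable_Complex_borel_on lborel.emeasure_pair_measure_Times)
qed

end

theory Submission
  imports Defs "HOL-Complex_Analysis.Cauchy_Integral_Formula" "HOL-Computational_Algebra.Polynomial"
begin

text \<open>The idea is that, in logarithmic coordinates, everything becomes Plancherel's identity on the line.
The substitution \<open>t = exp u\<close> in Euler's integral gives
\<open>Gamma (c + i y) = \<integral> exp (c u - exp u) exp (i y u) du\<close>, so the Gamma function on a vertical line is a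
Fourier transform. Expanding at the centre \<open>1\<close> of the disc, Vandermonde's convolution shows that the
Mellin-Bergman transform of \<open>\<zeta> ^ m\<close> is \<open>Gamma (z + m + 1) / ((m + 1)! Gamma (z + 1))\<close>. Hence, for a
polynomial \<open>p\<close> with coefficients \<open>c m\<close>, the function \<open>Gamma (z + 1) M p z\<close> is, on the line
\<open>Re z = x\<close>, the Fourier transform of \<open>\<phi> u exp (x u)\<close>, where \<open>\<phi> u\<close> is the sum of the
\<open>c m exp ((m + 1) u - exp u) / (m + 1)!\<close>.

The powers of \<open>2\<close> in the weight of the transform and in the masses of \<open>omega\<close> cancel, so that
Plancherel's identity on the lines \<open>Re z = n / 2\<close>, weighted by \<open>1 / n!\<close>, adds up to the integral of
\<open>|\<phi> u|\<^sup>2\<close> against the sum of the \<open>exp (n u) / n!\<close>, which is \<open>exp (exp u)\<close>. This factor cancels one of the two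
factors \<open>exp (- exp u)\<close>, the remaining integrals are factorials, and the result is, up to the factor
\<open>2 pi\<close>, the squared Bergman norm of \<open>p\<close> (\<open>poly_mellin_omega\<close>). Taylor polynomials at \<open>1\<close> are dense in the Bergman space
(\<open>taylor_poly_tendsto\<close>), and since \<open>exp (2 x u) \<le> exp (exp u)\<close> for \<open>0 \<le> x \<le> 1 / 2\<close>, the Bergman norm also
controls the \<open>L\<^sup>2\<close> norm on each line near the imaginary axis. This yields the boundary values
(\<open>boundary_value_exists\<close>) and lets the isometry pass to the limit (\<open>bergman_isometric_omega\<close>).

For the uniqueness, the reproducing kernel at a real point \<open>\<eta>\<close> of the disc has Mellin-Bergman transform
\<open>\<eta> powr (z - 1)\<close>. Testing the isometry on the kernels at \<open>\<eta> = 2 ^ (- k)\<close> prescribes the integrals of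
\<open>w x * 4 powr (- k x)\<close> against \<open>\<nu>(dx)\<close> for all \<open>k\<close>, where \<open>w\<close> is a fixed positive finite function. These are the
moments of the bounded variable \<open>4 powr (- x)\<close>; they determine its distribution, and hence \<open>\<nu>\<close>
(\<open>isometric_base_measure_unique\<close>).\<close>

section \<open>Square integrable functions\<close>

definition L2sq :: "'a measure \<Rightarrow> ('a \<Rightarrow> complex) \<Rightarrow> real" where
  "L2sq M F = (LINT z|M. (cmod (F z))\<^sup>2)"

lemma L2sq_nonneg [simp]: "0 \<le> L2sq M F"
  by (simp add: L2sq_def)

lemma square_integrableD:
  assumes "square_integrable M F"
  shows "F \<in> borel_measurable M" "integrable M (\<lambda>z. (cmod (F z))\<^sup>2)"
  using assms by (auto simp: square_integrable_def)

lemma cmod_add_sq_le: "(cmod (a + b))\<^sup>2 \<le> 2 * (cmod a)\<^sup>2 + 2 * (cmod b)\<^sup>2"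
proof -
  have "(cmod (a + b))\<^sup>2 \<le> (cmod a + cmod b)\<^sup>2"
    by (intro power_mono norm_triangle_ineq) auto
  also have "\<dots> \<le> 2 * (cmod a)\<^sup>2 + 2 * (cmod b)\<^sup>2"
    using sum_squares_bound[of "cmod a" "cmod b"] by (simp add: power2_sum)
  finally show ?thesis .
qed

lemma square_integrable_add:
  assumes "square_integrable M F" "square_integrable M G"
  shows "square_integrable M (\<lambda>z. F z + G z)"
proof -
  note [measurable] = assms[THEN square_integrableD(1)]
  have "integrable M (\<lambda>z. (cmod (F z + G z))\<^sup>2)"
    by (rule Bochner_Integration.integrable_bound
          [of M "\<lambda>z. 2 * (cmod (F z))\<^sup>2 + 2 * (cmod (G z))\<^sup>2"])
       (use assms in \<open>auto simp: square_integrable_def cmod_add_sq_le\<close>)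
  then show ?thesis by (simp add: square_integrable_def)
qed

lemma square_integrable_cmult:
  assumes "square_integrable M F"
  shows "square_integrable M (\<lambda>z. c * F z)"
  using assms by (auto simp: square_integrable_def norm_mult power_mult_distrib)

lemma square_integrable_uminus:
  assumes "square_integrable M F"
  shows "square_integrable M (\<lambda>z. - F z)"
  using assms by (auto simp: square_integrable_def)

lemma square_integrable_diff:
  assumes "square_integrable M F" "square_integrable M G"
  shows "square_integrable M (\<lambda>z. F z - G z)"
  using square_integrable_add[OF assms(1) square_integrable_uminus[OF assms(2)]] by simp

lemma borel_measurable_cnj [measurable]: "cnj \<in> borel_measurable borel"
  by (intro borel_measurable_continuous_onI continuous_intros)

lemma mult_le_sum_squares:
  fixes a b :: real
  assumes "0 \<le> a" "0 \<le> b"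
  shows "a * b \<le> a\<^sup>2 + b\<^sup>2"
  using sum_squares_bound[of a b] mult_nonneg_nonneg[OF assms] by linarith

lemma integrable_norm_mult_square_integrable:
  assumes "square_integrable M F" "square_integrable M G"
  shows "integrable M (\<lambda>z. cmod (F z) * cmod (G z))"
proof -
  note [measurable] = assms[THEN square_integrableD(1)]
  show ?thesis
    by (rule Bochner_Integration.integrable_bound
          [of M "\<lambda>z. (cmod (F z))\<^sup>2 + (cmod (G z))\<^sup>2"])
       (use assms in \<open>auto simp: square_integrable_def mult_le_sum_squares intro!: AE_I2\<close>)
qed

lemma integrable_inner_square_integrable:
  assumes "square_integrable M F" "square_integrable M G"
  shows "integrable M (\<lambda>z. F z * cnj (G z))"
proof -
  note [measurable] = assms[THEN square_integrableD(1)]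
  show ?thesis
    by (rule Bochner_Integration.integrable_bound[OF integrable_norm_mult_square_integrable[OF assms]])
       (auto simp: norm_mult)
qed

lemma L2sq_triangle:
  assumes "square_integrable M F" "square_integrable M G"
  shows "L2sq M (\<lambda>z. F z + G z) \<le> 2 * L2sq M F + 2 * L2sq M G"
proof -
  have "L2sq M (\<lambda>z. F z + G z) \<le> (LINT z|M. 2 * (cmod (F z))\<^sup>2 + 2 * (cmod (G z))\<^sup>2)"
    unfolding L2sq_def
    using assms square_integrable_add[OF assms]
    by (intro integral_mono) (auto simp: square_integrable_def cmod_add_sq_le)
  also have "\<dots> = 2 * L2sq M F + 2 * L2sq M G"
    using assms by (simp add: L2sq_def square_integrable_def)
  finally show ?thesis .
qed

lemma L2sq_diff_triangle:
  assumes "square_integrable M F" "square_integrable M G" "square_integrable M H"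
  shows "L2sq M (\<lambda>z. F z - H z) \<le> 2 * L2sq M (\<lambda>z. F z - G z) + 2 * L2sq M (\<lambda>z. G z - H z)"
  using L2sq_triangle[of M "\<lambda>z. F z - G z" "\<lambda>z. G z - H z"] assms
  by (simp add: square_integrable_diff)

lemma L2sq_commute: "L2sq M (\<lambda>z. F z - G z) = L2sq M (\<lambda>z. G z - F z)"
  by (simp add: L2sq_def norm_minus_commute)

text \<open>The discriminant argument: the integral of \<open>(|F| - t |G|)\<^sup>2\<close> is nonnegative for every real \<open>t\<close>.\<close>

lemma L2_Cauchy_Schwarz:
  assumes "square_integrable M F" "square_integrable M G"
  shows "(cmod (LINT z|M. F z * cnj (G z)))\<^sup>2 \<le> L2sq M F * L2sq M G"
proof -
  define B where "B = (LINT z|M. cmod (F z) * cmod (G z))"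
  have intB: "integrable M (\<lambda>z. cmod (F z) * cmod (G z))"
    by (rule integrable_norm_mult_square_integrable[OF assms])
  have B0: "0 \<le> B" by (simp add: B_def)
  have *: "0 \<le> L2sq M F - 2 * t * B + t\<^sup>2 * L2sq M G" for t
  proof -
    have "0 \<le> (LINT z|M. (cmod (F z) - t * cmod (G z))\<^sup>2)" by simp
    also have "(LINT z|M. (cmod (F z) - t * cmod (G z))\<^sup>2) =
        (LINT z|M. (cmod (F z))\<^sup>2 - 2 * t * (cmod (F z) * cmod (G z)) + t\<^sup>2 * (cmod (G z))\<^sup>2)"
      by (intro Bochner_Integration.integral_cong) (auto simp: power2_eq_square algebra_simps)
    also have "\<dots> = L2sq M F - 2 * t * B + t\<^sup>2 * L2sq M G"
      using assms intB unfolding B_def L2sq_def square_integrable_def by simp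
    finally show ?thesis .
  qed
  have "B\<^sup>2 \<le> L2sq M F * L2sq M G"
  proof (cases "L2sq M G = 0")
    case True
    have "B = 0"
    proof (rule ccontr)
      assume "B \<noteq> 0"
      with B0 *[of "(L2sq M F + 1) / (2 * B)"] True show False by simp
    qed
    then show ?thesis by (simp add: True)
  next
    case False
    then have pos: "0 < L2sq M G" using L2sq_nonneg[of M G] by linarith
    have "0 \<le> L2sq M F - B\<^sup>2 / L2sq M G"
      using *[of "B / L2sq M G"] pos by (simp add: power2_eq_square field_simps)
    then show ?thesis using pos by (simp add: field_simps)
  qed
  moreover have "cmod (LINT z|M. F z * cnj (G z)) \<le> B"
    unfolding B_def using integral_norm_bound[of M "\<lambda>z. F z * cnj (G z)"] by (simp add: norm_mult)
  then have "(cmod (LINT z|M. F z * cnj (G z)))\<^sup>2 \<le> B\<^sup>2"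
    by (intro power_mono) auto
  ultimately show ?thesis by linarith
qed

lemma L2_inner_tendsto:
  assumes F: "\<And>k. square_integrable M (F k)" "square_integrable M F'"
    and G: "\<And>k. square_integrable M (G k)" "square_integrable M G'"
    and "(\<lambda>k. L2sq M (\<lambda>z. F k z - F' z)) \<longlonglongrightarrow> 0"
    and "(\<lambda>k. L2sq M (\<lambda>z. G k z - G' z)) \<longlonglongrightarrow> 0"
  shows "(\<lambda>k. LINT z|M. F k z * cnj (G k z)) \<longlonglongrightarrow> (LINT z|M. F' z * cnj (G' z))"
proof -
  let ?a = "\<lambda>k. sqrt (L2sq M (\<lambda>z. F k z - F' z))"
  let ?b = "\<lambda>k. sqrt (L2sq M (\<lambda>z. G k z - G' z))"
  have CS: "cmod (LINT z|M. U z * cnj (V z)) \<le> sqrt (L2sq M U) * sqrt (L2sq M V)"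
    if "square_integrable M U" "square_integrable M V" for U V
    using L2_Cauchy_Schwarz[OF that] by (simp add: real_le_rsqrt flip: real_sqrt_mult)
  have bound: "cmod ((LINT z|M. F k z * cnj (G k z)) - (LINT z|M. F' z * cnj (G' z))) \<le>
      ?a k * sqrt (L2sq M G') + sqrt (L2sq M F') * ?b k + ?a k * ?b k" for k
  proof -
    let ?d = "\<lambda>z. F k z - F' z" and ?e = "\<lambda>z. G k z - G' z"
    have d: "square_integrable M ?d" and e: "square_integrable M ?e"
      using F G by (auto intro: square_integrable_diff)
    note I = integrable_inner_square_integrable
    have "(LINT z|M. F k z * cnj (G k z)) - (LINT z|M. F' z * cnj (G' z)) =
        (LINT z|M. F k z * cnj (G k z) - F' z * cnj (G' z))"
      using I[OF F(1) G(1)] I[OF F(2) G(2)] by simp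
    also have "\<dots> = (LINT z|M. ?d z * cnj (G' z) + F' z * cnj (?e z) + ?d z * cnj (?e z))"
      by (intro Bochner_Integration.integral_cong) (auto simp: algebra_simps)
    also have "\<dots> = (LINT z|M. ?d z * cnj (G' z)) + (LINT z|M. F' z * cnj (?e z))
        + (LINT z|M. ?d z * cnj (?e z))"
      using I[OF d G(2)] I[OF F(2) e] I[OF d e]
      by (subst Bochner_Integration.integral_add Bochner_Integration.integrable_add; force?)+
    finally have eq: "(LINT z|M. F k z * cnj (G k z)) - (LINT z|M. F' z * cnj (G' z)) =
        (LINT z|M. ?d z * cnj (G' z)) + (LINT z|M. F' z * cnj (?e z)) + (LINT z|M. ?d z * cnj (?e z))" .
    show ?thesis
      unfolding eq using CS[OF d G(2)] CS[OF F(2) e] CS[OF d e]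
        norm_triangle_ineq[of "(LINT z|M. ?d z * cnj (G' z)) + (LINT z|M. F' z * cnj (?e z))" "LINT z|M. ?d z * cnj (?e z)"]
        norm_triangle_ineq[of "LINT z|M. ?d z * cnj (G' z)" "LINT z|M. F' z * cnj (?e z)"]
      by linarith
  qed
  have "?a \<longlonglongrightarrow> 0" "?b \<longlonglongrightarrow> 0"
    using tendsto_real_sqrt[OF assms(5)] tendsto_real_sqrt[OF assms(6)] by simp_all
  then have "(\<lambda>k. ?a k * sqrt (L2sq M G') + sqrt (L2sq M F') * ?b k + ?a k * ?b k) \<longlonglongrightarrow> 0"
    using assms(5,6) by (auto intro!: tendsto_eq_intros)
  then have "(\<lambda>k. (LINT z|M. F k z * cnj (G k z)) - (LINT z|M. F' z * cnj (G' z))) \<longlonglongrightarrow> 0"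
    by (rule Lim_null_comparison[OF always_eventually[OF allI[OF bound]]])
  then show ?thesis by (simp add: LIM_zero_iff)
qed

lemma L2sq_tendsto:
  assumes F: "\<And>k. square_integrable M (F k)" "square_integrable M F'"
    and "(\<lambda>k. L2sq M (\<lambda>z. F k z - F' z)) \<longlonglongrightarrow> 0"
  shows "(\<lambda>k. L2sq M (F k)) \<longlonglongrightarrow> L2sq M F'"
proof -
  have "(LINT z|M. U z * cnj (U z)) = of_real (L2sq M U)" for U
    by (simp add: L2sq_def complex_norm_square[symmetric] flip: of_real_power)
  with L2_inner_tendsto[OF F F assms(3,3)] show ?thesis
    by (simp add: tendsto_of_real_iff)
qed

text \<open>This reduces the isometry on polynomials, which is an identity of inner products, to an identity of norms.\<close>

lemma L2_polarization:
  assumes "square_integrable M F" "square_integrable M G"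
  shows "(LINT z|M. F z * cnj (G z)) =
    (of_real (L2sq M (\<lambda>z. F z + G z)) - of_real (L2sq M (\<lambda>z. F z - G z))
     + \<i> * of_real (L2sq M (\<lambda>z. F z + \<i> * G z)) - \<i> * of_real (L2sq M (\<lambda>z. F z - \<i> * G z))) / 4"
proof -
  have sq: "of_real (L2sq M U) = (LINT z|M. U z * cnj (U z))" for U
    by (simp add: L2sq_def complex_norm_square[symmetric] flip: of_real_power)
  have iG: "square_integrable M (\<lambda>z. \<i> * G z)" 
    by (rule square_integrable_cmult[OF assms(2)])
  note I = integrable_inner_square_integrable
  have i: "integrable M (\<lambda>z. (F z + G z) * cnj (F z + G z))" "integrable M (\<lambda>z. (F z - G z) * cnj (F z - G z))"
    "integrable M (\<lambda>z. \<i> * ((F z + \<i> * G z) * cnj (F z + \<i> * G z)))" "integrable M (\<lambda>z. \<i> * ((F z - \<i> * G z) * cnj (F z - \<i> * G z)))"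
    using assms iG by (auto intro!: I integrable_mult_right square_integrable_add square_integrable_diff simp del: complex_cnj_add complex_cnj_diff)
  have "4 * (LINT z|M. F z * cnj (G z)) = (LINT z|M. 4 * (F z * cnj (G z)))" by simp
  also have "\<dots> = (LINT z|M. (F z + G z) * cnj (F z + G z) - (F z - G z) * cnj (F z - G z)
      + \<i> * ((F z + \<i> * G z) * cnj (F z + \<i> * G z)) - \<i> * ((F z - \<i> * G z) * cnj (F z - \<i> * G z)))"
    by (intro Bochner_Integration.integral_cong) (auto simp: algebra_simps)
  also have "\<dots> = (LINT z|M. (F z + G z) * cnj (F z + G z)) - (LINT z|M. (F z - G z) * cnj (F z - G z))
      + (LINT z|M. \<i> * ((F z + \<i> * G z) * cnj (F z + \<i> * G z))) - (LINT z|M. \<i> * ((F z - \<i> * G z) * cnj (F z - \<i> * G z)))"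
    using i by (simp del: complex_cnj_add complex_cnj_diff integral_mult_right_zero)
  finally show ?thesis unfolding sq by (simp only: integral_mult_right_zero) (simp add: mult.commute)
qed

lemma square_integrable_nn:
  assumes "F \<in> borel_measurable M" "(\<integral>\<^sup>+z. ennreal ((cmod (F z))\<^sup>2) \<partial>M) \<le> ennreal c" "0 \<le> c"
  shows "square_integrable M F" "L2sq M F \<le> c"
proof -
  note [measurable] = assms(1)
  have fin: "(\<integral>\<^sup>+z. ennreal ((cmod (F z))\<^sup>2) \<partial>M) < \<infinity>"
    using assms(2) by (simp add: le_less_trans)
  show sq: "square_integrable M F"
    using fin by (auto simp: square_integrable_def integrable_iff_bounded)
  have "ennreal (L2sq M F) \<le> ennreal c"
    using sq assms(2) unfolding L2sq_def square_integrable_def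
    by (subst nn_integral_eq_integral[symmetric]) auto
  then show "L2sq M F \<le> c" using assms(3) by simp
qed

lemma nn_L2sq:
  assumes "square_integrable M F"
  shows "(\<integral>\<^sup>+z. ennreal ((cmod (F z))\<^sup>2) \<partial>M) = ennreal (L2sq M F)"
  using assms unfolding L2sq_def square_integrable_def by (intro nn_integral_eq_integral) auto

text \<open>Approximations below are compared with limits that are only known pointwise; Fatou's lemma then
transfers norm bounds without any further convergence statement.\<close>

lemma L2sq_Fatou:
  assumes F: "\<And>j. square_integrable M (F j)"
    and H: "H \<in> borel_measurable M"
    and lim: "AE z in M. (\<lambda>j. F j z) \<longlonglongrightarrow> H z"
    and bound: "\<forall>\<^sub>F j in sequentially. L2sq M (F j) \<le> c"
  shows "square_integrable M H" "L2sq M H \<le> c"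
proof -
  note [measurable] = F[THEN square_integrableD(1)] H
  have c: "0 \<le> c"
    using eventually_happens[OF bound] order_trans[OF L2sq_nonneg] by auto
  have "(\<integral>\<^sup>+z. ennreal ((cmod (H z))\<^sup>2) \<partial>M) =
      (\<integral>\<^sup>+z. liminf (\<lambda>j. ennreal ((cmod (F j z))\<^sup>2)) \<partial>M)"
  proof (rule nn_integral_cong_AE)
    show "AE z in M. ennreal ((cmod (H z))\<^sup>2) = liminf (\<lambda>j. ennreal ((cmod (F j z))\<^sup>2))"
      using lim
    proof eventually_elim
      case (elim z)
      then have "(\<lambda>j. ennreal ((cmod (F j z))\<^sup>2)) \<longlonglongrightarrow> ennreal ((cmod (H z))\<^sup>2)"
        by (intro tendsto_ennrealI tendsto_power tendsto_norm)
      from lim_imp_Liminf[OF _ this] show ?case by simp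
    qed
  qed
  also have "\<dots> \<le> liminf (\<lambda>j. (\<integral>\<^sup>+z. ennreal ((cmod (F j z))\<^sup>2) \<partial>M))"
    by (rule nn_integral_liminf) auto
  also have "\<dots> = liminf (\<lambda>j. ennreal (L2sq M (F j)))"
    by (simp add: nn_L2sq F)
  also have "\<dots> \<le> ennreal c"
  proof -
    have "liminf (\<lambda>j. ennreal (L2sq M (F j))) \<le> liminf (\<lambda>j::nat. ennreal c)"
      using bound by (intro Liminf_mono) (auto elim!: eventually_mono intro: ennreal_leI)
    then show ?thesis by (simp add: Liminf_const)
  qed
  finally have "(\<integral>\<^sup>+z. ennreal ((cmod (H z))\<^sup>2) \<partial>M) \<le> ennreal c" .
  from square_integrable_nn[OF H this c] show "square_integrable M H" "L2sq M H \<le> c" .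
qed

text \<open>The Riesz-Fischer argument: along a rapidly Cauchy subsequence the increments are, almost
everywhere, eventually dominated by a geometric series.\<close>

lemma L2_complete:
  assumes F: "\<And>j. square_integrable M (F j)"
    and Cauchy: "\<And>e. 0 < e \<Longrightarrow> \<exists>N. \<forall>j\<ge>N. \<forall>k\<ge>N. L2sq M (\<lambda>z. F j z - F k z) \<le> e"
  shows "\<exists>H. square_integrable M H \<and> (\<lambda>k. L2sq M (\<lambda>z. F k z - H z)) \<longlonglongrightarrow> 0"
proof -
  note [measurable] = F[THEN square_integrableD(1)]
  obtain N where N: "\<And>i j k. j \<ge> N i \<Longrightarrow> k \<ge> N i \<Longrightarrow> L2sq M (\<lambda>z. F j z - F k z) \<le> (1/8) ^ i"
    using Cauchy[of "(1/8) ^ _"] by (simp add: zero_less_power) metis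
  define r where "r = (\<lambda>i. i + (\<Sum>j\<le>i. N j))"
  have rN: "r i \<ge> N i" for i
    using member_le_sum[of i "{..i}" N] by (simp add: r_def)
  \<comment> \<open>The sum makes \<open>r\<close> monotone, the summand \<open>i\<close> makes it unbounded.\<close>
  have rmono: "r i \<le> r (Suc i)" "i \<le> r i" for i
    by (auto simp: r_def)
  let ?d = "\<lambda>i z. F (r (Suc i)) z - F (r i) z"
  have d: "L2sq M (?d i) \<le> (1/8) ^ i" for i
    using N[OF order_trans[OF rN rmono(1)] rN] .
  have sqd: "square_integrable M (?d i)" for i
    by (intro square_integrable_diff F)
  \<comment> \<open>The factor \<open>4 ^ i\<close> is small enough for the sum of the norms to converge, and large enough
    to force \<open>|d i| \<le> 2 ^ (- i)\<close> eventually wherever the sum is finite.\<close>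
  have "(\<integral>\<^sup>+z. (\<Sum>i. ennreal (4 ^ i * (cmod (?d i z))\<^sup>2)) \<partial>M) =
      (\<Sum>i. \<integral>\<^sup>+z. ennreal (4 ^ i * (cmod (?d i z))\<^sup>2) \<partial>M)"
    by (rule nn_integral_suminf) measurable
  also have "\<dots> = (\<Sum>i. ennreal (4 ^ i) * ennreal (L2sq M (?d i)))"
    by (simp add: ennreal_mult nn_integral_cmult nn_L2sq[OF sqd])
  also have "\<dots> \<le> (\<Sum>i. ennreal ((1/2) ^ i))"
  proof (rule suminf_le)
    show "ennreal (4 ^ i) * ennreal (L2sq M (?d i)) \<le> ennreal ((1/2) ^ i)" for i
    proof -
      have "4 ^ i * L2sq M (?d i) \<le> 4 ^ i * (1/8) ^ i"
        using d[of i] by (intro mult_left_mono) auto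
      also have "\<dots> = (1/2::real) ^ i" by (simp flip: power_mult_distrib)
      finally show ?thesis by (simp add: ennreal_leI flip: ennreal_mult)
    qed
  qed auto
  also have "\<dots> = ennreal (\<Sum>i. (1/2) ^ i)"
    by (rule suminf_ennreal2) (auto intro: summable_geometric)
  also have "\<dots> < \<infinity>" by simp
  finally have "AE z in M. (\<Sum>i. ennreal (4 ^ i * (cmod (?d i z))\<^sup>2)) \<noteq> \<infinity>"
    by (intro nn_integral_PInf_AE) auto
  then have conv: "AE z in M. convergent (\<lambda>i. F (r i) z)"
  proof eventually_elim
    case (elim z)
    have sm: "summable (\<lambda>i. 4 ^ i * (cmod (?d i z))\<^sup>2)"
      using elim by (intro summable_suminf_not_top) auto
    then have "(\<lambda>i. 4 ^ i * (cmod (?d i z))\<^sup>2) \<longlonglongrightarrow> 0"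
      by (rule summable_LIMSEQ_zero)
    then have "\<forall>\<^sub>F i in sequentially. 4 ^ i * (cmod (?d i z))\<^sup>2 < 1"
      by (rule order_tendstoD) simp
    then have ev: "\<forall>\<^sub>F i in sequentially. norm (?d i z) \<le> (1/2) ^ i"
    proof eventually_elim
      case (elim i)
      have "(2 ^ i * cmod (?d i z))\<^sup>2 = (2 ^ i)\<^sup>2 * (cmod (?d i z))\<^sup>2"
        by (rule power_mult_distrib)
      also have "(2 ^ i)\<^sup>2 = (4 ^ i :: real)"
        by (simp add: power2_eq_square flip: power_mult_distrib)
      also have "4 ^ i * (cmod (?d i z))\<^sup>2 \<le> 1\<^sup>2" using elim by simp
      finally have "(2 ^ i * cmod (?d i z))\<^sup>2 \<le> 1\<^sup>2" .
      then have "2 ^ i * cmod (?d i z) \<le> 1"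
        by (rule power2_le_imp_le) simp
      then show ?case by (simp add: power_divide field_simps)
    qed
    have "summable (\<lambda>i. ?d i z)"
      by (rule summable_comparison_test_ev[OF ev]) (simp add: summable_geometric)
    then have "convergent (\<lambda>n. \<Sum>i<n. ?d i z)"
      by (simp add: summable_iff_convergent)
    moreover have "(\<Sum>i<n. ?d i z) = F (r n) z - F (r 0) z" for n
      by (simp add: sum_lessThan_telescope[of "\<lambda>i. F (r i) z"])
    ultimately have "convergent (\<lambda>n. F (r n) z - F (r 0) z)" by simp
    then show ?case by (simp add: convergent_diff_const_right_iff)
  qed
  define H where "H z = lim (\<lambda>i. F (r i) z)" for z
  have [measurable]: "H \<in> borel_measurable M"
    unfolding H_def by measurable
  have lim: "AE z in M. (\<lambda>i. F (r i) z) \<longlonglongrightarrow> H z"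
    using conv by eventually_elim (simp add: H_def convergent_LIMSEQ_iff)
  have tail: "square_integrable M (\<lambda>z. F k z - H z) \<and> L2sq M (\<lambda>z. F k z - H z) \<le> (1/8) ^ i"
    if k: "k \<ge> N i" for i k
  proof -
    have sqi: "square_integrable M (\<lambda>z. F k z - F (r j) z)" for j
      by (intro square_integrable_diff F)
    have "\<forall>\<^sub>F j in sequentially. L2sq M (\<lambda>z. F k z - F (r j) z) \<le> (1/8) ^ i"
      unfolding eventually_sequentially
      using N[OF k] rmono(2) order_trans by blast
    moreover have "AE z in M. (\<lambda>j. F k z - F (r j) z) \<longlonglongrightarrow> F k z - H z"
      using lim by eventually_elim (intro tendsto_intros)
    ultimately show ?thesis
      using L2sq_Fatou[of M "\<lambda>j z. F k z - F (r j) z" "\<lambda>z. F k z - H z", OF sqi] by auto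
  qed
  have "square_integrable M H"
    using square_integrable_diff[OF F[of "N 0"] conjunct1[OF tail[of 0 "N 0"]]] by simp
  moreover have "(\<lambda>k. L2sq M (\<lambda>z. F k z - H z)) \<longlonglongrightarrow> 0"
  proof (rule LIMSEQ_I)
    fix e :: real assume "0 < e"
    then obtain i where i: "(1/8::real) ^ i < e"
      using real_arch_pow_inv[of e "1/8"] by auto
    show "\<exists>no. \<forall>k\<ge>no. norm (L2sq M (\<lambda>z. F k z - H z) - 0) < e"
      using tail i by (intro exI[of _ "N i"]) (auto intro: le_less_trans)
  qed
  ultimately show ?thesis by blast
qed

section \<open>Plancherel's identity on the line\<close>

text \<open>The sign of the exponent is that of characteristic functions of distributions.\<close>

definition fourier :: "(real \<Rightarrow> complex) \<Rightarrow> real \<Rightarrow> complex" where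
  "fourier \<phi> y = (LINT u|lborel. \<phi> u * iexp (y * u))"

lemma integrable_lborel_tensor:
  fixes f g :: "real \<Rightarrow> complex"
  assumes "integrable lborel f" "integrable lborel g"
  shows "integrable (lborel \<Otimes>\<^sub>M lborel) (\<lambda>(x, y). f x * g y)"
proof -
  note [measurable] = borel_measurable_integrable[OF assms(1)] borel_measurable_integrable[OF assms(2)]
  show ?thesis
    by (rule lborel_pair.Fubini_integrable)
       (use assms in \<open>auto simp: norm_mult\<close>)
qed

lemma integrable_mult_iexp:
  assumes "integrable lborel f"
  shows "integrable lborel (\<lambda>u. f u * iexp (y * u))"
proof -
  note [measurable] = borel_measurable_integrable[OF assms]
  show ?thesis
    by (rule Bochner_Integration.integrable_bound[OF assms]) (auto simp: norm_mult)
qed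

text \<open>Fubini's theorem. The integrand is symmetric in the roles of \<open>f\<close> and \<open>g\<close>.\<close>

lemma fourier_multiplication_formula:
  assumes "integrable lborel f" "integrable lborel g"
  shows "(LINT y|lborel. fourier f y * g y) = (LINT u|lborel. f u * fourier g u)"
proof -
  note [measurable] = borel_measurable_integrable[OF assms(1)] borel_measurable_integrable[OF assms(2)]
  have "integrable (lborel \<Otimes>\<^sub>M lborel) (\<lambda>(u, y). f u * g y * iexp (y * u))"
    by (rule Bochner_Integration.integrable_bound[OF integrable_lborel_tensor[OF assms]])
       (auto simp: norm_mult)
  then have "(LINT y|lborel. LINT u|lborel. f u * g y * iexp (y * u)) =
      (LINT u|lborel. LINT y|lborel. f u * g y * iexp (y * u))"
    by (rule lborel_pair.Fubini_integral)
  moreover have "(LINT u|lborel. f u * g y * iexp (y * u)) = fourier f y * g y" for y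
    unfolding fourier_def integral_mult_left_zero[symmetric] by (simp only: mult_ac)
  moreover have "(LINT y|lborel. f u * g y * iexp (y * u)) = f u * fourier g u" for u
    unfolding fourier_def integral_mult_right_zero[symmetric] by (simp only: mult_ac)
  ultimately show ?thesis by simp
qed

lemma norm_fourier_le: "cmod (fourier f y) \<le> (LINT u|lborel. cmod (f u))"
  unfolding fourier_def using integral_norm_bound[of lborel "\<lambda>u. f u * iexp (y * u)"]
  by (simp add: norm_mult)

lemma borel_measurable_fourier [measurable]:
  assumes [measurable]: "f \<in> borel_measurable lborel"
  shows "fourier f \<in> borel_measurable lborel"
  unfolding fourier_def by measurable

lemma fourier_std_normal: "fourier (\<lambda>y. of_real (std_normal_density y)) t = of_real (exp (- t\<^sup>2 / 2))"
proof -
  have "char std_normal_distribution t = (LINT x|lborel. std_normal_density x *\<^sub>R iexp (t * x))"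
    unfolding char_def by (subst integral_density) auto
  then show ?thesis
    unfolding fourier_def char_std_normal_distribution by (simp add: scaleR_conv_of_real)
qed

lemma fourier_scaled_modulated_normal:
  assumes "0 < e"
  shows "fourier (\<lambda>y. of_real (std_normal_density (e * y)) * iexp (y * u)) v =
    of_real (exp (- ((u + v) / e)\<^sup>2 / 2) / e)"
proof -
  have "fourier (\<lambda>y. of_real (std_normal_density (e * y)) * iexp (y * u)) v =
      (LINT y|lborel. of_real (std_normal_density (e * y)) * iexp (((u + v) / e) * (0 + e * y)))"
    unfolding fourier_def
  proof (intro Bochner_Integration.integral_cong refl)
    fix y :: real
    have "((u + v) / e) * (0 + e * y) = y * u + v * y"
      using assms by (simp add: field_simps)
    then show "of_real (std_normal_density (e * y)) * iexp (y * u) * iexp (v * y) =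
        of_real (std_normal_density (e * y)) * iexp (((u + v) / e) * (0 + e * y))"
      by (simp only: of_real_add ring_distribs exp_add mult.assoc)
  qed
  also have "\<dots> = of_real (1 / e) * fourier (\<lambda>y. of_real (std_normal_density y)) ((u + v) / e)"
    unfolding fourier_def
    using lborel_integral_real_affine[of e "\<lambda>y. of_real (std_normal_density y) * iexp (((u + v) / e) * y)" 0] assms
    by (simp add: scaleR_conv_of_real)
  finally show ?thesis by (simp add: fourier_std_normal)
qed

text \<open>Gaussian regularisation: \<open>|fourier \<phi>|\<^sup>2\<close> is multiplied by a normal density of large variance, and the
multiplication formula, used twice, turns the integral into one of \<open>\<phi>\<close> against a convolution of \<open>\<phi>\<close> with
a narrow Gaussian. Both sides converge by dominated convergence, the convolution because \<open>\<phi>\<close> is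
bounded and continuous, the product because \<open>|fourier \<phi>|\<^sup>2\<close> itself dominates it.\<close>

lemma Plancherel_continuous:
  fixes \<phi> :: "real \<Rightarrow> complex"
  assumes int: "integrable lborel \<phi>" and cont: "continuous_on UNIV \<phi>"
    and bound: "\<And>u. cmod (\<phi> u) \<le> B" and sq: "square_integrable lborel (fourier \<phi>)"
  shows "square_integrable lborel \<phi>" "L2sq lborel (fourier \<phi>) = 2 * pi * L2sq lborel \<phi>"
proof -
  have [measurable]: "\<phi> \<in> borel_measurable borel"
    using borel_measurable_integrable[OF int] by simp
  have B0: "0 \<le> B" using order_trans[OF norm_ge_zero bound[of 0]] .
  show sq\<phi>: "square_integrable lborel \<phi>"
    unfolding square_integrable_def
  proof
    show "integrable lborel (\<lambda>z. (cmod (\<phi> z))\<^sup>2)"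
      by (rule Bochner_Integration.integrable_bound[OF integrable_mult_right[OF int, of "of_real B"]])
         (auto simp: norm_mult power2_eq_square B0 bound intro!: mult_right_mono)
  qed simp
  define e :: "nat \<Rightarrow> real" where "e n = 1 / real (Suc n)" for n
  have e0: "0 < e n" for n by (simp add: e_def)
  have elim: "e \<longlonglongrightarrow> 0" unfolding e_def by (rule LIMSEQ_Suc[OF lim_1_over_n])
  define G where "G n y = cnj (fourier \<phi> y) * of_real (std_normal_density (e n * y))" for n y
  \<comment> \<open>The conjugate of the transform of \<open>\<phi>\<close> is the transform of the reflected conjugate, so the
    multiplication formula also applies to it.\<close>
  define \<phi>' where "\<phi>' v = cnj (\<phi> (- v))" for v
  have [measurable]: "\<phi>' \<in> borel_measurable borel" unfolding \<phi>'_def by measurable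
  have int': "integrable lborel \<phi>'"
    using lborel_integrable_real_affine[of "\<lambda>v. cnj (\<phi> v)" "-1" 0] int
    unfolding \<phi>'_def by simp
  have ft': "fourier \<phi>' y = cnj (fourier \<phi> y)" for y
  proof -
    have "cnj (fourier \<phi> y) = (LINT u|lborel. cnj (\<phi> u * iexp (y * u)))"
      unfolding fourier_def by (rule Bochner_Integration.integral_cnj[symmetric])
    also have "\<dots> = (LINT u|lborel. cnj (\<phi> u) * iexp (- y * u))"
      by (simp add: exp_cnj)
    also have "\<dots> = fourier \<phi>' y"
      unfolding fourier_def \<phi>'_def
      by (subst lborel_integral_real_affine[of "-1" _ 0]) auto
    finally show ?thesis ..
  qed
  have intN: "integrable lborel (\<lambda>y. complex_of_real (std_normal_density (e n * y)))" for n
    using lborel_integrable_real_affine[of "\<lambda>y. complex_of_real (std_normal_density y)" "e n" 0] e0[of n]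
    by (auto intro: integrable_normal_density)
  have intG: "integrable lborel (G n)" for n
    unfolding G_def
    by (rule Bochner_Integration.integrable_bound
          [OF integrable_mult_right[OF intN[of n], of "of_real (LINT u|lborel. cmod (\<phi> u))"]])
       (auto simp: norm_mult intro!: mult_right_mono norm_fourier_le)
  \<comment> \<open>After rescaling, a Gaussian mean of \<open>cnj \<phi>\<close> about \<open>u\<close> at scale \<open>e n\<close>.\<close>
  have ftG: "fourier (G n) u = (LINT w|lborel. cnj (\<phi> (u - e n * w)) * of_real (exp (- w\<^sup>2 / 2)))" for n u
  proof -
    have "fourier (G n) u = (LINT y|lborel. fourier \<phi>' y * (of_real (std_normal_density (e n * y)) * iexp (y * u)))"
      unfolding fourier_def[of "G n"] G_def ft' by (simp add: mult_ac)
    also have "\<dots> = (LINT v|lborel. \<phi>' v * fourier (\<lambda>y. of_real (std_normal_density (e n * y)) * iexp (y * u)) v)"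
      by (rule fourier_multiplication_formula[OF int'])
         (use integrable_mult_iexp[OF intN[of n], of u] in \<open>simp add: mult.commute\<close>)
    also have "\<dots> = (LINT v|lborel. \<phi>' v * of_real (exp (- ((u + v) / e n)\<^sup>2 / 2) / e n))"
      by (simp only: fourier_scaled_modulated_normal[OF e0])
    also have "\<dots> = (LINT w|lborel. cnj (\<phi> (u - e n * w)) * of_real (exp (- w\<^sup>2 / 2)))"
      using e0[of n]
      by (subst lborel_integral_real_affine[of "e n" _ "- u"])
         (auto simp: \<phi>'_def scaleR_conv_of_real)
    finally show ?thesis .
  qed
  have intE: "integrable lborel (\<lambda>w. complex_of_real (exp (- w\<^sup>2 / 2)))"
    and valE: "(LINT w|lborel. complex_of_real (exp (- w\<^sup>2 / 2))) = of_real (sqrt (2 * pi))"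
  proof -
    have *: "exp (- w\<^sup>2 / 2) = sqrt (2 * pi) * std_normal_density w" for w :: real
      by (simp add: std_normal_density_def)
    show "integrable lborel (\<lambda>w. complex_of_real (exp (- w\<^sup>2 / 2)))"
      unfolding * by (auto intro: integrable_normal_density)
    show "(LINT w|lborel. complex_of_real (exp (- w\<^sup>2 / 2))) = of_real (sqrt (2 * pi))"
      unfolding * integral_complex_of_real by (simp add: integral_normal_density)
  qed
  have ftG_lim: "(\<lambda>n. fourier (G n) u) \<longlonglongrightarrow> of_real (sqrt (2 * pi)) * cnj (\<phi> u)" for u
  proof -
    have "(\<lambda>n. LINT w|lborel. cnj (\<phi> (u - e n * w)) * of_real (exp (- w\<^sup>2 / 2))) \<longlonglongrightarrow>
        (LINT w|lborel. cnj (\<phi> u) * of_real (exp (- w\<^sup>2 / 2)))"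
    proof (rule integral_dominated_convergence[where w = "\<lambda>w. B * exp (- w\<^sup>2 / 2)"])
      show "integrable lborel (\<lambda>w. B * exp (- w\<^sup>2 / 2))"
        using intE unfolding complex_of_real_integrable_eq by (rule integrable_mult_right)
      show "AE w in lborel. (\<lambda>n. cnj (\<phi> (u - e n * w)) * of_real (exp (- w\<^sup>2 / 2))) \<longlonglongrightarrow>
          cnj (\<phi> u) * of_real (exp (- w\<^sup>2 / 2))"
      proof (intro AE_I2 tendsto_mult tendsto_const tendsto_cnj)
        fix w
        have "(\<lambda>n. u - e n * w) \<longlonglongrightarrow> u" using elim by (auto intro!: tendsto_eq_intros)
        then show "(\<lambda>n. \<phi> (u - e n * w)) \<longlonglongrightarrow> \<phi> u"
          using cont by (intro continuous_on_tendsto_compose[OF cont]) auto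
      qed
    qed (auto simp: norm_mult bound intro!: mult_right_mono)
    then show ?thesis
      by (simp only: ftG integral_mult_right_zero valE mult.commute)
  qed
  have lim1: "(\<lambda>n. LINT u|lborel. \<phi> u * fourier (G n) u) \<longlonglongrightarrow>
      (LINT u|lborel. \<phi> u * (of_real (sqrt (2 * pi)) * cnj (\<phi> u)))"
  proof (rule integral_dominated_convergence[where w = "\<lambda>u. cmod (\<phi> u) * (B * sqrt (2 * pi))"])
    have "G n \<in> borel_measurable lborel" for n using borel_measurable_integrable[OF intG] .
    then show "(\<lambda>u. \<phi> u * fourier (G n) u) \<in> borel_measurable lborel" for n
      by (intro borel_measurable_times borel_measurable_fourier) auto
    have "cmod (fourier (G n) u) \<le> (LINT w|lborel. B * exp (- w\<^sup>2 / 2))" for n u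
    proof -
      have "cmod (fourier (G n) u) \<le> (LINT w|lborel. cmod (cnj (\<phi> (u - e n * w)) * of_real (exp (- w\<^sup>2 / 2))))"
        unfolding ftG by (rule integral_norm_bound)
      also have "\<dots> \<le> (LINT w|lborel. B * exp (- w\<^sup>2 / 2))"
        using intE unfolding complex_of_real_integrable_eq
        by (intro integral_mono_AE' AE_I2 integrable_mult_right)
           (auto simp: norm_mult bound B0 intro!: mult_right_mono)
      finally show ?thesis .
    qed
    also have "(LINT w|lborel. B * exp (- w\<^sup>2 / 2)) = B * sqrt (2 * pi)"
      using valE unfolding integral_complex_of_real of_real_eq_iff by simp
    finally show "AE u in lborel. norm (\<phi> u * fourier (G n) u) \<le> cmod (\<phi> u) * (B * sqrt (2 * pi))" for n
      by (auto simp: norm_mult intro!: mult_left_mono)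
    show "AE u in lborel. (\<lambda>n. \<phi> u * fourier (G n) u) \<longlonglongrightarrow> \<phi> u * (of_real (sqrt (2 * pi)) * cnj (\<phi> u))"
      by (intro AE_I2 tendsto_mult ftG_lim tendsto_const)
  qed (use int in auto)
  have val: "(LINT u|lborel. \<phi> u * (of_real (sqrt (2 * pi)) * cnj (\<phi> u))) =
      of_real (sqrt (2 * pi) * L2sq lborel \<phi>)"
    unfolding L2sq_def
    by (simp add: mult.left_commute[of "\<phi> _"] complex_norm_square[symmetric]
             flip: of_real_power of_real_mult del: of_real_mult of_real_power)
  have swap: "(LINT u|lborel. \<phi> u * fourier (G n) u) = (LINT y|lborel. fourier \<phi> y * G n y)" for n
    by (rule fourier_multiplication_formula[OF int intG, symmetric])
  have lim2: "(\<lambda>n. LINT y|lborel. fourier \<phi> y * G n y) \<longlonglongrightarrow>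
      (LINT y|lborel. of_real ((cmod (fourier \<phi> y))\<^sup>2 * (1 / sqrt (2 * pi))))"
  proof (rule integral_dominated_convergence[where w = "\<lambda>y. (cmod (fourier \<phi> y))\<^sup>2 * (1 / sqrt (2 * pi))"])
    have eq: "fourier \<phi> y * G n y = of_real ((cmod (fourier \<phi> y))\<^sup>2 * std_normal_density (e n * y))" for n y
      by (simp add: G_def complex_norm_square del: of_real_power)
    have le: "std_normal_density t \<le> 1 / sqrt (2 * pi)" for t
      by (simp add: std_normal_density_def divide_right_mono)
    show "AE y in lborel. norm (fourier \<phi> y * G n y) \<le> (cmod (fourier \<phi> y))\<^sup>2 * (1 / sqrt (2 * pi))" for n
      unfolding eq norm_of_real by (auto simp: abs_mult le intro!: mult_left_mono simp del: times_divide_eq_right)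
    show "AE y in lborel. (\<lambda>n. fourier \<phi> y * G n y) \<longlonglongrightarrow> of_real ((cmod (fourier \<phi> y))\<^sup>2 * (1 / sqrt (2 * pi)))"
      unfolding eq
    proof (intro AE_I2 tendsto_of_real tendsto_mult tendsto_const)
      fix y
      have "(\<lambda>n. 1 / sqrt (2 * pi) * exp (- (e n * y)\<^sup>2 / 2)) \<longlonglongrightarrow> 1 / sqrt (2 * pi) * exp (- (0 * y)\<^sup>2 / 2)"
        by (intro tendsto_intros elim) auto
      then show "(\<lambda>n. std_normal_density (e n * y)) \<longlonglongrightarrow> 1 / sqrt (2 * pi)"
        by (simp add: std_normal_density_def)
    qed
    show "(\<lambda>y. fourier \<phi> y * G n y) \<in> borel_measurable lborel" for n
      unfolding G_def by measurable
  qed (use sq in \<open>auto simp: square_integrable_def\<close>)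
  have "of_real (sqrt (2 * pi) * L2sq lborel \<phi>) =
      (LINT y|lborel. complex_of_real ((cmod (fourier \<phi> y))\<^sup>2 * (1 / sqrt (2 * pi))))"
    by (rule LIMSEQ_unique[OF lim1[unfolded val swap] lim2])
  then have "sqrt (2 * pi) * L2sq lborel \<phi> = L2sq lborel (fourier \<phi>) / sqrt (2 * pi)"
    unfolding integral_complex_of_real of_real_eq_iff by (simp add: L2sq_def)
  then have "sqrt (2 * pi) * sqrt (2 * pi) * L2sq lborel \<phi> = L2sq lborel (fourier \<phi>)"
    by (simp add: field_simps)
  then show "L2sq lborel (fourier \<phi>) = 2 * pi * L2sq lborel \<phi>"
    by simp
qed

section \<open>The Gamma function on vertical lines\<close>

text \<open>Euler's integral as a Lebesgue integral; the substitution rule for improper integrals needs it in this form.\<close>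

lemma set_integrable_Gamma:
  assumes "0 < Re z"
  shows "set_integrable lborel {0<..} (\<lambda>t. of_real t powr (z - 1) / of_real (exp t))"
proof -
  have [measurable]: "(\<lambda>t. indicator {0<..} t *\<^sub>R (complex_of_real t powr (z - 1) / of_real (exp t))) \<in> borel_measurable borel"
    by (intro borel_measurable_continuous_on_indicator continuous_intros) auto
  show ?thesis
    using absolutely_integrable_Gamma_integral'[OF assms]
    unfolding set_integrable_def by (subst (asm) integrable_completion) auto
qed

lemma set_integral_Gamma:
  assumes "0 < Re z"
  shows "(LINT t:{0<..}|lborel. of_real t powr (z - 1) / of_real (exp t)) = Gamma z"
  using set_borel_integral_eq_integral(2)[OF set_integrable_Gamma[OF assms]]
    Gamma_integral_complex'[OF assms] by (simp add: integral_unique)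

lemma powr_log_substitution:
  assumes "0 < x"
  shows "(of_real (exp (c * ln x - exp (ln x))) * iexp (y * ln x)) * inverse (of_real x) =
    of_real x powr (Complex c y - 1) / of_real (exp x)"
proof -
  have "of_real x powr (Complex c y - 1) = exp (of_real (c * ln x)) * iexp (y * ln x) * inverse (complex_of_real x)"
  proof -
    have "(Complex c y - 1) * of_real (ln x) = of_real (c * ln x) + \<i> * of_real (y * ln x) + - of_real (ln x)"
      by (simp add: complex_eq_iff algebra_simps)
    then have "of_real x powr (Complex c y - 1) = exp (of_real (c * ln x) + \<i> * of_real (y * ln x) + - of_real (ln x))"
      using assms by (simp add: powr_def Ln_of_real)
    also have "exp (- complex_of_real (ln x)) = inverse (of_real x)"
      using assms by (simp add: exp_minus exp_of_real)
    ultimately show ?thesis by (simp only: exp_add)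
  qed
  moreover have "complex_of_real (exp (c * ln x - exp (ln x))) = exp (of_real (c * ln x)) / of_real (exp x)"
    using assms by (simp only: exp_diff exp_of_real of_real_divide exp_ln)
  ultimately show ?thesis by (simp only: divide_inverse mult_ac)
qed

text \<open>The substitution \<open>u = ln t\<close> in Euler's integral. Its direction matters: the integrability over
the half-line is known, and the one over the whole line is derived from it.\<close>

lemma
  fixes c y :: real
  assumes c: "0 < c"
  shows integrable_exp_linear_minus_exp: "integrable lborel (\<lambda>u. exp (c * u - exp u))"
    and fourier_exp_linear_minus_exp: "fourier (\<lambda>u. of_real (exp (c * u - exp u))) y = Gamma (Complex c y)"
proof -
  have A: "((ereal \<circ> ln \<circ> real_of_ereal) \<longlongrightarrow> - \<infinity>) (at_right 0)"
    unfolding zero_ereal_def ereal_tendsto_simps by (rule ln_at_0)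
  have B: "((ereal \<circ> ln \<circ> real_of_ereal) \<longlongrightarrow> \<infinity>) (at_left \<infinity>)"
    unfolding ereal_tendsto_simps by (rule ln_at_top)
  have U: "einterval 0 \<infinity> = {0<..}" by (auto simp: einterval_def)
  have s: "set_integrable lborel {0<..} (\<lambda>x. (of_real (exp (c * ln x - exp (ln x))) * iexp (y * ln x)) * inverse (of_real x))" for y
    using set_integrable_Gamma[of "Complex c y"] c
    by (subst set_integrable_cong[OF refl refl powr_log_substitution]) auto
  have "set_integrable lborel {0<..} (\<lambda>x. cmod ((of_real (exp (c * ln x - exp (ln x))) * iexp (0 * ln x)) * inverse (of_real x)))"
    by (rule set_integrable_norm[OF s])
  then have s': "set_integrable lborel {0<..} (\<lambda>x. exp (c * ln x - exp (ln x)) * inverse x)"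
    by (rule set_integrable_cong[THEN iffD1, rotated -1]) (auto simp: norm_mult norm_inverse)
  have deriv: "DERIV ln x :> inverse x" if "0 < ereal x" "ereal x < \<infinity>" for x
    using that DERIV_ln[of x] by simp
  have contg: "isCont inverse x" if "0 < ereal x" "ereal x < \<infinity>" for x :: real
    using that by (intro continuous_intros) auto
  have nonneg: "0 \<le> inverse x" if "0 \<le> ereal x" "ereal x \<le> \<infinity>" for x :: real
    using that by simp
  have "set_integrable lborel (einterval (-\<infinity>) \<infinity>) (\<lambda>u. exp (c * u - exp u))"
  proof (rule interval_integral_substitution_nonneg(1)[OF _ deriv _ contg _ nonneg A B])
    show "isCont (\<lambda>u. exp (c * u - exp u)) (ln x)" for x :: real
      by (intro continuous_intros)
    show "set_integrable lborel (einterval 0 \<infinity>) (\<lambda>x. exp (c * ln x - exp (ln x)) * inverse x)"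
      unfolding U by (rule s')
  qed simp_all
  then show int: "integrable lborel (\<lambda>u. exp (c * u - exp u))"
    by (simp add: set_integrable_def)
  have int2: "integrable lborel (\<lambda>u. of_real (exp (c * u - exp u)) * iexp (y * u))"
    by (rule integrable_mult_iexp) (use int in \<open>simp add: complex_of_real_integrable_eq\<close>)
  have "(LBINT u=-\<infinity>..\<infinity>. of_real (exp (c * u - exp u)) * iexp (y * u)) =
      (LBINT x=0..\<infinity>. inverse x *\<^sub>R (of_real (exp (c * ln x - exp (ln x))) * iexp (y * ln x)))"
  proof (rule interval_integral_substitution_integrable[OF _ deriv _ contg nonneg A B])
    show "isCont (\<lambda>u. of_real (exp (c * u - exp u)) * iexp (y * u)) (ln x)" for x :: real
      by (intro continuous_intros)
    show "set_integrable lborel (einterval 0 \<infinity>)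
        (\<lambda>x. inverse x *\<^sub>R (of_real (exp (c * ln x - exp (ln x))) * iexp (y * ln x)))"
      using s[of y] unfolding U by (simp add: scaleR_conv_of_real mult.commute)
    show "set_integrable lborel (einterval (-\<infinity>) \<infinity>) (\<lambda>u. of_real (exp (c * u - exp u)) * iexp (y * u))"
      using int2 by (simp add: set_integrable_def)
  qed simp_all
  also have "\<dots> = (LINT x:{0<..}|lborel. of_real x powr (Complex c y - 1) / of_real (exp x))"
    unfolding interval_lebesgue_integral_def U
    by (simp, intro set_lebesgue_integral_cong)
       (auto simp: scaleR_conv_of_real simp flip: powr_log_substitution)
  also have "\<dots> = Gamma (Complex c y)"
    by (rule set_integral_Gamma) (simp add: c)
  finally show "fourier (\<lambda>u. of_real (exp (c * u - exp u))) y = Gamma (Complex c y)"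
    by (simp add: fourier_def interval_lebesgue_integral_def set_lebesgue_integral_def)
qed

lemma integral_exp_linear_minus_exp:
  fixes c :: real
  assumes "0 < c"
  shows "(LINT u|lborel. exp (c * u - exp u)) = Gamma c"
proof -
  have "complex_of_real (LINT u|lborel. exp (c * u - exp u)) = Gamma (Complex c 0)"
    using fourier_exp_linear_minus_exp[OF assms, of 0] by (simp add: fourier_def)
  then show ?thesis
    by (simp add: Complex_eq Gamma_complex_of_real)
qed

lemma cmod_Gamma_le:
  assumes "0 < Re z"
  shows "cmod (Gamma z) \<le> Gamma (Re z)"
  using norm_fourier_le[of "\<lambda>u. of_real (exp (Re z * u - exp u))" "Im z"] assms
  by (simp add: fourier_exp_linear_minus_exp integral_exp_linear_minus_exp)

text \<open>The recurrence \<open>Gamma (z + 2) = (z + 1) z Gamma z\<close> converts the boundedness of the Gamma function on vertical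
lines into quadratic decay, which makes them square integrable there.\<close>

lemma cmod_Gamma_le_decay:
  assumes "1 \<le> Re z"
  shows "cmod (Gamma z) \<le> Gamma (Re z + 2) / (1 + (Im z)\<^sup>2)"
proof -
  have nz: "z \<noteq> 0" "z + 1 \<noteq> 0" using assms by (auto simp: complex_eq_iff)
  have "z \<notin> \<int>\<^sub>\<le>\<^sub>0" "z + 1 \<notin> \<int>\<^sub>\<le>\<^sub>0" using assms by (auto elim!: nonpos_Ints_cases simp: complex_eq_iff)
  then have "Gamma (z + 2) = (z + 1) * (z * Gamma z)"
    using Gamma_plus1[of z] Gamma_plus1[of "z + 1"] nz
    by (simp add: add.assoc nonpos_Ints_def)
  then have "cmod (z + 1) * cmod z * cmod (Gamma z) = cmod (Gamma (z + 2))"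
    by (simp add: norm_mult)
  also have "\<dots> \<le> Gamma (Re z + 2)"
    using cmod_Gamma_le[of "z + 2"] assms by simp
  finally have *: "cmod (z + 1) * cmod z * cmod (Gamma z) \<le> Gamma (Re z + 2)" .
  have "1 + (Im z)\<^sup>2 \<le> (Re z)\<^sup>2 + (Im z)\<^sup>2"
    using assms by (simp add: power2_eq_square) (metis mult_mono zero_le_one mult_1 order_trans)
  also have "\<dots> = cmod z * cmod z" by (simp add: cmod_power2 flip: power2_eq_square)
  also have "\<dots> \<le> cmod (z + 1) * cmod z"
    using assms by (intro mult_right_mono) (auto simp: cmod_def power2_eq_square algebra_simps)
  finally have "(1 + (Im z)\<^sup>2) * cmod (Gamma z) \<le> cmod (z + 1) * cmod z * cmod (Gamma z)"
    by (intro mult_right_mono) auto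
  with * have "(1 + (Im z)\<^sup>2) * cmod (Gamma z) \<le> Gamma (Re z + 2)" by linarith
  moreover have "0 < 1 + (Im z)\<^sup>2" by (simp add: add_pos_nonneg)
  ultimately show ?thesis by (simp add: field_simps)
qed

lemma integrable_inverse_one_plus_square: "integrable lborel (\<lambda>y::real. 1 / (1 + y\<^sup>2))"
  using integrable_inverse_1_plus_square by (simp add: set_integrable_def inverse_eq_divide)

section \<open>Sums of shifted Gamma functions\<close>

text \<open>This is \<open>Gamma (z + 1)\<close> times the Mellin-Bergman transform of \<open>p\<close>, see \<open>weighted_mellin_poly\<close>. Unlike the
transform, it makes sense on the imaginary axis.\<close>

definition gamma_sum :: "complex poly \<Rightarrow> complex \<Rightarrow> complex" where
  "gamma_sum p z = (\<Sum>m\<le>degree p. coeff p m / fact (Suc m) * Gamma (of_nat (Suc m) + z))"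

text \<open>With \<open>t = exp u\<close>, the monomial of degree \<open>m\<close> is represented by \<open>t ^ (m + 1) exp (- t) / (m + 1)!\<close>; in this picture
the powers of \<open>\<zeta> - 1\<close> correspond, up to constants, to the Laguerre functions \<open>t exp (- t) L t\<close> with parameter \<open>1\<close>.\<close>

definition laguerre_sum :: "complex poly \<Rightarrow> real \<Rightarrow> complex" where
  "laguerre_sum p u = (\<Sum>m\<le>degree p. coeff p m / fact (Suc m) * of_real (exp (real (Suc m) * u - exp u)))"

lemma exp_linear_minus_exp_le:
  fixes c u :: real
  assumes "0 < c"
  shows "exp (c * u - exp u) \<le> exp (c * ln c - c)"
proof -
  have "c * (1 + (u - ln c)) \<le> c * exp (u - ln c)"
    using assms by (intro mult_left_mono exp_ge_add_one_self) auto
  also have "\<dots> = exp u" using assms by (simp add: exp_diff)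
  finally show ?thesis by (simp add: algebra_simps)
qed

lemma laguerre_sum_shift:
  "laguerre_sum p u * of_real (exp (x * u)) =
    (\<Sum>m\<le>degree p. coeff p m / fact (Suc m) * of_real (exp ((real (Suc m) + x) * u - exp u)))"
proof -
  have "complex_of_real (exp ((real (Suc m) + x) * u - exp u)) =
      of_real (exp (real (Suc m) * u - exp u)) * of_real (exp (x * u))" for m
    unfolding of_real_mult[symmetric] exp_add[symmetric] by (simp add: algebra_simps)
  then show ?thesis
    unfolding laguerre_sum_def sum_distrib_right by (simp add: mult.assoc)
qed

lemma laguerre_sum_shift_props:
  assumes "0 \<le> x"
  shows "integrable lborel (\<lambda>u. laguerre_sum p u * of_real (exp (x * u)))" (is ?int)
    and "continuous_on UNIV (\<lambda>u. laguerre_sum p u * of_real (exp (x * u)))" (is ?cont)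
    and "\<exists>B. \<forall>u. cmod (laguerre_sum p u * of_real (exp (x * u))) \<le> B" (is ?bd)
    and "fourier (\<lambda>u. laguerre_sum p u * of_real (exp (x * u))) y = gamma_sum p (Complex x y)" (is ?fourier)
proof -
  have pos: "0 < real (Suc m) + x" for m using assms by simp
  have int: "integrable lborel (\<lambda>u. complex_of_real (exp ((real (Suc m) + x) * u - exp u)))" for m
    using integrable_exp_linear_minus_exp[OF pos] by (simp only: complex_of_real_integrable_eq)
  show ?int
    unfolding laguerre_sum_shift by (intro Bochner_Integration.integrable_sum integrable_mult_right int)
  show ?cont
    unfolding laguerre_sum_shift by (intro continuous_intros)
  show ?bd
  proof (intro exI allI)
    fix u
    show "cmod (laguerre_sum p u * of_real (exp (x * u))) \<le>
        (\<Sum>m\<le>degree p. cmod (coeff p m / fact (Suc m)) * exp ((real (Suc m) + x) * ln (real (Suc m) + x) - (real (Suc m) + x)))"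
      unfolding laguerre_sum_shift
      by (rule sum_norm_le) (auto simp only: norm_mult norm_of_real abs_exp_cancel
          intro!: mult_left_mono exp_linear_minus_exp_le pos norm_ge_zero)
  qed
  have "fourier (\<lambda>u. laguerre_sum p u * of_real (exp (x * u))) y =
      (\<Sum>m\<le>degree p. coeff p m / fact (Suc m) * fourier (\<lambda>u. of_real (exp ((real (Suc m) + x) * u - exp u))) y)"
    unfolding fourier_def laguerre_sum_shift sum_distrib_right
    by (subst Bochner_Integration.integral_sum)
       (auto simp only: mult.assoc integral_mult_right_zero intro!: integrable_mult_right integrable_mult_iexp int)
  also have "\<dots> = gamma_sum p (Complex x y)"
    unfolding gamma_sum_def fourier_exp_linear_minus_exp[OF pos]
    by (intro sum.cong refl arg_cong2[where f = "(*)"] arg_cong[where f = Gamma]) (simp add: complex_eq_iff)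
  finally show ?fourier .
qed

lemma square_integrable_decay:
  assumes "F \<in> borel_measurable lborel" "\<And>y. cmod (F y) \<le> C / (1 + y\<^sup>2)"
  shows "square_integrable lborel F"
proof -
  note [measurable] = assms(1)
  have C: "0 \<le> C" using order_trans[OF norm_ge_zero assms(2)[of 0]] by simp
  have pos: "0 < 1 + y\<^sup>2" for y :: real by (simp add: add_pos_nonneg)
  have "(cmod (F y))\<^sup>2 \<le> C\<^sup>2 * (1 / (1 + y\<^sup>2))" for y
  proof -
    have "(cmod (F y))\<^sup>2 \<le> (C / (1 + y\<^sup>2))\<^sup>2" by (intro power_mono assms) auto
    also have "\<dots> = C\<^sup>2 * (1 / (1 + y\<^sup>2) * (1 / (1 + y\<^sup>2)))" by (simp add: power2_eq_square)
    also have "\<dots> \<le> C\<^sup>2 * (1 / (1 + y\<^sup>2) * 1)"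
      using pos[of y] by (intro mult_left_mono) auto
    finally show ?thesis by simp
  qed
  then show ?thesis
    unfolding square_integrable_def
    by (auto intro!: Bochner_Integration.integrable_bound[OF integrable_mult_right[OF integrable_inverse_one_plus_square, of "C\<^sup>2"]])
qed

lemma gamma_sum_decay:
  "\<exists>C. \<forall>x\<in>{0..X}. \<forall>y. cmod (gamma_sum p (Complex x y)) \<le> C / (1 + y\<^sup>2)"
proof -
  have "\<exists>K. \<forall>x\<in>{0..X}. Gamma (real m + 3 + x) \<le> K" for m
  proof -
    have "compact ((\<lambda>x. Gamma (real m + 3 + x)) ` {0..X})"
      by (intro compact_continuous_image continuous_intros
            continuous_on_compose2[where g = Gamma and t = "- \<int>\<^sub>\<le>\<^sub>0"] continuous_on_Gamma)
         (auto elim!: nonpos_Ints_cases simp: image_subset_iff)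
    from compact_imp_bounded[OF this] show ?thesis
      by (auto simp: bounded_real dest: abs_le_D1)
  qed
  then obtain K where K: "\<And>m x. x \<in> {0..X} \<Longrightarrow> Gamma (real m + 3 + x) \<le> K m" by metis
  show ?thesis
  proof (intro exI ballI allI)
    fix x y assume x: "x \<in> {0..X}"
    have "cmod (gamma_sum p (Complex x y)) \<le>
        (\<Sum>m\<le>degree p. cmod (coeff p m / fact (Suc m)) * (K m / (1 + y\<^sup>2)))"
      unfolding gamma_sum_def
    proof (rule sum_norm_le)
      fix m
      have "cmod (Gamma (of_nat (Suc m) + Complex x y)) \<le> Gamma (real (Suc m) + x + 2) / (1 + y\<^sup>2)"
        using cmod_Gamma_le_decay[of "of_nat (Suc m) + Complex x y"] x by simp
      also have "\<dots> \<le> K m / (1 + y\<^sup>2)"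
        using K[OF x, of m] by (intro divide_right_mono) (auto simp: algebra_simps)
      finally show "cmod (coeff p m / fact (Suc m) * Gamma (of_nat (Suc m) + Complex x y)) \<le>
          cmod (coeff p m / fact (Suc m)) * (K m / (1 + y\<^sup>2))"
        unfolding norm_mult by (intro mult_left_mono) auto
    qed
    then show "cmod (gamma_sum p (Complex x y)) \<le>
        (\<Sum>m\<le>degree p. cmod (coeff p m / fact (Suc m)) * K m) / (1 + y\<^sup>2)"
      by (simp add: sum_divide_distrib)
  qed
qed

lemma continuous_on_gamma_sum: "continuous_on {z. - 1 < Re z} (gamma_sum p)"
  unfolding gamma_sum_def
  by (intro continuous_intros continuous_on_compose2[where g = Gamma and t = "- \<int>\<^sub>\<le>\<^sub>0"] continuous_on_Gamma)
     (auto elim!: nonpos_Ints_cases simp: complex_eq_iff)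

lemma continuous_on_Complex_line: "continuous_on UNIV (\<lambda>y. Complex x y)"
  unfolding Complex_eq by (intro continuous_intros)

lemma borel_measurable_on_line:
  assumes "continuous_on {z. - 1 < Re z} F" "0 \<le> x"
  shows "(\<lambda>y. F (Complex x y)) \<in> borel_measurable lborel"
proof -
  have "continuous_on UNIV (\<lambda>y. F (Complex x y))"
    by (rule continuous_on_compose2[OF assms(1) continuous_on_Complex_line]) (use assms in auto)
  then show ?thesis by (simp add: borel_measurable_continuous_onI)
qed

text \<open>Multiplication of a function by \<open>exp (x u)\<close> moves its transform from one vertical line to another, so one function \<open>laguerre_sum p\<close>
accounts for the norms on all vertical lines.\<close>

lemma gamma_sum_line:
  assumes x: "0 \<le> x"
  shows "square_integrable lborel (\<lambda>y. gamma_sum p (Complex x y))"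
    and "square_integrable lborel (\<lambda>u. laguerre_sum p u * of_real (exp (x * u)))"
    and "L2sq lborel (\<lambda>y. gamma_sum p (Complex x y)) =
      2 * pi * L2sq lborel (\<lambda>u. laguerre_sum p u * of_real (exp (x * u)))"
proof -
  obtain C where C: "\<And>y. cmod (gamma_sum p (Complex x y)) \<le> C / (1 + y\<^sup>2)"
    using gamma_sum_decay[of x p] x by (meson atLeastAtMost_iff order_refl)
  show sq: "square_integrable lborel (\<lambda>y. gamma_sum p (Complex x y))"
    by (rule square_integrable_decay[OF borel_measurable_on_line[OF continuous_on_gamma_sum x] C])
  note P = laguerre_sum_shift_props[OF x, of p]
  obtain B where B: "\<And>u. cmod (laguerre_sum p u * of_real (exp (x * u))) \<le> B"
    using P(3) by auto
  have eq: "fourier (\<lambda>u. laguerre_sum p u * of_real (exp (x * u))) = (\<lambda>y. gamma_sum p (Complex x y))"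
    using P(4) by auto
  show "square_integrable lborel (\<lambda>u. laguerre_sum p u * of_real (exp (x * u)))"
    "L2sq lborel (\<lambda>y. gamma_sum p (Complex x y)) =
      2 * pi * L2sq lborel (\<lambda>u. laguerre_sum p u * of_real (exp (x * u)))"
    using Plancherel_continuous[OF P(1,2) B] sq unfolding eq by auto
qed

definition laguerre_energy :: "complex poly \<Rightarrow> real" where
  "laguerre_energy p = (LINT u|lborel. (cmod (laguerre_sum p u))\<^sup>2 * exp (exp u))"

text \<open>The weight \<open>exp (exp u)\<close> leaves one factor \<open>exp (- exp u)\<close> of the two in the square, and Euler's integral
then gives factorials. The matrix obtained is the Gram matrix of the monomials in the Bergman space.\<close>

lemma laguerre_energy:
  "integrable lborel (\<lambda>u. (cmod (laguerre_sum p u))\<^sup>2 * exp (exp u))" (is ?int)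
  "of_real (laguerre_energy p) = (\<Sum>m\<le>degree p. \<Sum>n\<le>degree p.
     coeff p m * cnj (coeff p n) * (fact (m + n + 1) / (fact (Suc m) * fact (Suc n))))" (is ?val)
proof -
  let ?c = "\<lambda>m n. coeff p m / fact (Suc m) * cnj (coeff p n / fact (Suc n))"
  let ?e = "\<lambda>m n u. complex_of_real (exp (real (m + n + 2) * u - exp u))"
  have eq: "complex_of_real ((cmod (laguerre_sum p u))\<^sup>2 * exp (exp u)) =
      (\<Sum>m\<le>degree p. \<Sum>n\<le>degree p. ?c m n * ?e m n u)" for u
  proof -
    have e: "?e m n u = of_real (exp (real (Suc m) * u - exp u)) * of_real (exp (real (Suc n) * u - exp u)) * of_real (exp (exp u))" for m n
      unfolding of_real_mult[symmetric] exp_add[symmetric] by (simp add: algebra_simps)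
    have "complex_of_real ((cmod (laguerre_sum p u))\<^sup>2 * exp (exp u)) =
        laguerre_sum p u * cnj (laguerre_sum p u) * of_real (exp (exp u))"
      by (simp add: complex_norm_square del: of_real_power)
    also have "\<dots> = (\<Sum>m\<le>degree p. \<Sum>n\<le>degree p. ?c m n * ?e m n u)"
      unfolding laguerre_sum_def cnj_sum sum_product unfolding sum_distrib_right e
      by (intro sum.cong refl) (simp add: mult_ac)
    finally show ?thesis .
  qed
  have int: "integrable lborel (?e m n)" for m n
    using integrable_exp_linear_minus_exp[of "real (m + n + 2)"] by (simp only: complex_of_real_integrable_eq)
  have val: "(LINT u|lborel. ?e m n u) = fact (m + n + 1)" for m n
  proof -
    have "(LINT u|lborel. exp (real (m + n + 2) * u - exp u)) = fact (m + n + 1)"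
      using integral_exp_linear_minus_exp[of "real (m + n + 2)"] Gamma_fact[of "m + n + 1", where 'a = real]
      by (simp add: add_ac)
    then show ?thesis unfolding integral_complex_of_real by simp
  qed
  have "integrable lborel (\<lambda>u. complex_of_real ((cmod (laguerre_sum p u))\<^sup>2 * exp (exp u)))"
    unfolding eq by (intro Bochner_Integration.integrable_sum integrable_mult_right int)
  then show ?int by (simp only: complex_of_real_integrable_eq)
  have "of_real (laguerre_energy p) = (LINT u|lborel. complex_of_real ((cmod (laguerre_sum p u))\<^sup>2 * exp (exp u)))"
    unfolding laguerre_energy_def integral_complex_of_real ..
  also have "\<dots> = (\<Sum>m\<le>degree p. \<Sum>n\<le>degree p. ?c m n * fact (m + n + 1))"
    unfolding eq
    by (subst Bochner_Integration.integral_sum Bochner_Integration.integrable_sum;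
        (intro sum.cong refl Bochner_Integration.integrable_sum integrable_mult_right int)?)
       (subst Bochner_Integration.integral_sum,
        auto simp only: integral_mult_right_zero val intro!: sum.cong integrable_mult_right int)
  finally show ?val by (simp add: mult_ac del: fact_Suc)
qed

lemma laguerre_energy_nonneg: "0 \<le> laguerre_energy p"
  by (simp add: laguerre_energy_def)

text \<open>The bound \<open>1 / 2\<close> ensures \<open>2 x u \<le> max 0 u \<le> exp u\<close>. Uniformity in \<open>x\<close> near \<open>0\<close> is what produces the boundary values.\<close>

lemma L2sq_laguerre_sum_le:
  assumes "0 \<le> x" "x \<le> 1 / 2"
  shows "L2sq lborel (\<lambda>u. laguerre_sum p u * of_real (exp (x * u))) \<le> laguerre_energy p"
  unfolding L2sq_def laguerre_energy_def
proof (rule integral_mono)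
  show "integrable lborel (\<lambda>u. (cmod (laguerre_sum p u * of_real (exp (x * u))))\<^sup>2)"
    using gamma_sum_line(2)[OF assms(1)] by (simp add: square_integrable_def)
  fix u :: real
  have "(exp (x * u))\<^sup>2 = exp ((2 * x) * u)"
    by (simp add: power2_eq_square flip: exp_add)
  also have "\<dots> \<le> exp (exp u)"
  proof -
    have "(2 * x) * u \<le> max 0 u"
    proof (cases "0 \<le> u")
      case True
      then have "(2 * x) * u \<le> 1 * u" using assms by (intro mult_right_mono) auto
      then show ?thesis by simp
    next
      case False
      then show ?thesis using assms by (simp add: mult_nonneg_nonpos)
    qed
    also have "\<dots> \<le> exp u" using exp_ge_add_one_self[of u] exp_gt_zero[of u] by linarith
    finally show ?thesis by simp
  qed
  finally show "(cmod (laguerre_sum p u * of_real (exp (x * u))))\<^sup>2 \<le> (cmod (laguerre_sum p u))\<^sup>2 * exp (exp u)"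
    by (auto simp: norm_mult power_mult_distrib intro!: mult_left_mono)
qed (rule laguerre_energy(1))

text \<open>The exponential series \<open>\<Sum>n. exp u ^ n / n! = exp (exp u)\<close> explains the masses of the measure \<open>omega\<close>.\<close>

lemma suminf_gamma_sum_lines:
  "(\<Sum>n. ennreal (1 / fact n) * ennreal (L2sq lborel (\<lambda>y. gamma_sum p (Complex (real n / 2) y)))) =
    ennreal (2 * pi * laguerre_energy p)"
proof -
  let ?g = "\<lambda>n u. laguerre_sum p u * of_real (exp (real n / 2 * u))"
  have [measurable]: "laguerre_sum p \<in> borel_measurable borel"
    using gamma_sum_line(2)[of 0 p] by (simp add: square_integrable_def)
  have "ennreal (1 / fact n) * ennreal (L2sq lborel (\<lambda>y. gamma_sum p (Complex (real n / 2) y))) =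
      ennreal (2 * pi) * (\<integral>\<^sup>+u. ennreal ((cmod (laguerre_sum p u))\<^sup>2 * (exp u ^ n / fact n)) \<partial>lborel)" for n
  proof -
    have "(cmod (?g n u))\<^sup>2 = (cmod (laguerre_sum p u))\<^sup>2 * exp u ^ n" for u
      by (simp add: norm_mult power_mult_distrib power2_eq_square flip: exp_add exp_of_nat_mult)
    then have "(\<integral>\<^sup>+u. ennreal ((cmod (laguerre_sum p u))\<^sup>2 * (exp u ^ n / fact n)) \<partial>lborel) =
        (\<integral>\<^sup>+u. ennreal (1 / fact n) * ennreal ((cmod (?g n u))\<^sup>2) \<partial>lborel)"
      by (simp flip: ennreal_mult)
    also have "\<dots> = ennreal (1 / fact n) * ennreal (L2sq lborel (?g n))"
      by (subst nn_integral_cmult, measurable) (subst nn_L2sq[OF gamma_sum_line(2)], simp_all)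
    finally show ?thesis
      by (simp add: gamma_sum_line(3) mult_ac flip: ennreal_mult)
  qed
  then have "(\<Sum>n. ennreal (1 / fact n) * ennreal (L2sq lborel (\<lambda>y. gamma_sum p (Complex (real n / 2) y)))) =
      ennreal (2 * pi) * (\<Sum>n. \<integral>\<^sup>+u. ennreal ((cmod (laguerre_sum p u))\<^sup>2 * (exp u ^ n / fact n)) \<partial>lborel)"
    by simp
  also have "(\<Sum>n. \<integral>\<^sup>+u. ennreal ((cmod (laguerre_sum p u))\<^sup>2 * (exp u ^ n / fact n)) \<partial>lborel) =
      (\<integral>\<^sup>+u. (\<Sum>n. ennreal ((cmod (laguerre_sum p u))\<^sup>2 * (exp u ^ n / fact n))) \<partial>lborel)"
    by (rule nn_integral_suminf[symmetric]) measurable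
  also have "\<dots> = (\<integral>\<^sup>+u. ennreal ((cmod (laguerre_sum p u))\<^sup>2 * exp (exp u)) \<partial>lborel)"
  proof (rule nn_integral_cong)
    fix u :: real
    have "(\<lambda>n. exp u ^ n / fact n) sums exp (exp u)"
      using exp_converges[of "exp u"] by (simp add: divide_inverse mult.commute)
    then have "(\<lambda>n. (cmod (laguerre_sum p u))\<^sup>2 * (exp u ^ n / fact n)) sums ((cmod (laguerre_sum p u))\<^sup>2 * exp (exp u))"
      by (rule sums_mult)
    then show "(\<Sum>n. ennreal ((cmod (laguerre_sum p u))\<^sup>2 * (exp u ^ n / fact n))) =
        ennreal ((cmod (laguerre_sum p u))\<^sup>2 * exp (exp u))"
      by (intro suminf_ennreal_eq) auto
  qed
  also have "\<dots> = ennreal (laguerre_energy p)"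
    unfolding laguerre_energy_def by (intro nn_integral_eq_integral laguerre_energy(1)) auto
  finally show ?thesis
    using laguerre_energy_nonneg[of p] by (simp add: ennreal_mult)
qed

section \<open>Rotations and radial integrals in the plane\<close>

lemma lborel_complex_eq_distr:
  "lborel = distr (lborel \<Otimes>\<^sub>M lborel) borel (\<lambda>(x, y). Complex x y)"
proof (rule lborel_eqI)
  have [measurable]: "(\<lambda>(x, y). Complex x y) \<in> (lborel \<Otimes>\<^sub>M lborel) \<rightarrow>\<^sub>M borel"
    unfolding case_prod_unfold Complex_eq by measurable
  fix l u :: complex
  assume le: "\<And>b. b \<in> Basis \<Longrightarrow> l \<bullet> b \<le> u \<bullet> b"
  have le': "Re l \<le> Re u" "Im l \<le> Im u"
    using le[of 1] le[of \<i>] by (auto simp: Basis_complex_def)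
  have "(\<lambda>(x, y). Complex x y) -` box l u \<inter> space (lborel \<Otimes>\<^sub>M lborel) = {Re l<..<Re u} \<times> {Im l<..<Im u}"
    by (auto simp: space_pair_measure box_def Basis_complex_def)
  then show "emeasure (distr (lborel \<Otimes>\<^sub>M lborel) borel (\<lambda>(x, y). Complex x y)) (box l u) =
      ennreal (\<Prod>b\<in>Basis. (u - l) \<bullet> b)"
    using le' by (simp add: emeasure_distr lborel.emeasure_pair_measure_Times Basis_complex_def ennreal_mult)
qed simp

lemma nn_integral_lborel_complex:
  assumes [measurable]: "f \<in> borel_measurable borel"
  shows "(\<integral>\<^sup>+z. f z \<partial>lborel) = (\<integral>\<^sup>+x. \<integral>\<^sup>+y. f (Complex x y) \<partial>lborel \<partial>lborel)"
    and "(\<integral>\<^sup>+z. f z \<partial>lborel) = (\<integral>\<^sup>+y. \<integral>\<^sup>+x. f (Complex x y) \<partial>lborel \<partial>lborel)"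
proof -
  have m[measurable]: "(\<lambda>(x, y). Complex x y) \<in> (lborel \<Otimes>\<^sub>M lborel) \<rightarrow>\<^sub>M borel"
    unfolding case_prod_unfold Complex_eq by measurable
  have [measurable]: "(\<lambda>(x, y). f (Complex x y)) \<in> borel_measurable (lborel \<Otimes>\<^sub>M lborel)"
    using measurable_compose[OF m assms] by (simp add: case_prod_unfold)
  have "(\<integral>\<^sup>+z. f z \<partial>lborel) = (\<integral>\<^sup>+p. f (case p of (x, y) \<Rightarrow> Complex x y) \<partial>(lborel \<Otimes>\<^sub>M lborel))"
    by (subst lborel_complex_eq_distr) (rule nn_integral_distr[OF m], simp)
  also have "\<dots> = (\<integral>\<^sup>+p. (case p of (x, y) \<Rightarrow> f (Complex x y)) \<partial>(lborel \<Otimes>\<^sub>M lborel))"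
    by (simp add: case_prod_unfold)
  finally have *: "(\<integral>\<^sup>+z. f z \<partial>lborel) = (\<integral>\<^sup>+p. (case p of (x, y) \<Rightarrow> f (Complex x y)) \<partial>(lborel \<Otimes>\<^sub>M lborel))" .
  show "(\<integral>\<^sup>+z. f z \<partial>lborel) = (\<integral>\<^sup>+x. \<integral>\<^sup>+y. f (Complex x y) \<partial>lborel \<partial>lborel)"
    unfolding * by (subst lborel.nn_integral_fst[symmetric]) auto
  then show "(\<integral>\<^sup>+z. f z \<partial>lborel) = (\<integral>\<^sup>+y. \<integral>\<^sup>+x. f (Complex x y) \<partial>lborel \<partial>lborel)"
    by (subst lborel_pair.Fubini') auto
qed

lemma nn_integral_lborel_shift:
  assumes [measurable]: "f \<in> borel_measurable borel"
  shows "(\<integral>\<^sup>+x. f (x + t) \<partial>lborel) = (\<integral>\<^sup>+x. f (x::real) \<partial>lborel)"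
  using nn_integral_real_affine[of f 1 t] by (simp add: add.commute)

lemma nn_integral_shear:
  assumes [measurable]: "f \<in> borel_measurable borel"
  shows "(\<integral>\<^sup>+z. f (Complex (Re z + a * Im z) (Im z)) \<partial>lborel) = (\<integral>\<^sup>+z. f z \<partial>lborel)"
    and "(\<integral>\<^sup>+z. f (Complex (Re z) (Im z + a * Re z)) \<partial>lborel) = (\<integral>\<^sup>+z. f z \<partial>lborel)"
proof -
  have [measurable]: "(\<lambda>z. Complex (Re z + a * Im z) (Im z)) \<in> borel_measurable borel"
    "(\<lambda>z. Complex (Re z) (Im z + a * Re z)) \<in> borel_measurable borel"
    "(\<lambda>x. Complex x y) \<in> borel_measurable borel" "(\<lambda>x. Complex y x) \<in> borel_measurable borel" for y
    unfolding Complex_eq by measurable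
  show "(\<integral>\<^sup>+z. f (Complex (Re z + a * Im z) (Im z)) \<partial>lborel) = (\<integral>\<^sup>+z. f z \<partial>lborel)"
    by (simp add: nn_integral_lborel_complex(2) nn_integral_lborel_shift[of "\<lambda>x. f (Complex x _)"])
  show "(\<integral>\<^sup>+z. f (Complex (Re z) (Im z + a * Re z)) \<partial>lborel) = (\<integral>\<^sup>+z. f z \<partial>lborel)"
    by (simp add: nn_integral_lborel_complex(1) nn_integral_lborel_shift[of "\<lambda>x. f (Complex _ x)"])
qed

text \<open>A rotation with matrix entries \<open>Re c\<close>, \<open>Im c\<close> is a product of three shears, and a shear preserves area because
it translates every line parallel to an axis. The slope \<open>a\<close> exists because \<open>Im c \<noteq> 0\<close>.\<close>

lemma nn_integral_rotate:
  assumes f[measurable]: "f \<in> borel_measurable borel" and c: "cmod c = 1" "Im c \<noteq> 0"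
  shows "(\<integral>\<^sup>+z. f (c * z) \<partial>lborel) = (\<integral>\<^sup>+z. f z \<partial>lborel)"
proof -
  define a where "a = (Re c - 1) / Im c"
  define S where "S z = Complex (Re z + a * Im z) (Im z)" for z
  define T where "T z = Complex (Re z) (Im z + Im c * Re z)" for z
  have [measurable]: "S \<in> borel_measurable borel" "T \<in> borel_measurable borel"
    unfolding S_def T_def Complex_eq by measurable
  have c1: "(Re c)\<^sup>2 + (Im c)\<^sup>2 = 1" using c(1) by (simp add: cmod_def)
  \<comment> \<open>The product of the shears has the entries \<open>1 + a Im c\<close> on the diagonal, \<open>Im c\<close> and \<open>a (2 + a Im c)\<close> off it.\<close>
  have ab: "a * Im c = Re c - 1" using c(2) by (simp add: a_def)
  have ac: "a * (Re c + 1) = - Im c"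
  proof -
    have "(Re c - 1) * (Re c + 1) = - Im c * Im c"
      using c1 by (simp add: power2_eq_square algebra_simps)
    then show ?thesis using c(2) by (simp add: a_def field_simps)
  qed
  have eq: "c * z = S (T (S z))" for z
  proof -
    have "Im (S (T (S z))) = Im z * (1 + a * Im c) + Im c * Re z"
      by (simp add: S_def T_def algebra_simps)
    moreover have "Re (S (T (S z))) = Re z * (1 + a * Im c) + Im z * (a * (Re c + 1)) + a * Im z * (1 + a * Im c - Re c)"
      by (simp add: S_def T_def algebra_simps)
    ultimately show ?thesis
      unfolding ab ac by (simp add: complex_eq_iff algebra_simps)
  qed
  have hS: "(\<integral>\<^sup>+z. g (S z) \<partial>lborel) = (\<integral>\<^sup>+z. g z \<partial>lborel)"
    and hT: "(\<integral>\<^sup>+z. g (T z) \<partial>lborel) = (\<integral>\<^sup>+z. g z \<partial>lborel)"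
    if "g \<in> borel_measurable borel" for g :: "complex \<Rightarrow> ennreal"
    unfolding S_def T_def by (rule nn_integral_shear[OF that])+
  have "(\<integral>\<^sup>+z. f (c * z) \<partial>lborel) = (\<integral>\<^sup>+z. f (S (T (S z))) \<partial>lborel)" by (simp add: eq)
  also have "\<dots> = (\<integral>\<^sup>+z. f (S (T z)) \<partial>lborel)"
    by (rule hS) measurable
  also have "\<dots> = (\<integral>\<^sup>+z. f (S z) \<partial>lborel)"
    by (rule hT) measurable
  also have "\<dots> = (\<integral>\<^sup>+z. f z \<partial>lborel)"
    by (rule hS) measurable
  finally show ?thesis .
qed

lemma lborel_distr_rotation:
  assumes c: "cmod c = 1" "Im c \<noteq> 0"
  shows "distr lborel borel (\<lambda>z. w + c * (z - w)) = lborel"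
proof (rule measure_eqI)
  fix A assume "A \<in> sets (distr lborel borel (\<lambda>z. w + c * (z - w)))"
  then have [measurable]: "A \<in> sets borel" by simp
  have "emeasure (distr lborel borel (\<lambda>z. w + c * (z - w))) A =
      (\<integral>\<^sup>+z. indicator A (w + c * (z - w)) \<partial>lborel)"
    by (subst nn_integral_distr[of "\<lambda>z. w + c * (z - w)" lborel borel "indicator A", symmetric]) auto
  also have "\<dots> = (\<integral>\<^sup>+z. indicator A (w + c * (z - w)) \<partial>distr lborel borel ((+) w))"
    by (simp add: lborel_distr_plus)
  also have "\<dots> = (\<integral>\<^sup>+z. indicator A (w + c * z) \<partial>lborel)"
    by (subst nn_integral_distr) auto
  also have "\<dots> = (\<integral>\<^sup>+z. indicator A (w + z) \<partial>lborel)"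
    by (rule nn_integral_rotate[OF _ c, of "\<lambda>z. indicator A (w + z)"]) measurable
  also have "\<dots> = (\<integral>\<^sup>+z. indicator A z \<partial>distr lborel borel ((+) w))"
    by (subst nn_integral_distr) auto
  also have "\<dots> = emeasure lborel A" by (simp add: lborel_distr_plus)
  finally show "emeasure (distr lborel borel (\<lambda>z. w + c * (z - w))) A = emeasure lborel A" .
qed simp

text \<open>A rotation by the angle \<open>pi / (2 |j - k|)\<close> multiplies the integral by \<open>\<i>\<close> or by \<open>- \<i>\<close>, hence it vanishes.\<close>

lemma ball_monomials_orthogonal:
  fixes w :: complex
  assumes "j \<noteq> k"
  shows "(LINT z:ball w r|lborel. (z - w) ^ j * cnj ((z - w) ^ k)) = 0"
proof -
  define n where "n = (if j < k then k - j else j - k)"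
  have n: "0 < n" using assms by (auto simp: n_def)
  define c where "c = cis (pi / 2 / real n)"
  have "0 < pi / 2 / real n" "pi / 2 / real n < pi" 
    using n pi_gt_zero by (auto simp: field_simps)
  then have "0 < sin (pi / 2 / real n)" by (rule sin_gt_zero)
  then have c: "cmod c = 1" "Im c \<noteq> 0" by (auto simp: c_def)
  have cn: "c ^ n = \<i>" using n unfolding c_def Complex.DeMoivre by (simp add: cis_pi_half)
  have cc: "c * cnj c = 1" using c(1) by (simp add: complex_norm_square[symmetric])
  have cjk: "c ^ j * cnj c ^ k \<noteq> 1"
  proof (cases "j < k")
    case True
    then have k: "k = j + n" by (simp add: n_def)
    have "c ^ j * cnj c ^ k = (c * cnj c) ^ j * cnj (c ^ n)"
      unfolding k power_add power_mult_distrib by (simp add: mult_ac)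
    then show ?thesis by (simp add: cc cn complex_eq_iff)
  next
    case False
    then have k: "j = k + n" by (simp add: n_def)
    have "c ^ j * cnj c ^ k = (c * cnj c) ^ k * c ^ n"
      unfolding k power_add power_mult_distrib by (simp add: mult_ac)
    then show ?thesis by (simp add: cc cn complex_eq_iff)
  qed
  let ?g = "\<lambda>z. indicator (ball w r) z *\<^sub>R ((z - w) ^ j * cnj ((z - w) ^ k))"
  have [measurable]: "(\<lambda>z. cnj ((z - w) ^ k)) \<in> borel_measurable borel"
    by (intro borel_measurable_continuous_onI continuous_intros)
  have [measurable]: "ball w r \<in> sets borel" by simp
  have "integral\<^sup>L lborel ?g = integral\<^sup>L (distr lborel borel (\<lambda>z. w + c * (z - w))) ?g"
    by (simp add: lborel_distr_rotation[OF c])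
  also have "\<dots> = (LINT z|lborel. ?g (w + c * (z - w)))"
    by (rule integral_distr) measurable
  also have "\<dots> = (LINT z|lborel. (c ^ j * cnj c ^ k) * ?g z)"
  proof (rule Bochner_Integration.integral_cong[OF refl])
    fix z
    have "indicator (ball w r) (w + c * (z - w)) = (indicator (ball w r) z :: real)"
      using c(1) by (auto simp: indicator_def dist_norm norm_mult norm_minus_commute)
    then show "?g (w + c * (z - w)) = (c ^ j * cnj c ^ k) * ?g z"
      by (simp add: power_mult_distrib mult_ac)
  qed
  also have "\<dots> = (c ^ j * cnj c ^ k) * integral\<^sup>L lborel ?g" by (rule integral_mult_right_zero)
  finally show ?thesis using cjk by (auto simp: set_lebesgue_integral_def)
qed

text \<open>The area of a disc is proportional to the square of its radius, so the image of the area measure under the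
squared modulus is \<open>pi\<close> times Lebesgue measure.\<close>

lemma nn_integral_radial:
  fixes w :: complex
  assumes [measurable]: "h \<in> borel_measurable borel" and R: "0 < R"
  shows "(\<integral>\<^sup>+z. h ((cmod (z - w))\<^sup>2) * indicator (ball w R) z \<partial>lborel) =
    ennreal pi * (\<integral>\<^sup>+t. h t * indicator {0<..<R\<^sup>2} t \<partial>lborel)"
proof -
  let ?q = "\<lambda>z. (cmod (z - w))\<^sup>2"
  have [measurable]: "ball w R \<in> sets borel" by simp
  let ?D = "density lborel (indicator (ball w R))"
  let ?N1 = "distr ?D borel ?q"
  let ?N2 = "density lborel (\<lambda>t. ennreal pi * indicator {0<..<R\<^sup>2} t)"
  have ballV: "emeasure lborel (ball w r) = ennreal (pi * r\<^sup>2)" if "0 \<le> r" for r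
    using that emeasure_ball[of r w] by (simp add: unit_ball_vol_2)
  have cballV: "emeasure lborel (cball w r) = ennreal (pi * r\<^sup>2)" if "0 \<le> r" for r
    using that emeasure_cball[of r w] by (simp add: unit_ball_vol_2)
  have N1: "emeasure ?N1 {..x} = emeasure lborel (ball w R \<inter> {z. ?q z \<le> x})" for x
  proof -
    have "emeasure ?N1 {..x} = emeasure ?D {z. ?q z \<le> x}"
      by (subst emeasure_distr) (auto intro!: arg_cong[where f = "emeasure _"])
    also have "\<dots> = (\<integral>\<^sup>+z. indicator (ball w R \<inter> {z. ?q z \<le> x}) z \<partial>lborel)"
      by (subst emeasure_density) (auto simp flip: indicator_inter_arith)
    finally show ?thesis by simp
  qed
  have N2: "emeasure ?N2 {..x} = ennreal pi * emeasure lborel ({0<..<R\<^sup>2} \<inter> {..x})" for x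
    by (subst emeasure_density)
       (auto simp: mult.assoc nn_integral_cmult simp flip: indicator_inter_arith)
  have eq: "emeasure ?N1 {..x} = emeasure ?N2 {..x}" for x
  proof -
    consider "x < 0" | "0 \<le> x" "x < R\<^sup>2" | "R\<^sup>2 \<le> x" by linarith
    then show ?thesis
    proof cases
      case 1
      then have "ball w R \<inter> {z. ?q z \<le> x} = {}" "{0<..<R\<^sup>2} \<inter> {..x} = {}"
        using order_trans[OF zero_le_power2, of _ x] by (force, force)
      then show ?thesis unfolding N1 N2 by simp
    next
      case 2
      have lt: "sqrt x < R" using 2 R by (simp add: real_less_lsqrt)
      have iff: "?q z \<le> x \<longleftrightarrow> dist w z \<le> sqrt x" for z
        using real_sqrt_le_iff[of "?q z" x] by (simp add: dist_norm norm_minus_commute)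
      have "ball w R \<inter> {z. ?q z \<le> x} = cball w (sqrt x)"
        unfolding iff ball_def cball_def using lt by (auto intro: le_less_trans)
      moreover have "{0<..<R\<^sup>2} \<inter> {..x} = {0<..x}" using 2 by auto
      ultimately show ?thesis unfolding N1 N2 using 2 by (simp add: cballV ennreal_mult)
    next
      case 3
      have "?q z \<le> x" if "z \<in> ball w R" for z
        using that 3 power_mono[of "cmod (z - w)" R 2] by (auto simp: dist_norm norm_minus_commute)
      then have "ball w R \<inter> {z. ?q z \<le> x} = ball w R" by auto
      moreover have "{0<..<R\<^sup>2} \<inter> {..x} = {0<..<R\<^sup>2}" using 3 by auto
      ultimately show ?thesis unfolding N1 N2 using R by (simp add: ballV ennreal_mult)
    qed
  qed
  have f1: "finite_borel_measure ?N1"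
    unfolding finite_borel_measure_def finite_borel_measure_axioms_def
  proof (intro conjI finite_measureI)
    have "emeasure ?D (space ?D) = emeasure lborel (ball w R)"
      by (subst emeasure_density) auto
    then show "emeasure ?N1 (space ?N1) \<noteq> \<infinity>" using R by (subst emeasure_distr) (auto simp: ballV)
  qed simp
  have f2: "finite_borel_measure ?N2"
    unfolding finite_borel_measure_def finite_borel_measure_axioms_def
  proof (intro conjI finite_measureI)
    show "emeasure ?N2 (space ?N2) \<noteq> \<infinity>"
      by (subst emeasure_density) (auto simp: nn_integral_cmult ennreal_mult_eq_top_iff)
  qed simp
  have "?N1 = ?N2"
    using f1 f2 by (rule cdf_unique') (simp add: cdf_def measure_def eq fun_eq_iff)
  then have "(\<integral>\<^sup>+t. h t \<partial>?N1) = (\<integral>\<^sup>+t. h t \<partial>?N2)" by simp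
  moreover have "(\<integral>\<^sup>+t. h t \<partial>?N1) = (\<integral>\<^sup>+z. h (?q z) * indicator (ball w R) z \<partial>lborel)"
    by (subst nn_integral_distr) (auto simp: nn_integral_density mult.commute)
  moreover have "(\<integral>\<^sup>+t. h t \<partial>?N2) = ennreal pi * (\<integral>\<^sup>+t. h t * indicator {0<..<R\<^sup>2} t \<partial>lborel)"
    by (simp add: nn_integral_density mult_ac nn_integral_cmult)
  ultimately show ?thesis by simp
qed

lemma square_powr:
  fixes x a :: real
  assumes "0 \<le> x"
  shows "(x\<^sup>2) powr a = x powr (2 * a)"
proof (cases "x = 0")
  case False
  then have "x\<^sup>2 = x powr 2" using assms by simp
  then show ?thesis by (simp only: powr_powr)
qed simp

lemma nn_integral_norm_powr_ball:
  fixes w :: complex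
  assumes s: "- 2 < s" and R: "0 < R"
  shows "(\<integral>\<^sup>+z. ennreal (cmod (z - w) powr s) * indicator (ball w R) z \<partial>lborel) =
    ennreal (2 * pi * R powr (s + 2) / (s + 2))"
proof -
  have "(\<integral>\<^sup>+z. ennreal (cmod (z - w) powr s) * indicator (ball w R) z \<partial>lborel) =
      (\<integral>\<^sup>+z. ennreal (((cmod (z - w))\<^sup>2) powr (s / 2)) * indicator (ball w R) z \<partial>lborel)"
    by (simp add: square_powr)
  also have "\<dots> = ennreal pi * (\<integral>\<^sup>+t. ennreal (t powr (s / 2)) * indicator {0<..<R\<^sup>2} t \<partial>lborel)"
    by (rule nn_integral_radial[OF _ R]) measurable
  also have "(\<integral>\<^sup>+t. ennreal (t powr (s / 2)) * indicator {0<..<R\<^sup>2} t \<partial>lborel) =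
      (\<integral>\<^sup>+t. ennreal (indicator {0..R\<^sup>2} t * t powr (s / 2)) \<partial>lborel)"
  proof (rule nn_integral_cong_AE)
    show "AE t in lborel. ennreal (t powr (s / 2)) * indicator {0<..<R\<^sup>2} t =
        ennreal (indicator {0..R\<^sup>2} t * t powr (s / 2))"
      using AE_lborel_singleton[of 0] AE_lborel_singleton[of "R\<^sup>2"]
      by eventually_elim (auto simp: indicator_def)
  qed
  also have "\<dots> = ennreal ((R\<^sup>2) powr (s / 2 + 1) / (s / 2 + 1))"
    using nn_integral_has_integral_lebesgue[OF _ has_integral_powr_from_0[of "s / 2" "R\<^sup>2"]] s by simp
  also have "(R\<^sup>2) powr (s / 2 + 1) = R powr (s + 2)"
    using R by (simp add: square_powr algebra_simps)
  also have "ennreal pi * ennreal (R powr (s + 2) / (s / 2 + 1)) = ennreal (2 * pi * R powr (s + 2) / (s + 2))"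
  proof -
    have "pi * (R powr (s + 2) / (s / 2 + 1)) = 2 * pi * R powr (s + 2) / (s + 2)"
      using s by (simp add: divide_simps)
    then show ?thesis using s by (subst ennreal_mult[symmetric]) auto
  qed
  finally show ?thesis .
qed

section \<open>Taylor coefficients in the Bergman space\<close>

abbreviation disc :: "complex measure" where
  "disc \<equiv> restrict_space lborel Delta"

lemma disc_measure_integral:
  fixes f :: "complex \<Rightarrow> complex"
  shows "(LINT z:Delta|lborel. f z) = (LINT z|disc. f z)"
  by (subst integral_restrict_space) (auto simp: set_lebesgue_integral_def)

lemma bergman_inner_altdef:
  "bergman_inner f g = (LINT z|disc. f z * cnj (g z)) / of_real pi"
  by (simp add: bergman_inner_def disc_measure_integral)

lemma finite_measure_disc: "finite_measure disc"
  by (intro finite_measure_restrict_space finite_measureI)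
     (auto simp: emeasure_restrict_space emeasure_ball finite_measure_def)

lemma continuous_on_borel_measurable_disc:
  "continuous_on Delta f \<Longrightarrow> f \<in> borel_measurable disc"
  using borel_measurable_continuous_on_restrict[of Delta f]
  by (simp add: measurable_def space_restrict_space sets_restrict_space)

lemma bergman_space_iff:
  "f \<in> bergman_space \<longleftrightarrow> f holomorphic_on Delta \<and> square_integrable disc f"
proof -
  have "set_integrable lborel Delta (\<lambda>\<zeta>. (cmod (f \<zeta>))\<^sup>2) \<longleftrightarrow> integrable disc (\<lambda>\<zeta>. (cmod (f \<zeta>))\<^sup>2)"
    by (subst integrable_restrict_space) (auto simp: set_integrable_def)
  then show ?thesis
    by (auto simp: bergman_space_def square_integrable_def
        intro: continuous_on_borel_measurable_disc holomorphic_on_imp_continuous_on)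
qed

lemma square_integrable_disc_bounded:
  assumes "continuous_on Delta f" "\<And>z. z \<in> Delta \<Longrightarrow> cmod (f z) \<le> B"
  shows "square_integrable disc f"
proof -
  interpret finite_measure disc by (rule finite_measure_disc)
  have [measurable]: "f \<in> borel_measurable disc"
    by (rule continuous_on_borel_measurable_disc[OF assms(1)])
  have "integrable disc (\<lambda>z. (cmod (f z))\<^sup>2)"
    by (rule integrable_const_bound[of _ "B\<^sup>2"])
       (auto intro!: AE_I2 power_mono assms simp: space_restrict_space)
  then show ?thesis by (simp add: square_integrable_def)
qed

definition has_coeffs :: "(complex \<Rightarrow> complex) \<Rightarrow> (nat \<Rightarrow> complex) \<Rightarrow> bool" where
  "has_coeffs f a \<longleftrightarrow> (\<forall>z\<in>Delta. (\<lambda>k. a k * (z - 1) ^ k) sums f z)"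

lemma bergman_space_has_coeffs:
  assumes "f \<in> bergman_space"
  shows "\<exists>a. has_coeffs f a"
  unfolding has_coeffs_def
proof (intro exI ballI)
  fix z :: complex assume "z \<in> Delta"
  then show "(\<lambda>k. (deriv ^^ k) f 1 / fact k * (z - 1) ^ k) sums f z"
    using assms by (intro holomorphic_power_series) (auto simp: bergman_space_def)
qed

lemma integral_disc_monomials:
  "(LINT z|disc. (z - 1) ^ j * cnj ((z - 1) ^ k)) = (if j = k then of_real (pi / real (k + 1)) else 0)"
proof (cases "j = k")
  case False
  then show ?thesis
    using ball_monomials_orthogonal[of j k 1 1] by (simp add: disc_measure_integral)
next
  case True
  have *: "(z - 1) ^ k * cnj ((z - 1) ^ k) = of_real (cmod (z - 1) ^ (2 * k))" for z
  proof -
    have "(z - 1) ^ k * cnj ((z - 1) ^ k) = ((z - 1) * cnj (z - 1)) ^ k"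
      by (simp only: complex_cnj_power power_mult_distrib)
    also have "\<dots> = of_real (cmod (z - 1) ^ (2 * k))"
      unfolding complex_norm_square[symmetric] power_mult by simp
    finally show ?thesis .
  qed
  have "(LINT z:Delta|lborel. cmod (z - 1) ^ (2 * k)) = pi / real (k + 1)"
  proof -
    have "(\<integral>\<^sup>+z. ennreal (indicator Delta z * cmod (z - 1) ^ (2 * k)) \<partial>lborel) =
        (\<integral>\<^sup>+z. ennreal (((cmod (z - 1))\<^sup>2) ^ k) * indicator (ball 1 1) z \<partial>lborel)"
      by (intro nn_integral_cong) (auto simp: indicator_def power_mult)
    also have "\<dots> = ennreal pi * (\<integral>\<^sup>+t. ennreal (t ^ k) * indicator {0<..<1\<^sup>2} t \<partial>lborel)"
      by (rule nn_integral_radial) auto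
    also have "(\<integral>\<^sup>+t. ennreal (t ^ k) * indicator {0<..<1\<^sup>2::real} t \<partial>lborel) =
        (\<integral>\<^sup>+t. ennreal (t ^ k) * indicator {0..1} t \<partial>lborel)"
    proof (rule nn_integral_cong_AE)
      show "AE t in lborel. ennreal (t ^ k) * indicator {0<..<1\<^sup>2::real} t = ennreal (t ^ k) * indicator {0..1} t"
        using AE_lborel_singleton[of 0] AE_lborel_singleton[of "1::real"]
        by eventually_elim (auto simp: indicator_def)
    qed
    also have "\<dots> = ennreal (1 ^ Suc k / real (Suc k) - 0 ^ Suc k / real (Suc k))"
    proof (rule nn_integral_FTC_Icc[where F = "\<lambda>t. t ^ Suc k / real (Suc k)"])
      show "DERIV (\<lambda>t. t ^ Suc k / real (Suc k)) t :> t ^ k" for t :: real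
        using DERIV_cdivide[OF DERIV_pow[of "Suc k" t], of "real (Suc k)"] by simp
    qed auto
    finally have nn: "(\<integral>\<^sup>+z. ennreal (indicator Delta z * cmod (z - 1) ^ (2 * k)) \<partial>lborel) = ennreal (pi / real (k + 1))"
      by (simp add: divide_inverse flip: ennreal_mult)
    show ?thesis
      unfolding set_lebesgue_integral_def real_scaleR_def
      by (rule integral_eq_nn_integral[THEN trans]) (auto simp: nn intro!: borel_measurable_times borel_measurable_indicator)
  qed
  then have "(LINT z|disc. cmod (z - 1) ^ (2 * k)) = pi / real (k + 1)"
    by (subst integral_restrict_space) (auto simp: set_lebesgue_integral_def)
  then show ?thesis unfolding True * integral_complex_of_real by simp
qed

lemma finite_sum_has_coeffs:
  "has_coeffs (\<lambda>z. \<Sum>k<n. a k * (z - 1) ^ k) (\<lambda>k. if k < n then a k else 0)"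
  unfolding has_coeffs_def
proof
  fix z
  show "(\<lambda>k. (if k < n then a k else 0) * (z - 1) ^ k) sums (\<Sum>k<n. a k * (z - 1) ^ k)"
    using sums_If_finite_set[of "{..<n}" "\<lambda>k. a k * (z - 1) ^ k"]
    by (simp add: if_distrib[of "\<lambda>x. x * _"] cong: if_cong)
qed

lemma has_coeffs_abs_summable:
  assumes a: "has_coeffs f a" and r: "0 \<le> r" "r < 1"
  shows "summable (\<lambda>k. cmod (a k) * r ^ k)"
proof -
  obtain s where s: "r < s" "s < 1" using dense[OF r(2)] by auto
  have "1 + complex_of_real s \<in> Delta" using s r by (simp add: dist_norm)
  then have "summable (\<lambda>k. a k * complex_of_real s ^ k)"
    using a unfolding has_coeffs_def by (force dest: sums_summable)
  then have "summable (\<lambda>k. norm (a k * complex_of_real r ^ k))"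
    by (rule powser_insidea) (use s r in auto)
  then show ?thesis using r by (simp add: norm_mult norm_power)
qed

text \<open>Term by term integration is legitimate on smaller discs, where the Taylor series converges normally,
and the radius then tends to \<open>1\<close> by dominated convergence.\<close>

lemma integral_disc_coeff:
  assumes a: "has_coeffs f a" and int: "integrable disc f"
  shows "(LINT z|disc. f z * cnj ((z - 1) ^ k)) = a k * of_real (pi / real (k + 1))"
proof -
  define r :: "nat \<Rightarrow> real" where "r n = 1 - 1 / real (n + 2)" for n
  have r: "0 < r n" "r n < 1" for n by (auto simp: r_def field_simps)
  have rlim: "r \<longlonglongrightarrow> 1"
    unfolding r_def using LIMSEQ_ignore_initial_segment[OF lim_1_over_n[where 'a = real], of 2]
    using tendsto_diff[OF tendsto_const[of 1]] by fastforce
  let ?I = "\<lambda>n g. LINT z|disc. indicator (ball 1 (r n)) z *\<^sub>R (g z)"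
  have cm[measurable]: "(\<lambda>z. cnj ((z - 1) ^ j)) \<in> borel_measurable disc" "(\<lambda>z. (z - 1) ^ j) \<in> borel_measurable disc" for j
    by (auto intro!: continuous_on_borel_measurable_disc continuous_intros)
  have [measurable]: "ball 1 (r n) \<inter> Delta \<in> sets disc" for n
    by (subst sets_restrict_space_iff) auto
  have ind[measurable]: "(\<lambda>z. indicator (ball 1 (r n)) z :: real) \<in> borel_measurable disc" for n
    by (rule measurable_restrict_space1) (simp add: borel_measurable_indicator)
  have fm[measurable]: "f \<in> borel_measurable disc" using int by auto
  have lim: "(\<lambda>n. ?I n g) \<longlonglongrightarrow> (LINT z|disc. g z)" if g: "integrable disc g" for g :: "complex \<Rightarrow> complex"
  proof (rule integral_dominated_convergence[where w = "\<lambda>z. cmod (g z)"])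
    have [measurable]: "g \<in> borel_measurable disc" using g by auto
    show "(\<lambda>z. indicator (ball 1 (r n)) z *\<^sub>R g z) \<in> borel_measurable disc" for n
      by measurable
    show "AE z in disc. (\<lambda>n. indicator (ball 1 (r n)) z *\<^sub>R g z) \<longlonglongrightarrow> g z"
    proof (rule AE_I2)
      fix z assume "z \<in> space disc"
      then have "dist 1 z < 1" by (simp add: space_restrict_space)
      then have "\<forall>\<^sub>F n in sequentially. dist 1 z < r n" by (rule order_tendstoD[OF rlim])
      then show "(\<lambda>n. indicator (ball 1 (r n)) z *\<^sub>R g z) \<longlonglongrightarrow> g z"
        by (intro tendsto_eventually) (auto elim!: eventually_mono)
    qed
  qed (use g in \<open>auto simp: indicator_def\<close>)
  interpret finite_measure disc by (rule finite_measure_disc)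
  \<comment> \<open>On the disc of radius \<open>r n\<close> the Taylor series is dominated by a convergent numerical series, and all its
    terms but one are orthogonal to \<open>(z - 1) ^ k\<close>.\<close>
  have eq: "?I n (\<lambda>z. f z * cnj ((z - 1) ^ k)) = a k * ?I n (\<lambda>z. (z - 1) ^ k * cnj ((z - 1) ^ k))" for n
  proof -
    let ?h = "\<lambda>j z. indicator (ball 1 (r n)) z *\<^sub>R (a j * (z - 1) ^ j * cnj ((z - 1) ^ k))"
    have hb: "norm (?h j z) \<le> cmod (a j) * r n ^ j" for j z
    proof (cases "z \<in> ball 1 (r n)")
      case True
      then have z: "cmod (z - 1) \<le> r n" by (simp add: dist_norm norm_minus_commute)
      have "cmod (z - 1) ^ j * cmod (z - 1) ^ k \<le> r n ^ j * 1"
        using z r[of n] by (intro mult_mono power_mono power_le_one) auto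
      then have "cmod (a j) * (cmod (z - 1) ^ j * cmod (z - 1) ^ k) \<le> cmod (a j) * r n ^ j"
        by (intro mult_left_mono) auto
      moreover have "norm (?h j z) = cmod (a j) * (cmod (z - 1) ^ j * cmod (z - 1) ^ k)"
        using True by (simp only: norm_mult norm_power mult.assoc complex_mod_cnj norm_scaleR indicator_simps abs_one mult_1_left)
      ultimately show ?thesis by simp
    qed (use r[of n] in auto)
    have hm: "?h j \<in> borel_measurable disc" for j by measurable
    have hi: "integrable disc (?h j)" for j
      by (rule integrable_const_bound[OF AE_I2[OF hb] hm])
    have sm: "summable (\<lambda>j. cmod (a j) * r n ^ j)"
      by (rule has_coeffs_abs_summable[OF a]) (use r[of n] in auto)
    have "?I n (\<lambda>z. f z * cnj ((z - 1) ^ k)) = (LINT z|disc. (\<Sum>j. ?h j z))"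
    proof (rule Bochner_Integration.integral_cong[OF refl])
      fix z assume "z \<in> space disc"
      then have "z \<in> Delta" by (simp add: space_restrict_space)
      then have "(\<lambda>j. a j * (z - 1) ^ j) sums f z" using a by (simp add: has_coeffs_def)
      then have "(\<lambda>j. a j * (z - 1) ^ j * cnj ((z - 1) ^ k)) sums (f z * cnj ((z - 1) ^ k))"
        by (rule sums_mult2)
      then have "(\<lambda>j. ?h j z) sums (indicator (ball 1 (r n)) z *\<^sub>R (f z * cnj ((z - 1) ^ k)))"
        by (rule sums_scaleR_right)
      then show "indicator (ball 1 (r n)) z *\<^sub>R (f z * cnj ((z - 1) ^ k)) = (\<Sum>j. ?h j z)"
        by (simp add: sums_iff)
    qed
    also have "\<dots> = (\<Sum>j. LINT z|disc. ?h j z)"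
    proof (rule integral_suminf[OF hi])
      show "AE z in disc. summable (\<lambda>j. norm (?h j z))"
        by (intro AE_I2 summable_comparison_test'[OF sm, of 0]) (use hb in simp)
      show "summable (\<lambda>j. LINT z|disc. norm (?h j z))"
      proof (rule summable_comparison_test'[OF summable_mult[OF sm, of "measure disc (space disc)"], of 0])
        fix j
        have "(LINT z|disc. norm (?h j z)) \<le> (LINT z|disc. cmod (a j) * r n ^ j)"
          by (intro integral_mono integrable_norm hi hb) auto
        then show "norm (LINT z|disc. norm (?h j z)) \<le> measure disc (space disc) * (cmod (a j) * r n ^ j)"
          by simp
      qed
    qed
    also have "\<dots> = (\<Sum>j. if j = k then a k * ?I n (\<lambda>z. (z - 1) ^ k * cnj ((z - 1) ^ k)) else 0)"
    proof (intro suminf_cong)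
      fix j
      have "(LINT z|disc. ?h j z) = a j * ?I n (\<lambda>z. (z - 1) ^ j * cnj ((z - 1) ^ k))"
        by (subst integral_mult_right_zero[symmetric]) (simp add: mult.assoc scaleR_conv_of_real mult.left_commute)
      moreover have "?I n (\<lambda>z. (z - 1) ^ j * cnj ((z - 1) ^ k)) = 0" if "j \<noteq> k"
      proof -
        have "?I n (\<lambda>z. (z - 1) ^ j * cnj ((z - 1) ^ k)) = (LINT z:ball 1 (r n)|lborel. (z - 1) ^ j * cnj ((z - 1) ^ k))"
          using r[of n] by (subst integral_restrict_space)
             (auto simp: set_lebesgue_integral_def indicator_def intro!: Bochner_Integration.integral_cong)
        also have "\<dots> = 0" by (rule ball_monomials_orthogonal[OF that])
        finally show ?thesis .
      qed
      ultimately show "(LINT z|disc. ?h j z) = (if j = k then a k * ?I n (\<lambda>z. (z - 1) ^ k * cnj ((z - 1) ^ k)) else 0)"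
        by auto
    qed
    also have "\<dots> = a k * ?I n (\<lambda>z. (z - 1) ^ k * cnj ((z - 1) ^ k))"
      using sums_If_finite_set[of "{k}" "\<lambda>j. a k * ?I n (\<lambda>z. (z - 1) ^ k * cnj ((z - 1) ^ k))"]
      by (simp add: sums_iff)
    finally show ?thesis .
  qed
  have le1: "cmod ((z - 1) ^ k) \<le> 1" if "z \<in> Delta" for z
    using that by (auto simp: norm_power dist_norm norm_minus_commute intro!: power_le_one)
  have i1: "integrable disc (\<lambda>z. f z * cnj ((z - 1) ^ k))"
    by (rule Bochner_Integration.integrable_bound[OF int])
       (auto simp del: complex_cnj_power complex_cnj_diff simp: norm_mult space_restrict_space complex_mod_cnj
         intro!: mult_left_le le1 AE_I2)
  have "square_integrable disc (\<lambda>z. (z - 1) ^ k)"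
    by (rule square_integrable_disc_bounded[OF _ le1]) (intro continuous_intros)
  then have i2: "integrable disc (\<lambda>z. (z - 1) ^ k * cnj ((z - 1) ^ k))"
    by (intro integrable_inner_square_integrable)
  have "(\<lambda>n. a k * ?I n (\<lambda>z. (z - 1) ^ k * cnj ((z - 1) ^ k))) \<longlonglongrightarrow> a k * (LINT z|disc. (z - 1) ^ k * cnj ((z - 1) ^ k))"
    by (intro tendsto_mult tendsto_const lim i2)
  with lim[OF i1] have "(LINT z|disc. f z * cnj ((z - 1) ^ k)) = a k * (LINT z|disc. (z - 1) ^ k * cnj ((z - 1) ^ k))"
    unfolding eq by (rule LIMSEQ_unique)
  then show ?thesis unfolding integral_disc_monomials by simp
qed

section \<open>Convergence of Taylor polynomials in the Bergman space\<close>

definition taylor_poly :: "(nat \<Rightarrow> complex) \<Rightarrow> nat \<Rightarrow> complex poly" where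
  "taylor_poly a n = (\<Sum>k<n. smult (a k) ([:-1, 1:] ^ k))"

lemma poly_taylor_poly: "poly (taylor_poly a n) z = (\<Sum>k<n. a k * (z - 1) ^ k)"
  by (simp add: taylor_poly_def poly_sum poly_power)

lemma poly_bergman_space: "poly p \<in> bergman_space"
proof -
  have "bounded (poly p ` cball 1 1)"
    by (intro compact_imp_bounded compact_continuous_image continuous_intros) auto
  then obtain B where B: "\<And>z. z \<in> cball 1 1 \<Longrightarrow> cmod (poly p z) \<le> B"
    unfolding bounded_iff by blast
  have "square_integrable disc (poly p)"
    by (rule square_integrable_disc_bounded[where B = B]) (auto intro!: continuous_intros B)
  then show ?thesis by (auto simp: bergman_space_iff intro!: holomorphic_intros)
qed

lemma square_integrable_disc_imp_integrable:
  assumes "square_integrable disc f"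
  shows "integrable disc f"
proof -
  interpret finite_measure disc by (rule finite_measure_disc)
  have "square_integrable disc (\<lambda>z. 1)" by (simp add: square_integrable_def)
  from integrable_inner_square_integrable[OF assms this] show ?thesis by simp
qed

lemma taylor_poly_has_coeffs: "has_coeffs (poly (taylor_poly a n)) (\<lambda>k. if k < n then a k else 0)"
  using finite_sum_has_coeffs[of a n] by (simp add: poly_taylor_poly[abs_def])

lemma integral_disc_taylor_poly:
  assumes b: "has_coeffs h b" and h: "square_integrable disc h"
  shows "(LINT z|disc. h z * cnj (poly (taylor_poly a n) z)) =
    (\<Sum>k<n. b k * cnj (a k) * of_real (pi / real (k + 1)))"
proof -
  have i: "integrable disc (\<lambda>z. h z * cnj ((z - 1) ^ k))" for k
  proof -
    have "poly ([:-1, 1:] ^ k) = (\<lambda>z::complex. (z - 1) ^ k)" by (simp add: fun_eq_iff poly_power)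
    then show ?thesis
      using poly_bergman_space[of "[:-1, 1:] ^ k"] h
      by (intro integrable_inner_square_integrable) (simp_all add: bergman_space_iff)
  qed
  have "(LINT z|disc. h z * cnj (poly (taylor_poly a n) z)) =
      (LINT z|disc. (\<Sum>k<n. cnj (a k) * (h z * cnj ((z - 1) ^ k))))"
    by (simp add: poly_taylor_poly cnj_sum sum_distrib_left mult_ac)
  also have "\<dots> = (\<Sum>k<n. cnj (a k) * (LINT z|disc. h z * cnj ((z - 1) ^ k)))"
    by (subst Bochner_Integration.integral_sum)
       (auto simp only: integral_mult_right_zero intro!: integrable_mult_right i)
  also have "\<dots> = (\<Sum>k<n. b k * cnj (a k) * of_real (pi / real (k + 1)))"
    by (intro sum.cong refl)
       (simp only: integral_disc_coeff[OF b square_integrable_disc_imp_integrable[OF h]] mult_ac)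
  finally show ?thesis .
qed

text \<open>The Taylor polynomial is the orthogonal projection of \<open>f\<close> to the polynomials of degree less than \<open>n\<close>.\<close>

lemma Pythagoras_taylor_poly:
  assumes f: "f \<in> bergman_space" and a: "has_coeffs f a"
  shows "L2sq disc (\<lambda>z. f z - poly (taylor_poly a n) z) =
    L2sq disc f - (\<Sum>k<n. (cmod (a k))\<^sup>2 * (pi / real (k + 1)))"
proof -
  let ?T = "poly (taylor_poly a n)"
  have sf: "square_integrable disc f" using f by (simp add: bergman_space_iff)
  have sT: "square_integrable disc ?T" using poly_bergman_space by (simp add: bergman_space_iff)
  have sd: "square_integrable disc (\<lambda>z. f z - ?T z)" by (rule square_integrable_diff[OF sf sT])
  have sq: "(LINT z|disc. U z * cnj (U z)) = of_real (L2sq disc U)" for U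
    by (simp add: L2sq_def complex_norm_square[symmetric] flip: of_real_power)
  have c: "complex_of_real ((cmod (a k))\<^sup>2) = a k * cnj (a k)" for k
    by (rule complex_norm_square)
  define s where "s = (\<Sum>k<n. (cmod (a k))\<^sup>2 * (pi / real (k + 1)))"
  have s: "of_real s = (\<Sum>k<n. a k * cnj (a k) * of_real (pi / real (k + 1)))"
    unfolding s_def of_real_sum of_real_mult c ..
  have fT: "(LINT z|disc. f z * cnj (?T z)) = of_real s"
    unfolding s by (rule integral_disc_taylor_poly[OF a sf])
  have TT: "(LINT z|disc. ?T z * cnj (?T z)) = of_real s"
    unfolding integral_disc_taylor_poly[OF taylor_poly_has_coeffs sT] s by (intro sum.cong) auto
  have "(LINT z|disc. ?T z * cnj (f z)) = cnj (LINT z|disc. f z * cnj (?T z))"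
    by (subst Bochner_Integration.integral_cnj[symmetric]) (simp add: mult.commute)
  then have Tf: "(LINT z|disc. ?T z * cnj (f z)) = of_real s" by (simp add: fT)
  note I = integrable_inner_square_integrable
  have "of_real (L2sq disc (\<lambda>z. f z - ?T z)) =
      (LINT z|disc. f z * cnj (f z) - f z * cnj (?T z) - ?T z * cnj (f z) + ?T z * cnj (?T z))"
    unfolding sq[symmetric] by (intro Bochner_Integration.integral_cong) (auto simp: algebra_simps)
  also have "\<dots> = of_real (L2sq disc f) - of_real s - of_real s + of_real s"
    using I[OF sf sf] I[OF sf sT] I[OF sT sf] I[OF sT sT] by (simp add: fT TT Tf sq)
  finally have "complex_of_real (L2sq disc (\<lambda>z. f z - ?T z)) = of_real (L2sq disc f - s)"
    by simp
  then show ?thesis unfolding of_real_eq_iff s_def .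
qed

text \<open>By Bessel's inequality the coefficient sum converges, so the Taylor polynomials form a Cauchy sequence.
Since they converge pointwise to \<open>f\<close>, Fatou's lemma bounds the distance to \<open>f\<close> by the tail of the sum.\<close>

lemma taylor_poly_tendsto:
  assumes f: "f \<in> bergman_space" and a: "has_coeffs f a"
  shows "(\<lambda>n. L2sq disc (\<lambda>z. poly (taylor_poly a n) z - f z)) \<longlonglongrightarrow> 0"
proof -
  let ?T = "\<lambda>n. poly (taylor_poly a n)"
  let ?c = "\<lambda>k. (cmod (a k))\<^sup>2 * (pi / real (k + 1))"
  have c0: "0 \<le> ?c k" for k by simp
  have sf: "square_integrable disc f" using f by (simp add: bergman_space_iff)
  have sT: "square_integrable disc (?T n)" for n using poly_bergman_space by (simp add: bergman_space_iff)
  have bound: "sum ?c {..<n} \<le> L2sq disc f" for n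
    using Pythagoras_taylor_poly[OF f a, of n] L2sq_nonneg[of disc "\<lambda>z. f z - ?T n z"] by linarith
  have sm: "summable ?c"
    by (rule summableI_nonneg_bounded[OF c0 bound])
  have TT: "L2sq disc (\<lambda>z. ?T m z - ?T n z) \<le> suminf ?c - sum ?c {..<n}" if "n \<le> m" for m n
  proof -
    have S: "L2sq disc (?T m) = sum ?c {..<m}"
    proof -
      let ?a = "\<lambda>k. if k < m then a k else 0"
      have "taylor_poly ?a m = taylor_poly a m" by (simp add: taylor_poly_def)
      then have "L2sq disc (\<lambda>z. ?T m z - ?T m z) = L2sq disc (?T m) - (\<Sum>k<m. (cmod (?a k))\<^sup>2 * (pi / real (k + 1)))"
        using Pythagoras_taylor_poly[OF poly_bergman_space taylor_poly_has_coeffs[of a m], of m] by simp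
      moreover have "(\<Sum>k<m. (cmod (?a k))\<^sup>2 * (pi / real (k + 1))) = sum ?c {..<m}"
        by (intro sum.cong) auto
      ultimately show ?thesis by (simp add: L2sq_def)
    qed
    let ?a = "\<lambda>k. if k < m then a k else 0"
    have "taylor_poly ?a n = taylor_poly a n" using that by (simp add: taylor_poly_def)
    then have "L2sq disc (\<lambda>z. ?T m z - ?T n z) = L2sq disc (?T m) - (\<Sum>k<n. (cmod (?a k))\<^sup>2 * (pi / real (k + 1)))"
      using Pythagoras_taylor_poly[OF poly_bergman_space taylor_poly_has_coeffs[of a m], of n] by simp
    also have "(\<Sum>k<n. (cmod (?a k))\<^sup>2 * (pi / real (k + 1))) = sum ?c {..<n}"
      using that by (intro sum.cong) auto
    also have "L2sq disc (?T m) \<le> suminf ?c"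
      unfolding S by (rule sum_le_suminf[OF sm]) (auto intro: c0)
    finally show ?thesis by simp
  qed
  have le: "L2sq disc (\<lambda>z. f z - ?T n z) \<le> suminf ?c - sum ?c {..<n}" for n
  proof (rule L2sq_Fatou(2)[where F = "\<lambda>m z. ?T m z - ?T n z"])
    show "square_integrable disc (\<lambda>z. ?T m z - ?T n z)" for m
      by (intro square_integrable_diff sT)
    show "(\<lambda>z. f z - ?T n z) \<in> borel_measurable disc"
      by (rule square_integrableD[OF square_integrable_diff[OF sf sT]])
    show "AE z in disc. (\<lambda>m. ?T m z - ?T n z) \<longlonglongrightarrow> f z - ?T n z"
    proof (intro AE_I2 tendsto_diff tendsto_const)
      fix z assume "z \<in> space disc"
      then have "(\<lambda>k. a k * (z - 1) ^ k) sums f z"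
        using a by (simp add: has_coeffs_def space_restrict_space)
      then show "(\<lambda>m. ?T m z) \<longlonglongrightarrow> f z"
        by (simp add: sums_def poly_taylor_poly)
    qed
    show "\<forall>\<^sub>F m in sequentially. L2sq disc (\<lambda>z. ?T m z - ?T n z) \<le> suminf ?c - sum ?c {..<n}"
      using TT by (auto simp: eventually_sequentially)
  qed
  have "(\<lambda>n. suminf ?c - sum ?c {..<n}) \<longlonglongrightarrow> suminf ?c - suminf ?c"
    by (intro tendsto_diff tendsto_const summable_LIMSEQ sm)
  then have "(\<lambda>n. suminf ?c - sum ?c {..<n}) \<longlonglongrightarrow> 0" by simp
  then have "(\<lambda>n. L2sq disc (\<lambda>z. f z - ?T n z)) \<longlonglongrightarrow> 0"
    by (rule Lim_null_comparison[rotated]) (use le in simp)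
  then show ?thesis by (simp only: L2sq_commute[of disc f])
qed

lemma bergman_inner_sums:
  assumes h: "h \<in> bergman_space" "has_coeffs h b" and f: "f \<in> bergman_space" "has_coeffs f a"
  shows "(\<lambda>k. b k * cnj (a k) / of_nat (k + 1)) sums bergman_inner h f"
proof -
  have sh: "square_integrable disc h" and sf: "square_integrable disc f"
    and sT: "square_integrable disc (poly (taylor_poly a n))" for n
    using h f poly_bergman_space by (auto simp: bergman_space_iff)
  have "(\<lambda>n. LINT z|disc. h z * cnj (poly (taylor_poly a n) z)) \<longlonglongrightarrow> (LINT z|disc. h z * cnj (f z))"
    by (rule L2_inner_tendsto[OF sh sh sT sf _ taylor_poly_tendsto[OF f]]) (simp add: L2sq_def)
  then have "(\<lambda>n. (LINT z|disc. h z * cnj (poly (taylor_poly a n) z)) / of_real pi) \<longlonglongrightarrow> bergman_inner h f"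
    unfolding bergman_inner_altdef by (intro tendsto_divide tendsto_const) auto
  moreover have "(LINT z|disc. h z * cnj (poly (taylor_poly a n) z)) / of_real pi =
      (\<Sum>k<n. b k * cnj (a k) / of_nat (k + 1))" for n
    unfolding integral_disc_taylor_poly[OF h(2) sh] sum_divide_distrib
    by (intro sum.cong refl) (simp add: field_simps del: of_nat_Suc)
  ultimately show ?thesis by (simp add: sums_def)
qed

section \<open>Mellin-Bergman transforms of polynomials and kernels\<close>

lemma Delta_Re_pos: "z \<in> Delta \<Longrightarrow> 0 < Re z"
  using abs_Re_le_cmod[of "1 - z"] by (auto simp: dist_norm)

lemma Delta_nonpos_Reals: "z \<in> Delta \<Longrightarrow> z \<notin> \<real>\<^sub>\<le>\<^sub>0"
  using Delta_Re_pos[of z] by (auto simp: complex_nonpos_Reals_iff)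

lemma powr_has_coeffs: "has_coeffs (\<lambda>\<zeta>. \<zeta> powr w) (\<lambda>k. w gchoose k)"
  unfolding has_coeffs_def
proof
  fix z :: complex assume "z \<in> Delta"
  then show "(\<lambda>k. (w gchoose k) * (z - 1) ^ k) sums z powr w"
    using gen_binomial_complex[of "z - 1" w] by (simp add: dist_norm norm_minus_commute)
qed

text \<open>The argument of \<open>z\<close> is bounded, so only the modulus matters, and \<open>|z| powr (2 Re w)\<close> is integrable near \<open>0\<close>
exactly if \<open>2 Re w > - 2\<close>. The disc is enlarged to a disc about \<open>0\<close> to make the integral radial.\<close>

lemma powr_bergman_space:
  assumes "- 1 < Re w"
  shows "(\<lambda>\<zeta>. \<zeta> powr w) \<in> bergman_space"
proof -
  have holo: "(\<lambda>\<zeta>. \<zeta> powr w) holomorphic_on Delta"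
    using Delta_nonpos_Reals by (intro holomorphic_intros) auto
  then have [measurable]: "(\<lambda>\<zeta>. \<zeta> powr w) \<in> borel_measurable disc"
    by (intro continuous_on_borel_measurable_disc holomorphic_on_imp_continuous_on)
  have [measurable]: "ball 0 2 \<in> sets (borel :: complex measure)" by simp
  let ?c = "exp (2 * (pi * \<bar>Im w\<bar>))"
  have le: "(cmod (z powr w))\<^sup>2 \<le> ?c * cmod z powr (2 * Re w)" for z
  proof -
    have "- (Im w * Arg z) \<le> \<bar>Im w\<bar> * \<bar>Arg z\<bar>"
      by (metis abs_ge_minus_self abs_mult)
    also have "\<dots> \<le> \<bar>Im w\<bar> * pi"
      using Arg_bounded[of z] by (intro mult_left_mono) auto
    finally have "exp (- Im w * Arg z) \<le> exp (pi * \<bar>Im w\<bar>)" by (simp add: mult.commute)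
    then have "cmod (z powr w) \<le> cmod z powr Re w * exp (pi * \<bar>Im w\<bar>)"
      unfolding norm_powr_complex by (intro mult_left_mono) auto
    then have "(cmod (z powr w))\<^sup>2 \<le> (cmod z powr Re w * exp (pi * \<bar>Im w\<bar>))\<^sup>2"
      by (intro power_mono) auto
    also have "\<dots> = ?c * cmod z powr (2 * Re w)"
    proof -
      have "(exp (pi * \<bar>Im w\<bar>))\<^sup>2 = ?c" by (simp add: exp_double)
      moreover have "(cmod z powr Re w)\<^sup>2 = cmod z powr (2 * Re w)"
        by (simp only: power2_eq_square powr_add[symmetric] mult_2)
      ultimately show ?thesis by (simp only: power_mult_distrib mult.commute)
    qed
    finally show ?thesis .
  qed
  have "(\<integral>\<^sup>+z. ennreal ((cmod (z powr w))\<^sup>2) \<partial>disc) =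
      (\<integral>\<^sup>+z. ennreal ((cmod (z powr w))\<^sup>2) * indicator Delta z \<partial>lborel)"
    by (subst nn_integral_restrict_space) auto
  also have "\<dots> \<le> (\<integral>\<^sup>+z. ennreal ?c * (ennreal (cmod (z - 0) powr (2 * Re w)) * indicator (ball 0 2) z) \<partial>lborel)"
  proof (rule nn_integral_mono)
    fix z :: complex
    have "indicator Delta z \<le> (indicator (ball 0 2) z :: ennreal)"
      using dist_triangle[of 0 z 1] by (auto simp: indicator_def)
    then have "ennreal ((cmod (z powr w))\<^sup>2) * indicator Delta z \<le>
        ennreal (?c * cmod z powr (2 * Re w)) * indicator (ball 0 2) z"
      using le by (intro mult_mono ennreal_leI) auto
    then show "ennreal ((cmod (z powr w))\<^sup>2) * indicator Delta z \<le>
        ennreal ?c * (ennreal (cmod (z - 0) powr (2 * Re w)) * indicator (ball 0 2) z)"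
      by (simp add: ennreal_mult mult.assoc)
  qed
  also have "\<dots> = ennreal ?c * ennreal (2 * pi * 2 powr (2 * Re w + 2) / (2 * Re w + 2))"
    using assms by (subst nn_integral_cmult, measurable) (subst nn_integral_norm_powr_ball, simp_all)
  also have "\<dots> = ennreal (?c * (2 * pi * 2 powr (2 * Re w + 2) / (2 * Re w + 2)))"
    using assms by (intro ennreal_mult[symmetric]) auto
  finally have "square_integrable disc (\<lambda>z. z powr w)"
    using assms by (intro square_integrable_nn(1)) auto
  with holo show ?thesis by (simp add: bergman_space_iff)
qed

text \<open>The transform is an inner product with a power, hence continuous in \<open>f\<close> and computable from Taylor coefficients.\<close>

lemma mellin_bergman_eq_inner: "mellin_bergman f z = bergman_inner f (\<lambda>\<zeta>. \<zeta> powr (cnj z - 1))"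
proof -
  have "(LINT \<zeta>:Delta|lborel. f \<zeta> * cnj \<zeta> powr (z - 1)) = (LINT \<zeta>:Delta|lborel. f \<zeta> * cnj (\<zeta> powr (cnj z - 1)))"
  proof (rule set_lebesgue_integral_cong)
    show "\<forall>\<zeta>. \<zeta> \<in> Delta \<longrightarrow> f \<zeta> * cnj \<zeta> powr (z - 1) = f \<zeta> * cnj (\<zeta> powr (cnj z - 1))"
    proof (intro allI impI)
      fix \<zeta> :: complex assume "\<zeta> \<in> Delta"
      then have "0 < Re \<zeta>" by (rule Delta_Re_pos)
      then show "f \<zeta> * cnj \<zeta> powr (z - 1) = f \<zeta> * cnj (\<zeta> powr (cnj z - 1))"
        by (subst cnj_powr) auto
    qed
  qed simp
  then show ?thesis by (simp add: mellin_bergman_def bergman_inner_def)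
qed

lemma cnj_gbinomial: "cnj (w gchoose k) = cnj w gchoose k"
  by (simp add: gbinomial_prod_rev)

lemma mellin_bergman_sums:
  assumes "f \<in> bergman_space" "has_coeffs f a" "0 < Re z"
  shows "(\<lambda>k. a k * ((z - 1) gchoose k) / of_nat (k + 1)) sums mellin_bergman f z"
  using bergman_inner_sums[OF assms(1,2) powr_bergman_space powr_has_coeffs, of "cnj z - 1"] assms(3)
  by (simp add: mellin_bergman_eq_inner cnj_gbinomial)

text \<open>The factor \<open>1 / (k + 1)\<close> is absorbed by \<open>(m choose k) / (k + 1) = (m + 1 choose k + 1) / (m + 1)\<close>.\<close>

lemma Vandermonde_weighted:
  fixes w :: complex
  shows "(\<lambda>k. of_nat (m choose k) * (w gchoose k) / of_nat (k + 1)) sums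
    (((w + of_nat m + 1) gchoose m) / of_nat (m + 1))"
proof -
  have "(\<lambda>k. of_nat (m choose k) * (w gchoose k) / of_nat (k + 1)) sums
      (\<Sum>k\<in>{0..m}. of_nat (m choose k) * (w gchoose k) / of_nat (k + 1))"
    by (rule sums_finite) auto
  also have "(\<Sum>k\<in>{0..m}. of_nat (m choose k) * (w gchoose k) / of_nat (k + 1)) =
      (\<Sum>k\<in>{0..m}. (w gchoose k) * (of_nat (m + 1) gchoose (m - k))) / of_nat (m + 1)"
    unfolding sum_divide_distrib
  proof (rule sum.cong[OF refl])
    fix k assume k: "k \<in> {0..m}"
    have "Suc k * (Suc m choose Suc k) = Suc m * (m choose k)"
      by (rule Suc_times_binomial)
    moreover have "Suc m choose Suc k = Suc m choose (m - k)"
      using k binomial_symmetric[of "Suc k" "Suc m"] by simp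
    ultimately have "(k + 1) * ((m + 1) choose (m - k)) = (m + 1) * (m choose k)" by simp
    then have "complex_of_nat (k + 1) * of_nat ((m + 1) choose (m - k)) = of_nat (m + 1) * of_nat (m choose k)"
      by (simp only: of_nat_mult[symmetric])
    then have "complex_of_nat (m choose k) / of_nat (k + 1) = (of_nat (m + 1) gchoose (m - k)) / of_nat (m + 1)"
      unfolding binomial_gbinomial[of "m + 1"] by (simp add: field_simps del: of_nat_Suc)
    then have "(w gchoose k) * (complex_of_nat (m choose k) / of_nat (k + 1)) =
        (w gchoose k) * ((of_nat (m + 1) gchoose (m - k)) / of_nat (m + 1))"
      by simp
    then show "of_nat (m choose k) * (w gchoose k) / of_nat (k + 1) =
        (w gchoose k) * (of_nat (m + 1) gchoose (m - k)) / of_nat (m + 1)"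
      by (simp only: times_divide_eq_right mult.commute)
  qed
  also have "\<dots> = ((w + of_nat m + 1) gchoose m) / of_nat (m + 1)"
    unfolding gbinomial_Vandermonde by (simp add: add_ac)
  finally show ?thesis .
qed

lemma poly_has_coeffs: "has_coeffs (poly p) (\<lambda>k. \<Sum>m\<le>degree p. coeff p m * of_nat (m choose k))"
  unfolding has_coeffs_def
proof
  fix z :: complex
  have "(\<lambda>k. of_nat (m choose k) * (z - 1) ^ k) sums z ^ m" for m
  proof -
    have "(\<lambda>k. of_nat (m choose k) * (z - 1) ^ k) sums (\<Sum>k\<le>m. of_nat (m choose k) * (z - 1) ^ k)"
      by (rule sums_finite) auto
    also have "\<dots> = z ^ m" using binomial_ring[of "z - 1" 1 m] by simp
    finally show ?thesis .
  qed
  then have "(\<lambda>k. \<Sum>m\<le>degree p. coeff p m * (of_nat (m choose k) * (z - 1) ^ k)) sums (\<Sum>m\<le>degree p. coeff p m * z ^ m)"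
    by (intro sums_sum sums_mult)
  then show "(\<lambda>k. (\<Sum>m\<le>degree p. coeff p m * of_nat (m choose k)) * (z - 1) ^ k) sums poly p z"
    by (simp add: poly_altdef sum_distrib_right mult.assoc)
qed

lemma bergman_inner_poly_binomial:
  assumes g: "g \<in> bergman_space" "has_coeffs g (\<lambda>k. w gchoose k)"
  shows "bergman_inner (poly p) g = (\<Sum>m\<le>degree p. coeff p m * (((cnj w + of_nat m + 1) gchoose m) / of_nat (m + 1)))"
proof -
  have A: "(\<lambda>k. \<Sum>m\<le>degree p. coeff p m * (of_nat (m choose k) * (cnj w gchoose k) / of_nat (k + 1))) sums
      (\<Sum>m\<le>degree p. coeff p m * (((cnj w + of_nat m + 1) gchoose m) / of_nat (m + 1)))"
    by (intro sums_sum sums_mult Vandermonde_weighted)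
  have B: "(\<lambda>k. \<Sum>m\<le>degree p. coeff p m * (of_nat (m choose k) * (cnj w gchoose k) / of_nat (k + 1))) sums
      bergman_inner (poly p) g"
    using bergman_inner_sums[OF poly_bergman_space poly_has_coeffs g, of p]
    by (simp only: cnj_gbinomial sum_distrib_right sum_divide_distrib mult.assoc times_divide_eq_right)
  show ?thesis by (rule sums_unique2[OF B A])
qed

lemma gbinomial_Gamma:
  assumes "0 < Re z"
  shows "Gamma (z + 1) * (((z + of_nat m) gchoose m) / of_nat (m + 1)) = Gamma (of_nat (Suc m) + z) / fact (Suc m)"
proof -
  have "z + 1 \<notin> \<int>\<^sub>\<le>\<^sub>0" using assms by (auto elim!: nonpos_Ints_cases simp: complex_eq_iff)
  then have "pochhammer (z + 1) m = Gamma (z + 1 + of_nat m) / Gamma (z + 1)" "Gamma (z + 1) \<noteq> 0"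
    by (auto simp: pochhammer_Gamma Gamma_eq_zero_iff)
  then show ?thesis
    unfolding gbinomial_pochhammer' by (simp add: add_ac field_simps)
qed

definition poly_mellin :: "complex poly \<Rightarrow> complex \<Rightarrow> complex" where
  "poly_mellin p z = gamma_sum p z / 2 powr z"

lemma weighted_mellin_poly:
  assumes "0 < Re z"
  shows "weighted_mellin (poly p) z = poly_mellin p z"
proof -
  have w: "- 1 < Re (cnj z - 1)" using assms by simp
  have "weighted_mellin (poly p) z = Gamma (z + 1) / 2 powr z *
      (\<Sum>m\<le>degree p. coeff p m * (((z + of_nat m) gchoose m) / of_nat (m + 1)))"
    unfolding weighted_mellin_def mellin_bergman_eq_inner
      bergman_inner_poly_binomial[OF powr_bergman_space[OF w] powr_has_coeffs] by simp
  also have "\<dots> = (\<Sum>m\<le>degree p. coeff p m * (Gamma (z + 1) * (((z + of_nat m) gchoose m) / of_nat (m + 1)))) / 2 powr z"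
    by (simp add: sum_distrib_left sum_divide_distrib mult_ac del: of_nat_Suc)
  also have "\<dots> = poly_mellin p z"
    unfolding gbinomial_Gamma[OF assms] poly_mellin_def gamma_sum_def by (simp add: mult_ac del: fact_Suc)
  finally show ?thesis .
qed

text \<open>The Gram matrix of the monomials is a special case of the transform: \<open>\<zeta> ^ n\<close> is the power whose binomial
coefficients at \<open>1\<close> are ordinary ones.\<close>

lemma bergman_inner_poly_self: "bergman_inner (poly p) (poly p) = of_real (laguerre_energy p)"
proof -
  have val: "(((of_nat n + of_nat m + 1) gchoose m) / of_nat (m + 1) :: complex) = fact (m + n + 1) / (fact (Suc m) * fact (Suc n))" for m n
  proof -
    have "((of_nat n + of_nat m + 1) gchoose m :: complex) = of_nat ((m + n + 1) choose m)"
      by (simp add: binomial_gbinomial add_ac)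
    also have "\<dots> = fact (m + n + 1) / (fact m * fact (Suc n))"
      by (subst binomial_fact) auto
    finally show ?thesis by (simp add: mult_ac)
  qed
  have mono: "bergman_inner (poly p) (\<lambda>z. z ^ n) = (\<Sum>m\<le>degree p. coeff p m * (fact (m + n + 1) / (fact (Suc m) * fact (Suc n))))" for n
  proof -
    have eq: "poly (monom 1 n) = (\<lambda>z::complex. z ^ n)" by (simp add: poly_monom fun_eq_iff)
    have mem: "(\<lambda>z. z ^ n) \<in> bergman_space"
      using poly_bergman_space[of "monom 1 n"] unfolding eq .
    have co: "has_coeffs (\<lambda>z. z ^ n) (\<lambda>k. of_nat n gchoose k)"
    proof -
      have "(\<Sum>m\<le>n. coeff (monom 1 n) m * of_nat (m choose k)) = (of_nat n gchoose k :: complex)" for k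
        by (simp add: binomial_gbinomial sum.delta if_distrib[of "\<lambda>x. x * _"] cong: if_cong)
      then show ?thesis
        using poly_has_coeffs[of "monom 1 n"] unfolding eq by (simp add: degree_monom_eq)
    qed
    show ?thesis
      unfolding bergman_inner_poly_binomial[OF mem co] by (simp only: complex_cnj_of_nat val)
  qed
  have s: "square_integrable disc (poly p)" "square_integrable disc (\<lambda>z. z ^ n)" for n
    using poly_bergman_space[of p] poly_bergman_space[of "monom 1 n"]
    by (simp_all add: bergman_space_iff poly_monom[abs_def])
  have "(LINT z|disc. poly p z * cnj (poly p z)) =
      (LINT z|disc. (\<Sum>n\<le>degree p. cnj (coeff p n) * (poly p z * cnj (z ^ n))))"
  proof (rule Bochner_Integration.integral_cong[OF refl])
    fix z
    have "cnj (poly p z) = (\<Sum>n\<le>degree p. cnj (coeff p n) * cnj (z ^ n))"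
      unfolding poly_altdef by simp
    then show "poly p z * cnj (poly p z) = (\<Sum>n\<le>degree p. cnj (coeff p n) * (poly p z * cnj (z ^ n)))"
      by (simp only: sum_distrib_left mult.left_commute)
  qed
  also have "\<dots> = (\<Sum>n\<le>degree p. cnj (coeff p n) * (LINT z|disc. poly p z * cnj (z ^ n)))"
    by (subst Bochner_Integration.integral_sum)
       (auto simp only: integral_mult_right_zero intro!: integrable_mult_right integrable_inner_square_integrable s)
  finally have "bergman_inner (poly p) (poly p) = (\<Sum>n\<le>degree p. cnj (coeff p n) * bergman_inner (poly p) (\<lambda>z. z ^ n))"
    by (simp add: bergman_inner_altdef sum_divide_distrib)
  also have "\<dots> = (\<Sum>n\<le>degree p. \<Sum>m\<le>degree p. coeff p m * cnj (coeff p n) * (fact (m + n + 1) / (fact (Suc m) * fact (Suc n))))"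
    unfolding mono sum_distrib_left by (simp add: mult_ac del: fact_Suc)
  also have "\<dots> = of_real (laguerre_energy p)"
    unfolding laguerre_energy(2) by (rule sum.swap)
  finally show ?thesis .
qed

lemma L2sq_disc_poly: "L2sq disc (poly p) = pi * laguerre_energy p"
proof -
  have "bergman_inner (poly p) (poly p) = of_real (L2sq disc (poly p) / pi)"
    by (simp add: bergman_inner_altdef L2sq_def complex_norm_square[symmetric] flip: of_real_power)
  then show ?thesis unfolding bergman_inner_poly_self of_real_eq_iff by (simp add: field_simps)
qed

text \<open>The reproducing kernel of the Bergman space of the disc at the real point \<open>\<eta>\<close>.\<close>

definition disc_kernel :: "real \<Rightarrow> complex \<Rightarrow> complex" where
  "disc_kernel \<eta> \<zeta> = 1 / (1 - (\<zeta> - 1) * (of_real \<eta> - 1))\<^sup>2"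

lemma
  assumes \<eta>: "0 < \<eta>" "\<eta> < 2"
  shows disc_kernel_bergman_space: "disc_kernel \<eta> \<in> bergman_space"
    and disc_kernel_has_coeffs: "has_coeffs (disc_kernel \<eta>) (\<lambda>k. of_nat (k + 1) * (of_real \<eta> - 1) ^ k)"
proof -
  have n: "cmod (of_real \<eta> - 1) = \<bar>\<eta> - 1\<bar>"
    by (metis norm_of_real of_real_1 of_real_diff)
  have lt: "cmod ((z - 1) * (of_real \<eta> - 1)) \<le> \<bar>\<eta> - 1\<bar>" if "z \<in> Delta" for z
    unfolding norm_mult n
    using that by (intro mult_left_le_one_le) (auto simp: dist_norm norm_minus_commute)
  have eta1: "\<bar>\<eta> - 1\<bar> < 1" using \<eta> by auto
  have lower: "1 - \<bar>\<eta> - 1\<bar> \<le> cmod (1 - (z - 1) * (of_real \<eta> - 1))" if "z \<in> Delta" for z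
    using lt[OF that] norm_triangle_ineq2[of 1 "(z - 1) * (of_real \<eta> - 1)"] by simp
  have nz: "1 - (z - 1) * (of_real \<eta> - 1) \<noteq> 0" if "z \<in> Delta" for z
    using lower[OF that] eta1 by auto
  have holo: "disc_kernel \<eta> holomorphic_on Delta"
    unfolding disc_kernel_def[abs_def] using nz by (intro holomorphic_intros) auto
  have "cmod (disc_kernel \<eta> z) \<le> 1 / (1 - \<bar>\<eta> - 1\<bar>)\<^sup>2" if "z \<in> Delta" for z
    unfolding disc_kernel_def norm_divide norm_power norm_one
    using lower[OF that] eta1 by (intro divide_left_mono power_mono mult_pos_pos zero_less_power) auto
  then have "square_integrable disc (disc_kernel \<eta>)"
    by (rule square_integrable_disc_bounded[OF holomorphic_on_imp_continuous_on[OF holo]])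
  with holo show "disc_kernel \<eta> \<in> bergman_space" by (simp add: bergman_space_iff)
  show "has_coeffs (disc_kernel \<eta>) (\<lambda>k. of_nat (k + 1) * (of_real \<eta> - 1) ^ k)"
    unfolding has_coeffs_def
  proof
    fix z :: complex assume "z \<in> Delta"
    then have "(\<lambda>k. of_nat (Suc k) * ((z - 1) * (of_real \<eta> - 1)) ^ k) sums disc_kernel \<eta> z"
      unfolding disc_kernel_def using lt[of z] eta1 by (intro geometric_deriv_sums) auto
    then show "(\<lambda>k. of_nat (k + 1) * (of_real \<eta> - 1) ^ k * (z - 1) ^ k) sums disc_kernel \<eta> z"
      by (simp add: power_mult_distrib mult_ac del: of_nat_Suc)
  qed
qed

definition kernel_mellin :: "real \<Rightarrow> complex \<Rightarrow> complex" where
  "kernel_mellin \<eta> z = Gamma (z + 1) / 2 powr z * of_real \<eta> powr (z - 1)"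

text \<open>The coefficients \<open>(k + 1) (\<eta> - 1) ^ k\<close> of the kernel turn the coefficient formula for the transform into the
binomial series of \<open>\<eta> powr (z - 1)\<close>.\<close>

lemma weighted_mellin_disc_kernel:
  assumes \<eta>: "0 < \<eta>" "\<eta> < 2" and z: "0 < Re z"
  shows "weighted_mellin (disc_kernel \<eta>) z = kernel_mellin \<eta> z"
proof -
  have "cmod (of_real \<eta> - 1) = \<bar>\<eta> - 1\<bar>"
    by (metis norm_of_real of_real_1 of_real_diff)
  then have "cmod (of_real \<eta> - 1) < 1"
    using \<eta> by auto
  then have A: "(\<lambda>k. ((z - 1) gchoose k) * (of_real \<eta> - 1) ^ k) sums of_real \<eta> powr (z - 1)"
    using gen_binomial_complex[of "of_real \<eta> - 1" "z - 1"] by simp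
  have B: "(\<lambda>k. ((z - 1) gchoose k) * (of_real \<eta> - 1) ^ k) sums mellin_bergman (disc_kernel \<eta>) z"
    using mellin_bergman_sums[OF disc_kernel_bergman_space[OF \<eta>] disc_kernel_has_coeffs[OF \<eta>] z]
    by (simp add: mult_ac divide_simps del: of_nat_Suc)
  have "mellin_bergman (disc_kernel \<eta>) z = of_real \<eta> powr (z - 1)"
    by (rule sums_unique2[OF B A])
  then show ?thesis by (simp add: weighted_mellin_def kernel_mellin_def)
qed

section \<open>Boundary values on the imaginary axis\<close>

lemma gamma_sum_extend:
  assumes "degree p \<le> N"
  shows "gamma_sum p z = (\<Sum>m\<le>N. coeff p m / fact (Suc m) * Gamma (of_nat (Suc m) + z))"
  unfolding gamma_sum_def
  by (rule sum.mono_neutral_left) (use assms in \<open>auto simp: coeff_eq_0\<close>)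

lemma poly_mellin_add: "poly_mellin (p + q) z = poly_mellin p z + poly_mellin q z"
proof -
  let ?N = "max (degree p) (degree q)"
  have "degree (p + q) \<le> ?N" by (rule degree_add_le_max)
  then show ?thesis
    unfolding poly_mellin_def gamma_sum_extend[of "p + q" ?N] gamma_sum_extend[of p ?N, OF max.cobounded1]
      gamma_sum_extend[of q ?N, OF max.cobounded2]
    by (simp add: gamma_sum_extend[of "p + q" ?N] sum.distrib add_divide_distrib distrib_right)
qed

lemma poly_mellin_smult: "poly_mellin (smult c p) z = c * poly_mellin p z"
  unfolding poly_mellin_def gamma_sum_extend[of "smult c p" "degree p" for p, OF degree_smult_le]
  by (simp add: gamma_sum_def sum_distrib_left mult.assoc)

lemma poly_mellin_diff: "poly_mellin (p - q) z = poly_mellin p z - poly_mellin q z"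
  using poly_mellin_add[of p "smult (- 1) q" z] poly_mellin_smult[of "- 1" q z] by simp

text \<open>Such functions have their restriction to the imaginary axis as boundary value, by dominated convergence.
Both the transforms of polynomials and those of the kernels are of this kind.\<close>

definition strip_decay :: "(complex \<Rightarrow> complex) \<Rightarrow> bool" where
  "strip_decay G \<longleftrightarrow> continuous_on {z. - 1 < Re z} G \<and>
     (\<exists>C. \<forall>x\<in>{0..1}. \<forall>y. cmod (G (Complex x y)) \<le> C / (1 + y\<^sup>2))"

lemma cmod_2_powr: "cmod (2 powr z) = 2 powr Re z"
  by (simp add: norm_powr_real_powr)

lemma strip_decay_poly_mellin: "strip_decay (poly_mellin p)"
  unfolding strip_decay_def
proof
  show "continuous_on {z. - 1 < Re z} (poly_mellin p)"
    unfolding poly_mellin_def[abs_def] by (intro continuous_intros continuous_on_gamma_sum) auto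
  obtain C where C: "\<And>x y. x \<in> {0..1} \<Longrightarrow> cmod (gamma_sum p (Complex x y)) \<le> C / (1 + y\<^sup>2)"
    using gamma_sum_decay[of 1 p] by blast
  show "\<exists>C. \<forall>x\<in>{0..1}. \<forall>y. cmod (poly_mellin p (Complex x y)) \<le> C / (1 + y\<^sup>2)"
  proof (intro exI ballI allI)
    fix x y :: real assume x: "x \<in> {0..1}"
    have "cmod (poly_mellin p (Complex x y)) = cmod (gamma_sum p (Complex x y)) / 2 powr x"
      by (simp add: poly_mellin_def norm_divide cmod_2_powr)
    also have "\<dots> \<le> cmod (gamma_sum p (Complex x y)) / 1"
      using x by (intro divide_left_mono) (auto simp: ge_one_powr_ge_zero)
    also have "\<dots> \<le> C / (1 + y\<^sup>2)" using C[OF x] by simp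
    finally show "cmod (poly_mellin p (Complex x y)) \<le> C / (1 + y\<^sup>2)" .
  qed
qed

lemma kernel_mellin_eq: "kernel_mellin \<eta> z = poly_mellin 1 z * of_real \<eta> powr (z - 1)"
  by (simp add: kernel_mellin_def poly_mellin_def gamma_sum_def add.commute)

lemma strip_decay_kernel_mellin:
  assumes "0 < \<eta>"
  shows "strip_decay (kernel_mellin \<eta>)"
  unfolding strip_decay_def
proof
  have c: "continuous_on {z. - 1 < Re z} (poly_mellin 1)" using strip_decay_poly_mellin[of 1] by (simp add: strip_decay_def)
  show "continuous_on {z. - 1 < Re z} (kernel_mellin \<eta>)"
    unfolding kernel_mellin_eq[abs_def] using assms
    by (intro continuous_intros c) auto
  obtain C where C: "\<And>x y. x \<in> {0..1} \<Longrightarrow> cmod (poly_mellin 1 (Complex x y)) \<le> C / (1 + y\<^sup>2)"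
    using strip_decay_poly_mellin[of 1] unfolding strip_decay_def by blast
  show "\<exists>C. \<forall>x\<in>{0..1}. \<forall>y. cmod (kernel_mellin \<eta> (Complex x y)) \<le> C / (1 + y\<^sup>2)"
  proof (intro exI ballI allI)
    fix x y :: real assume x: "x \<in> {0..1}"
    have "\<eta> powr (x - 1) \<le> 1 + 1 / \<eta>"
    proof (cases "\<eta> \<le> 1")
      case True
      then have "\<eta> powr (x - 1) \<le> \<eta> powr (- 1)" using assms x by (intro powr_mono') auto
      then show ?thesis using assms by (simp add: powr_minus_divide)
    next
      case False
      then have "\<eta> powr (x - 1) \<le> \<eta> powr 0" using x by (intro powr_mono) auto
      then show ?thesis using assms by (simp add: add_increasing2)
    qed
    then have "cmod (poly_mellin 1 (Complex x y)) * \<eta> powr (x - 1) \<le> C / (1 + y\<^sup>2) * (1 + 1 / \<eta>)"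
      by (intro mult_mono C[OF x] order_trans[OF norm_ge_zero C[OF x]]) simp_all
    moreover have "cmod (kernel_mellin \<eta> (Complex x y)) = cmod (poly_mellin 1 (Complex x y)) * \<eta> powr (x - 1)"
      using assms by (simp add: kernel_mellin_eq norm_mult norm_powr_real_powr)
    ultimately show "cmod (kernel_mellin \<eta> (Complex x y)) \<le> (C * (1 + 1 / \<eta>)) / (1 + y\<^sup>2)"
      by simp
  qed
qed

lemma strip_decay_line:
  assumes "strip_decay G" "x \<in> {0..1}"
  shows "square_integrable lborel (\<lambda>y. G (Complex x y))"
proof -
  obtain C where "\<And>y. cmod (G (Complex x y)) \<le> C / (1 + y\<^sup>2)"
    using assms unfolding strip_decay_def by blast
  then show ?thesis
    using assms by (intro square_integrable_decay borel_measurable_on_line) (auto simp: strip_decay_def)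
qed

lemma strip_decay_tendsto_boundary:
  assumes G: "strip_decay G"
  shows "((\<lambda>x. L2sq lborel (\<lambda>y. G (Complex x y) - G (Complex 0 y))) \<longlongrightarrow> 0) (at_right 0)"
proof (rule tendsto_at_right_sequentially[of 0 1])
  fix S :: "nat \<Rightarrow> real"
  assume S: "\<And>n. 0 < S n" "\<And>n. S n < 1" "S \<longlonglongrightarrow> 0"
  have m1: "- 1 < S n" for n using S(1)[of n] by linarith
  have S01: "S n \<in> {0..1}" for n using S(1,2)[of n] by simp
  obtain C where C: "\<And>x y. x \<in> {0..1} \<Longrightarrow> cmod (G (Complex x y)) \<le> C / (1 + y\<^sup>2)"
    using G unfolding strip_decay_def by blast
  have sq: "square_integrable lborel (\<lambda>y::real. of_real (2 * C / (1 + y\<^sup>2)))"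
  proof (rule square_integrable_decay[where C = "2 * \<bar>C\<bar>"])
    show "cmod (of_real (2 * C / (1 + y\<^sup>2))) \<le> 2 * \<bar>C\<bar> / (1 + y\<^sup>2)" for y :: real
      unfolding norm_of_real by (simp add: abs_mult)
  qed measurable
  have m: "(\<lambda>y. G (Complex (S n) y) - G (Complex 0 y)) \<in> borel_measurable lborel" for n
    by (intro square_integrableD(1) square_integrable_diff strip_decay_line G S01) auto
  have "(\<lambda>n. LINT y|lborel. (cmod (G (Complex (S n) y) - G (Complex 0 y)))\<^sup>2) \<longlonglongrightarrow> (LINT y|(lborel::real measure). 0)"
  proof (rule integral_dominated_convergence[where w = "\<lambda>y. (cmod (of_real (2 * C / (1 + y\<^sup>2))))\<^sup>2"])
    show "(\<lambda>y. (cmod (G (Complex (S n) y) - G (Complex 0 y)))\<^sup>2) \<in> borel_measurable lborel" for n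
      using m[of n] by measurable
    show "integrable lborel (\<lambda>y::real. (cmod (of_real (2 * C / (1 + y\<^sup>2))))\<^sup>2)"
      using sq by (simp add: square_integrable_def)
    show "AE y in lborel. norm ((cmod (G (Complex (S n) y) - G (Complex 0 y)))\<^sup>2) \<le> (cmod (of_real (2 * C / (1 + y\<^sup>2))))\<^sup>2" for n
    proof (intro AE_I2)
      fix y :: real
      have "cmod (G (Complex (S n) y) - G (Complex 0 y)) \<le> 2 * C / (1 + y\<^sup>2)"
        using norm_triangle_ineq4[of "G (Complex (S n) y)" "G (Complex 0 y)"] C[OF S01[of n], of y] C[of 0 y] by simp
      also have "\<dots> \<le> cmod (of_real (2 * C / (1 + y\<^sup>2)))" by (metis abs_ge_self norm_of_real)
      finally show "norm ((cmod (G (Complex (S n) y) - G (Complex 0 y)))\<^sup>2) \<le> (cmod (of_real (2 * C / (1 + y\<^sup>2))))\<^sup>2"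
        by (simp add: power_mono)
    qed
    show "AE y in lborel. (\<lambda>n. (cmod (G (Complex (S n) y) - G (Complex 0 y)))\<^sup>2) \<longlonglongrightarrow> 0"
    proof (intro AE_I2)
      fix y :: real
      have "(\<lambda>n. of_real (S n) + \<i> * of_real y) \<longlonglongrightarrow> of_real 0 + \<i> * of_real y"
        by (intro tendsto_intros S(3))
      then have "(\<lambda>n. Complex (S n) y) \<longlonglongrightarrow> Complex 0 y" by (simp only: Complex_eq)
      then have "(\<lambda>n. G (Complex (S n) y)) \<longlonglongrightarrow> G (Complex 0 y)"
        using G m1 unfolding strip_decay_def
        by (intro continuous_on_tendsto_compose[of "{z. - 1 < Re z}" G]) auto
      then have "(\<lambda>n. (cmod (G (Complex (S n) y) - G (Complex 0 y)))\<^sup>2) \<longlonglongrightarrow> (cmod (G (Complex 0 y) - G (Complex 0 y)))\<^sup>2"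
        by (intro tendsto_intros)
      then show "(\<lambda>n. (cmod (G (Complex (S n) y) - G (Complex 0 y)))\<^sup>2) \<longlonglongrightarrow> 0" by simp
    qed
  qed simp
  then show "(\<lambda>n. L2sq lborel (\<lambda>y. G (Complex (S n) y) - G (Complex 0 y))) \<longlonglongrightarrow> 0"
    by (simp add: L2sq_def)
qed simp

lemma strip_decay_is_boundary_value:
  assumes G: "strip_decay G" and FG: "\<And>z. 0 < Re z \<Longrightarrow> F z = G z"
  shows "is_boundary_value F (\<lambda>y. G (Complex 0 y))"
  unfolding is_boundary_value_def
proof (intro conjI)
  show "square_integrable lborel (\<lambda>y. G (Complex 0 y))" using strip_decay_line[OF G, of 0] by simp
  show "\<forall>\<^sub>F x in at_right 0. square_integrable lborel (\<lambda>y. F (Complex x y))"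
    using eventually_at_right_real[of 0 1, OF zero_less_one]
  proof eventually_elim
    case (elim x)
    then have "x \<in> {0..1}" by simp
    from strip_decay_line[OF G this] show ?case using elim by (simp add: FG)
  qed
  show "((\<lambda>x. LINT y|lborel. (cmod (F (Complex x y) - G (Complex 0 y)))\<^sup>2) \<longlongrightarrow> 0) (at_right 0)"
  proof (rule Lim_transform_eventually[OF strip_decay_tendsto_boundary[OF G]])
    show "\<forall>\<^sub>F x in at_right 0. L2sq lborel (\<lambda>y. G (Complex x y) - G (Complex 0 y)) =
        (LINT y|lborel. (cmod (F (Complex x y) - G (Complex 0 y)))\<^sup>2)"
      using eventually_at_right_less[of 0]
      by eventually_elim (simp add: L2sq_def FG)
  qed
qed

text \<open>This makes the arbitrary choice in \<open>boundary_extension\<close> harmless: on functions with explicit boundary values it can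
be evaluated almost everywhere.\<close>

lemma boundary_value_unique:
  assumes b: "is_boundary_value F b" and c: "is_boundary_value F c"
  shows "AE y in lborel. b y = c y"
proof -
  have sb: "square_integrable lborel b" and sc: "square_integrable lborel c"
    using b c by (auto simp: is_boundary_value_def)
  have "L2sq lborel (\<lambda>y. b y - c y) \<le> 2 * 0 + 2 * 0"
  proof (rule tendsto_lowerbound)
    show "((\<lambda>x. 2 * L2sq lborel (\<lambda>y. F (Complex x y) - b y) + 2 * L2sq lborel (\<lambda>y. F (Complex x y) - c y)) \<longlongrightarrow> 2 * 0 + 2 * 0) (at_right 0)"
      using b c unfolding is_boundary_value_def L2sq_def by (intro tendsto_intros) auto
    have "\<forall>\<^sub>F x in at_right 0. square_integrable lborel (\<lambda>y. F (Complex x y))"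
      using b by (simp add: is_boundary_value_def)
    then show "\<forall>\<^sub>F x in at_right 0. L2sq lborel (\<lambda>y. b y - c y) \<le>
        2 * L2sq lborel (\<lambda>y. F (Complex x y) - b y) + 2 * L2sq lborel (\<lambda>y. F (Complex x y) - c y)"
    proof eventually_elim
      case (elim x)
      show ?case
        using L2sq_diff_triangle[OF sb elim sc] by (simp add: L2sq_commute[of lborel b])
    qed
  qed simp
  then have "L2sq lborel (\<lambda>y. b y - c y) = 0"
    using L2sq_nonneg[of lborel "\<lambda>y. b y - c y"] by linarith
  then have "(LINT y|lborel. (cmod (b y - c y))\<^sup>2) = 0" by (simp only: L2sq_def)
  moreover have "integrable lborel (\<lambda>y. (cmod (b y - c y))\<^sup>2)"
    using square_integrable_diff[OF sb sc] by (simp add: square_integrable_def)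
  ultimately have "AE y in lborel. (cmod (b y - c y))\<^sup>2 = 0"
    by (subst (asm) integral_nonneg_eq_0_iff_AE) auto
  then show ?thesis by eventually_elim simp
qed

lemma poly_mellin_line_le:
  assumes "0 \<le> x" "x \<le> 1 / 2"
  shows "L2sq lborel (\<lambda>y. poly_mellin p (Complex x y)) \<le> 2 * L2sq disc (poly p)"
proof -
  have "L2sq lborel (\<lambda>y. poly_mellin p (Complex x y)) \<le> L2sq lborel (\<lambda>y. gamma_sum p (Complex x y))"
    unfolding L2sq_def
  proof (rule integral_mono)
    show "integrable lborel (\<lambda>y. (cmod (poly_mellin p (Complex x y)))\<^sup>2)"
      using strip_decay_line[OF strip_decay_poly_mellin, of x p] assms by (simp add: square_integrable_def)
    show "integrable lborel (\<lambda>y. (cmod (gamma_sum p (Complex x y)))\<^sup>2)"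
      using gamma_sum_line(1)[OF assms(1)] by (simp add: square_integrable_def)
    fix y
    have "1 \<le> 2 powr x" using assms by (simp add: ge_one_powr_ge_zero)
    then have "cmod (gamma_sum p (Complex x y)) / 2 powr x \<le> cmod (gamma_sum p (Complex x y)) / 1"
      by (intro divide_left_mono) auto
    then show "(cmod (poly_mellin p (Complex x y)))\<^sup>2 \<le> (cmod (gamma_sum p (Complex x y)))\<^sup>2"
      by (intro power_mono) (simp_all add: poly_mellin_def norm_divide cmod_2_powr)
  qed
  also have "\<dots> \<le> 2 * pi * laguerre_energy p"
    unfolding gamma_sum_line(3)[OF assms(1)] by (intro mult_left_mono L2sq_laguerre_sum_le assms) auto
  finally show ?thesis by (simp add: L2sq_disc_poly)
qed

lemma poly_square_integrable_disc: "square_integrable disc (poly p)"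
  using poly_bergman_space by (simp add: bergman_space_iff)

locale taylor_approximation =
  fixes f :: "complex \<Rightarrow> complex" and a :: "nat \<Rightarrow> complex"
  assumes f: "f \<in> bergman_space" and a: "has_coeffs f a"
begin

abbreviation "T \<equiv> taylor_poly a"

text \<open>The additional \<open>1 / (n + 1)\<close> makes the bound strict, so that it also holds when the limit \<open>f\<close> is replaced by a
Taylor polynomial of sufficiently high degree.\<close>

definition err :: "nat \<Rightarrow> real" where
  "err n = 2 * L2sq disc (\<lambda>z. poly (T n) z - f z) + 1 / real (Suc n)"

lemma f_square_integrable: "square_integrable disc f"
  using f by (simp add: bergman_space_iff)

lemma err_tendsto: "err \<longlonglongrightarrow> 0"
  unfolding err_def[abs_def]
  using tendsto_add[OF tendsto_mult_right[OF taylor_poly_tendsto[OF f a], of 2] LIMSEQ_Suc[OF lim_1_over_n[where 'a = real]]]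
  by (simp add: mult.commute)

lemma err_pos: "0 < err n"
  by (simp add: err_def add_nonneg_pos)

lemma eventually_taylor_diff_le:
  "\<forall>\<^sub>F m in sequentially. 2 * L2sq disc (poly (T m - T n)) \<le> err n"
proof -
  have "(\<lambda>m. L2sq disc (\<lambda>z. poly (T m) z - poly (T n) z)) \<longlonglongrightarrow> L2sq disc (\<lambda>z. f z - poly (T n) z)"
  proof (rule L2sq_tendsto)
    show "(\<lambda>m. L2sq disc (\<lambda>z. poly (T m) z - poly (T n) z - (f z - poly (T n) z))) \<longlonglongrightarrow> 0"
      using taylor_poly_tendsto[OF f a] by simp
  qed (intro square_integrable_diff f_square_integrable poly_square_integrable_disc)+
  then have "(\<lambda>m. 2 * L2sq disc (poly (T m - T n))) \<longlonglongrightarrow> 2 * L2sq disc (\<lambda>z. poly (T n) z - f z)"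
    unfolding L2sq_commute[of disc f] by (intro tendsto_mult tendsto_const) (simp add: poly_diff[abs_def])
  moreover have "2 * L2sq disc (\<lambda>z. poly (T n) z - f z) < err n" by (simp add: err_def)
  ultimately have "\<forall>\<^sub>F m in sequentially. 2 * L2sq disc (poly (T m - T n)) < err n"
    by (rule order_tendstoD)
  then show ?thesis by (rule eventually_mono) simp
qed

lemma poly_mellin_tendsto:
  assumes "0 < Re z"
  shows "(\<lambda>n. poly_mellin (T n) z) \<longlonglongrightarrow> weighted_mellin f z"
proof -
  have g: "square_integrable disc (\<lambda>\<zeta>. \<zeta> powr (cnj z - 1))"
    using powr_bergman_space[of "cnj z - 1"] assms by (simp add: bergman_space_iff)
  have "(\<lambda>n. LINT \<zeta>|disc. poly (T n) \<zeta> * cnj (\<zeta> powr (cnj z - 1))) \<longlonglongrightarrow>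
      (LINT \<zeta>|disc. f \<zeta> * cnj (\<zeta> powr (cnj z - 1)))"
    by (rule L2_inner_tendsto[OF poly_square_integrable_disc f_square_integrable g g taylor_poly_tendsto[OF f a]]) (simp add: L2sq_def)
  then have "(\<lambda>n. weighted_mellin (poly (T n)) z) \<longlonglongrightarrow> weighted_mellin f z"
    unfolding weighted_mellin_def mellin_bergman_eq_inner bergman_inner_altdef
    by (intro tendsto_intros) auto
  then show ?thesis by (simp add: weighted_mellin_poly[OF assms])
qed

lemma poly_mellin_line: "x \<in> {0..1} \<Longrightarrow> square_integrable lborel (\<lambda>y. poly_mellin p (Complex x y))"
  by (rule strip_decay_line[OF strip_decay_poly_mellin])

text \<open>The bound for polynomials carries over to \<open>f\<close> by Fatou's lemma, because the transforms converge
pointwise in the open half-plane. It does not depend on \<open>x\<close>.\<close>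

lemma line_error:
  assumes x: "0 < x" "x \<le> 1 / 2"
  shows "square_integrable lborel (\<lambda>y. weighted_mellin f (Complex x y))"
    and "L2sq lborel (\<lambda>y. weighted_mellin f (Complex x y) - poly_mellin (T n) (Complex x y)) \<le> err n"
proof -
  have x01: "x \<in> {0..1}" using x by simp
  note sq = poly_mellin_line[OF x01]
  have lim: "(\<lambda>m. poly_mellin (T m) (Complex x y)) \<longlonglongrightarrow> weighted_mellin f (Complex x y)" for y
    using x by (intro poly_mellin_tendsto) simp
  have meas: "(\<lambda>y. weighted_mellin f (Complex x y)) \<in> borel_measurable lborel"
    by (rule borel_measurable_LIMSEQ_metric[OF square_integrableD(1)[OF sq] lim])
  have *: "square_integrable lborel (\<lambda>y. weighted_mellin f (Complex x y) - poly_mellin (T n) (Complex x y)) \<and>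
      L2sq lborel (\<lambda>y. weighted_mellin f (Complex x y) - poly_mellin (T n) (Complex x y)) \<le> err n" for n
  proof -
    have "\<forall>\<^sub>F m in sequentially. L2sq lborel (\<lambda>y. poly_mellin (T m) (Complex x y) - poly_mellin (T n) (Complex x y)) \<le> err n"
      using eventually_taylor_diff_le[of n]
    proof eventually_elim
      case (elim m)
      then show ?case
        using poly_mellin_line_le[of x "T m - T n"] x by (simp add: poly_mellin_diff)
    qed
    moreover have "square_integrable lborel (\<lambda>y. poly_mellin (T m) (Complex x y) - poly_mellin (T n) (Complex x y))" for m
      by (intro square_integrable_diff sq)
    moreover have "(\<lambda>y. weighted_mellin f (Complex x y) - poly_mellin (T n) (Complex x y)) \<in> borel_measurable lborel"
      by (intro borel_measurable_diff meas square_integrableD(1)[OF sq])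
    moreover have "AE y in lborel. (\<lambda>m. poly_mellin (T m) (Complex x y) - poly_mellin (T n) (Complex x y)) \<longlonglongrightarrow>
        weighted_mellin f (Complex x y) - poly_mellin (T n) (Complex x y)"
      by (intro AE_I2 tendsto_diff tendsto_const lim)
    ultimately show ?thesis
      using L2sq_Fatou[of lborel "\<lambda>m y. poly_mellin (T m) (Complex x y) - poly_mellin (T n) (Complex x y)"] by blast
  qed
  from * show "L2sq lborel (\<lambda>y. weighted_mellin f (Complex x y) - poly_mellin (T n) (Complex x y)) \<le> err n" by blast
  show "square_integrable lborel (\<lambda>y. weighted_mellin f (Complex x y))"
    using square_integrable_add[OF conjunct1[OF *[of 0]] sq[of "T 0"]] by simp
qed

text \<open>The boundary values of the Taylor polynomials form a Cauchy sequence. That their limit is the boundary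
value of the transform of \<open>f\<close> is the usual interchange of limits, which the uniformity of the bound in \<open>x\<close> permits.\<close>

lemma boundary_value_exists: "\<exists>b. is_boundary_value (weighted_mellin f) b"
proof -
  let ?P = "\<lambda>n y. poly_mellin (T n) (Complex 0 y)"
  have sqP: "square_integrable lborel (?P n)" for n by (rule poly_mellin_line) simp
  have "\<exists>b. square_integrable lborel b \<and> (\<lambda>k. L2sq lborel (\<lambda>y. ?P k y - b y)) \<longlonglongrightarrow> 0"
  proof (rule L2_complete[OF sqP])
    fix e :: real assume "0 < e"
    then obtain N where N: "\<And>n. n \<ge> N \<Longrightarrow> err n < e / 4"
      using order_tendstoD(2)[OF err_tendsto, of "e / 4"] by (auto simp: eventually_sequentially)
    have "L2sq lborel (\<lambda>y. ?P j y - ?P k y) \<le> e" if "j \<ge> N" "k \<ge> N" for j k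
    proof -
      have "L2sq disc (\<lambda>z. poly (T j) z - poly (T k) z) \<le>
          2 * L2sq disc (\<lambda>z. poly (T j) z - f z) + 2 * L2sq disc (\<lambda>z. poly (T k) z - f z)"
        using L2sq_diff_triangle[OF poly_square_integrable_disc f_square_integrable poly_square_integrable_disc, of "T j" "T k"] by (simp add: L2sq_commute[of _ f])
      also have "\<dots> \<le> err j + err k" by (simp add: err_def add_increasing2)
      finally show ?thesis
        using poly_mellin_line_le[of 0 "T j - T k"] N[OF that(1)] N[OF that(2)]
        by (simp add: poly_mellin_diff poly_diff[abs_def])
    qed
    then show "\<exists>N. \<forall>j\<ge>N. \<forall>k\<ge>N. L2sq lborel (\<lambda>y. ?P j y - ?P k y) \<le> e" by blast
  qed
  then obtain b where b: "square_integrable lborel b" "(\<lambda>k. L2sq lborel (\<lambda>y. ?P k y - b y)) \<longlonglongrightarrow> 0"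
    by blast
  have ev: "\<forall>\<^sub>F x in at_right 0. 0 < x \<and> x \<le> (1 / 2 :: real)"
    using eventually_at_right_real[of 0 "1/2"] by (auto elim!: eventually_mono)
  have "is_boundary_value (weighted_mellin f) b"
    unfolding is_boundary_value_def
  proof (intro conjI b)
    show "\<forall>\<^sub>F x in at_right 0. square_integrable lborel (\<lambda>y. weighted_mellin f (Complex x y))"
      using ev by eventually_elim (simp add: line_error)
    show "((\<lambda>x. LINT y|lborel. (cmod (weighted_mellin f (Complex x y) - b y))\<^sup>2) \<longlongrightarrow> 0) (at_right 0)"
      unfolding L2sq_def[symmetric]
    proof (rule tendstoI)
      fix e :: real assume e: "0 < e"
      have "\<forall>\<^sub>F k in sequentially. err k < e / 12 \<and> L2sq lborel (\<lambda>y. ?P k y - b y) < e / 12"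
        using e by (intro eventually_conj order_tendstoD(2)[OF err_tendsto] order_tendstoD(2)[OF b(2)]) auto
      then obtain k where k: "err k < e / 12" "L2sq lborel (\<lambda>y. ?P k y - b y) < e / 12"
        by (auto simp: eventually_sequentially)
      have "\<forall>\<^sub>F x in at_right 0. L2sq lborel (\<lambda>y. poly_mellin (T k) (Complex x y) - ?P k y) < e / 12"
        using e by (intro order_tendstoD(2)[OF strip_decay_tendsto_boundary[OF strip_decay_poly_mellin]]) auto
      with ev show "\<forall>\<^sub>F x in at_right 0. dist (L2sq lborel (\<lambda>y. weighted_mellin f (Complex x y) - b y)) 0 < e"
      proof eventually_elim
        case (elim x)
        have sx: "square_integrable lborel (\<lambda>y. poly_mellin (T k) (Complex x y))"
          using elim by (intro poly_mellin_line) auto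
        have sw: "square_integrable lborel (\<lambda>y. weighted_mellin f (Complex x y))"
          using elim by (intro line_error) auto
        have "L2sq lborel (\<lambda>y. weighted_mellin f (Complex x y) - b y) \<le>
            2 * err k + 2 * L2sq lborel (\<lambda>y. poly_mellin (T k) (Complex x y) - b y)"
          using L2sq_diff_triangle[OF sw sx b(1)] line_error(2)[of x k] elim by auto
        also have "L2sq lborel (\<lambda>y. poly_mellin (T k) (Complex x y) - b y) \<le> 2 * (e / 12) + 2 * (e / 12)"
          using L2sq_diff_triangle[OF sx sqP[of k] b(1)] k elim by linarith
        finally show ?case using k e by (simp add: field_simps)
      qed
    qed
  qed
  then show ?thesis by blast
qed

text \<open>The estimate is made for an arbitrary boundary value, since \<open>boundary_extension\<close> selects an unknown one.\<close>

lemma boundary_error: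
  assumes b: "is_boundary_value (weighted_mellin f) b"
  shows "L2sq lborel (\<lambda>y. poly_mellin (T n) (Complex 0 y) - b y) \<le> 4 * err n"
proof -
  let ?P = "\<lambda>x y. poly_mellin (T n) (Complex x y)" and ?F = "\<lambda>x y. weighted_mellin f (Complex x y)"
  have sb: "square_integrable lborel b" using b by (simp add: is_boundary_value_def)
  have s0: "square_integrable lborel (?P 0)" by (rule poly_mellin_line) simp
  have ev: "\<forall>\<^sub>F x in at_right 0. 0 < x \<and> x \<le> (1 / 2 :: real)"
    using eventually_at_right_real[of 0 "1/2"] by (auto elim!: eventually_mono)
  have "L2sq lborel (\<lambda>y. ?P 0 y - b y) \<le> 2 * 0 + 4 * err n + 4 * 0"
  proof (rule tendsto_lowerbound)
    show "((\<lambda>x. 2 * L2sq lborel (\<lambda>y. ?P x y - ?P 0 y) + 4 * err n + 4 * L2sq lborel (\<lambda>y. ?F x y - b y)) \<longlongrightarrow>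
        2 * 0 + 4 * err n + 4 * 0) (at_right 0)"
      using b unfolding is_boundary_value_def L2sq_def[symmetric]
      by (intro tendsto_intros strip_decay_tendsto_boundary strip_decay_poly_mellin) auto
    show "\<forall>\<^sub>F x in at_right 0. L2sq lborel (\<lambda>y. ?P 0 y - b y) \<le>
        2 * L2sq lborel (\<lambda>y. ?P x y - ?P 0 y) + 4 * err n + 4 * L2sq lborel (\<lambda>y. ?F x y - b y)"
      using ev
    proof eventually_elim
      case (elim x)
      have sx: "square_integrable lborel (?P x)" using elim by (intro poly_mellin_line) auto
      have sw: "square_integrable lborel (?F x)" using elim by (intro line_error) auto
      have "L2sq lborel (\<lambda>y. ?P x y - ?F x y) \<le> err n"
        using line_error(2)[of x n] elim by (simp add: L2sq_commute)
      then show ?case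
        using L2sq_diff_triangle[OF s0 sx sb] L2sq_diff_triangle[OF sx sw sb]
          L2sq_commute[of lborel "?P 0" "?P x"] by linarith
    qed
  qed simp
  then show ?thesis by simp
qed

end

section \<open>The isometry\<close>

lemma sets_vertical_product [simp]:
  "sets (vertical_product \<nu>) = sets (borel_on (closure right_half_plane))"
  by (simp add: vertical_product_def)

lemma nn_integral_vertical_product:
  assumes \<nu>: "sets \<nu> = sets (borel_on {0..})"
    and F: "F \<in> borel_measurable (borel_on (closure right_half_plane))"
  shows "(\<integral>\<^sup>+z. F z \<partial>vertical_product \<nu>) = (\<integral>\<^sup>+x. \<integral>\<^sup>+y. F (Complex x y) \<partial>lborel \<partial>\<nu>)"
proof -
  note m = measurable_Complex_borel_on[OF \<nu>]
  have "(\<integral>\<^sup>+z. F z \<partial>vertical_product \<nu>) =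
      (\<integral>\<^sup>+p. F (case p of (x, y) \<Rightarrow> Complex x y) \<partial>(\<nu> \<Otimes>\<^sub>M lborel))"
    unfolding vertical_product_def by (rule nn_integral_distr[OF m]) (simp add: F)
  also have "\<dots> = (\<integral>\<^sup>+x. \<integral>\<^sup>+y. F (Complex x y) \<partial>lborel \<partial>\<nu>)"
    by (subst lborel.nn_integral_fst[symmetric])
       (use measurable_compose[OF m F] in \<open>auto simp: case_prod_unfold\<close>)
  finally show ?thesis .
qed

lemma omega_base_eq_distr:
  "omega_base = distr (density (count_space UNIV) (\<lambda>n. ennreal (2 ^ n / fact n))) (borel_on {0..}) (\<lambda>n. real n / 2)"
proof (rule measure_eqI)
  fix A assume "A \<in> sets omega_base"
  then have A: "A \<in> sets (borel_on {0..})" by simp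
  have m: "(\<lambda>n. real n / 2) \<in> density (count_space UNIV) (\<lambda>n. ennreal (2 ^ n / fact n)) \<rightarrow>\<^sub>M borel_on {0..}"
    by simp
  have "emeasure (distr (density (count_space UNIV) (\<lambda>n. ennreal (2 ^ n / fact n))) (borel_on {0..}) (\<lambda>n. real n / 2)) A =
      (\<integral>\<^sup>+n. ennreal (2 ^ n / fact n) * indicator ((\<lambda>n. real n / 2) -` A) n \<partial>count_space UNIV)"
    by (subst emeasure_distr[OF m A]) (simp add: emeasure_density)
  also have "\<dots> = emeasure omega_base A"
    unfolding emeasure_omega_base[OF A] nn_integral_count_space_nat
    by (simp add: indicator_def)
  finally show "emeasure omega_base A = emeasure (distr (density (count_space UNIV) (\<lambda>n. ennreal (2 ^ n / fact n))) (borel_on {0..}) (\<lambda>n. real n / 2)) A" ..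
qed simp

lemma nn_integral_omega_base:
  assumes "h \<in> borel_measurable (borel_on {0..})"
  shows "(\<integral>\<^sup>+x. h x \<partial>omega_base) = (\<Sum>n. ennreal (2 ^ n / fact n) * h (real n / 2))"
  using assms unfolding omega_base_eq_distr
  by (subst nn_integral_distr) (auto simp: nn_integral_density nn_integral_count_space_nat)

lemma borel_measurable_line_nn_integral:
  assumes \<nu>: "sets \<nu> = sets (borel_on {0..})"
    and F: "F \<in> borel_measurable (borel_on (closure right_half_plane))"
  shows "(\<lambda>x. \<integral>\<^sup>+y. F (Complex x y) \<partial>lborel) \<in> borel_measurable \<nu>"
proof -
  have "(\<lambda>(x, y). F (Complex x y)) \<in> borel_measurable (\<nu> \<Otimes>\<^sub>M lborel)"
    using measurable_compose[OF measurable_Complex_borel_on[OF \<nu>] F] by (simp add: case_prod_unfold)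
  then show ?thesis by (rule lborel.borel_measurable_nn_integral)
qed

lemma nn_integral_omega:
  assumes F: "F \<in> borel_measurable (borel_on (closure right_half_plane))"
  shows "(\<integral>\<^sup>+z. F z \<partial>omega) = (\<Sum>n. ennreal (2 ^ n / fact n) * (\<integral>\<^sup>+y. F (Complex (real n / 2) y) \<partial>lborel))"
  unfolding omega_def
  by (subst nn_integral_vertical_product[OF sets_omega_base F])
     (intro nn_integral_omega_base borel_measurable_line_nn_integral F refl)

lemma continuous_borel_measurable_closure:
  assumes "continuous_on {z. - 1 < Re z} G"
  shows "G \<in> borel_measurable (borel_on (closure right_half_plane))"
  unfolding borel_on_def closure_right_half_plane
  by (intro borel_measurable_continuous_on_restrict continuous_on_subset[OF assms]) auto

text \<open>On the line \<open>Re z = n / 2\<close> the factor \<open>1 / 2 powr z\<close> contributes \<open>2 ^ (- n)\<close>, which cancels the power of \<open>2\<close>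
in the mass \<open>2 ^ n / n!\<close>.\<close>

lemma poly_mellin_omega:
  "square_integrable omega (poly_mellin p)"
  "L2sq omega (poly_mellin p) = 2 * L2sq disc (poly p)"
proof -
  have m: "poly_mellin p \<in> borel_measurable (borel_on (closure right_half_plane))"
    using strip_decay_poly_mellin by (intro continuous_borel_measurable_closure) (auto simp: strip_decay_def)
  have line: "ennreal (2 ^ n / fact n) * (\<integral>\<^sup>+y. ennreal ((cmod (poly_mellin p (Complex (real n / 2) y)))\<^sup>2) \<partial>lborel) =
      ennreal (1 / fact n) * ennreal (L2sq lborel (\<lambda>y. gamma_sum p (Complex (real n / 2) y)))" for n
  proof -
    have "(2 powr (real n / 2))\<^sup>2 = (2 ^ n :: real)"
      by (simp add: power2_eq_square powr_realpow flip: powr_add)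
    then have "(cmod (poly_mellin p (Complex (real n / 2) y)))\<^sup>2 =
        (1 / 2 ^ n) * (cmod (gamma_sum p (Complex (real n / 2) y)))\<^sup>2" for y
      by (simp add: poly_mellin_def norm_divide cmod_2_powr power_divide)
    then have "(\<integral>\<^sup>+y. ennreal ((cmod (poly_mellin p (Complex (real n / 2) y)))\<^sup>2) \<partial>lborel) =
        (\<integral>\<^sup>+y. ennreal (1 / 2 ^ n) * ennreal ((cmod (gamma_sum p (Complex (real n / 2) y)))\<^sup>2) \<partial>lborel)"
      by (simp flip: ennreal_mult)
    also have "\<dots> = ennreal (1 / 2 ^ n) * ennreal (L2sq lborel (\<lambda>y. gamma_sum p (Complex (real n / 2) y)))"
    proof -
      have sq: "square_integrable lborel (\<lambda>y. gamma_sum p (Complex (real n / 2) y))"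
        by (rule gamma_sum_line) simp
      note [measurable] = square_integrableD(1)[OF sq]
      show ?thesis by (subst nn_integral_cmult) (simp_all add: nn_L2sq[OF sq])
    qed
    finally show ?thesis
      by (simp add: mult.assoc[symmetric] flip: ennreal_mult)
  qed
  have "(\<integral>\<^sup>+z. ennreal ((cmod (poly_mellin p z))\<^sup>2) \<partial>omega) = ennreal (2 * pi * laguerre_energy p)"
    using m by (subst nn_integral_omega) (simp_all add: line suminf_gamma_sum_lines)
  then have nn: "(\<integral>\<^sup>+z. ennreal ((cmod (poly_mellin p z))\<^sup>2) \<partial>omega) = ennreal (2 * L2sq disc (poly p))"
    by (simp only: L2sq_disc_poly mult.assoc)
  have "poly_mellin p \<in> borel_measurable omega" 
    using m by (simp add: omega_def measurable_cong_sets[OF sets_vertical_product refl])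
  with nn show sq: "square_integrable omega (poly_mellin p)"
    by (intro square_integrable_nn(1)[where c = "2 * L2sq disc (poly p)"]) auto
  show "L2sq omega (poly_mellin p) = 2 * L2sq disc (poly p)"
    using nn unfolding nn_L2sq[OF sq] by simp
qed

lemma poly_mellin_inner_omega:
  "(LINT z|omega. poly_mellin p z * cnj (poly_mellin q z)) = 2 * (LINT z|disc. poly p z * cnj (poly q z))"
proof -
  have add: "L2sq omega (\<lambda>z. poly_mellin p z + c * poly_mellin q z) = 2 * L2sq disc (\<lambda>z. poly p z + c * poly q z)" for c
    using poly_mellin_omega(2)[of "p + smult c q"] by (simp add: poly_mellin_add[abs_def] poly_mellin_smult poly_add[abs_def] L2sq_def)
  show ?thesis
    unfolding L2_polarization[OF poly_mellin_omega(1) poly_mellin_omega(1)] L2_polarization[OF poly_square_integrable_disc poly_square_integrable_disc]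
    using add[of 1] add[of "- 1"] add[of \<i>] add[of "- \<i>"] by (simp add: field_simps)
qed

context taylor_approximation
begin

definition bval :: "real \<Rightarrow> complex" where
  "bval = (SOME b. is_boundary_value (weighted_mellin f) b)"

abbreviation "ext \<equiv> boundary_extension (weighted_mellin f)"

lemma bval: "is_boundary_value (weighted_mellin f) bval"
  unfolding bval_def by (rule someI_ex[OF boundary_value_exists])

lemma ext_eq: "ext z = (if 0 < Re z then weighted_mellin f z else bval (Im z))"
  by (simp add: boundary_extension_def bval_def)

lemma sets_omega: "sets omega = sets (borel_on (closure right_half_plane))"
  by (simp add: omega_def)

lemma Re_Im_measurable_omega [measurable]: "Re \<in> borel_measurable omega" "Im \<in> borel_measurable omega"
  unfolding measurable_cong_sets[OF sets_omega refl] borel_on_def by (intro measurable_restrict_space1; simp)+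

lemma ext_measurable: "ext \<in> borel_measurable omega"
proof (rule borel_measurable_LIMSEQ_metric)
  have [measurable]: "poly_mellin p \<in> borel_measurable omega" for p
    by (rule square_integrableD(1)[OF poly_mellin_omega(1)])
  have "bval \<in> borel_measurable borel" using bval by (simp add: is_boundary_value_def square_integrable_def)
  then have [measurable]: "(\<lambda>z. bval (Im z)) \<in> borel_measurable omega"
    by (rule measurable_compose[OF Re_Im_measurable_omega(2)])
  show "(\<lambda>z. if 0 < Re z then poly_mellin (T n) z else bval (Im z)) \<in> borel_measurable omega" for n
    by measurable
  show "(\<lambda>n. if 0 < Re z then poly_mellin (T n) z else bval (Im z)) \<longlonglongrightarrow> ext z" for z
    by (auto simp: ext_eq poly_mellin_tendsto)
qed

text \<open>In the open half-plane the transforms of the Taylor polynomials converge pointwise and Fatou's lemma applies;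
on the imaginary axis, which carries the atom at \<open>0\<close>, only the convergence in norm from
\<open>boundary_error\<close> is available. The difference is therefore split into these two parts.\<close>

lemma ext_error:
  "square_integrable omega ext"
  "L2sq omega (\<lambda>z. poly_mellin (T n) z - ext z) \<le> 10 * err n"
proof -
  have pm[measurable]: "poly_mellin p \<in> borel_measurable omega" for p
    by (rule square_integrableD(1)[OF poly_mellin_omega(1)])
  note [measurable] = ext_measurable
  have *: "square_integrable omega (\<lambda>z. ext z - poly_mellin (T n) z) \<and>
      L2sq omega (\<lambda>z. ext z - poly_mellin (T n) z) \<le> 10 * err n" for n
  proof -
    let ?d = "\<lambda>z. ext z - poly_mellin (T n) z"
    let ?H = "\<lambda>z. if 0 < Re z then ?d z else 0" and ?V = "\<lambda>z. if 0 < Re z then 0 else ?d z"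
    let ?F = "\<lambda>m z. if 0 < Re z then poly_mellin (T m) z - poly_mellin (T n) z else 0"
    have F: "square_integrable omega (?F m) \<and> L2sq omega (?F m) \<le> 2 * L2sq disc (poly (T m - T n))" for m
    proof -
      have "(\<integral>\<^sup>+z. ennreal ((cmod (?F m z))\<^sup>2) \<partial>omega) \<le> (\<integral>\<^sup>+z. ennreal ((cmod (poly_mellin (T m - T n) z))\<^sup>2) \<partial>omega)"
        by (intro nn_integral_mono) (simp add: poly_mellin_diff)
      also have "\<dots> = ennreal (2 * L2sq disc (poly (T m - T n)))"
        by (simp only: nn_L2sq[OF poly_mellin_omega(1)] poly_mellin_omega(2))
      finally show ?thesis by (intro conjI square_integrable_nn) auto
    qed
    have H: "square_integrable omega ?H" "L2sq omega ?H \<le> err n"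
    proof -
      have lim: "AE z in omega. (\<lambda>m. ?F m z) \<longlonglongrightarrow> ?H z"
        by (intro AE_I2) (auto simp: ext_eq intro!: tendsto_diff poly_mellin_tendsto)
      have ev: "\<forall>\<^sub>F m in sequentially. L2sq omega (?F m) \<le> err n"
        using eventually_taylor_diff_le[of n] by (rule eventually_mono) (use F order_trans in blast)
      have m: "?H \<in> borel_measurable omega" by measurable
      show "square_integrable omega ?H" "L2sq omega ?H \<le> err n"
        using L2sq_Fatou[OF conjunct1[OF F] m lim ev] by auto
    qed
    have V: "square_integrable omega ?V" "L2sq omega ?V \<le> 4 * err n"
    proof -
      let ?b = "\<lambda>y. poly_mellin (T n) (Complex 0 y) - bval y"
      have m: "?V \<in> borel_measurable omega" by measurable
      have sb: "square_integrable lborel ?b"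
        using bval by (intro square_integrable_diff poly_mellin_line) (auto simp: is_boundary_value_def)
      have "(\<lambda>z. ennreal ((cmod (?V z))\<^sup>2)) \<in> borel_measurable omega" by measurable
      then have "(\<integral>\<^sup>+z. ennreal ((cmod (?V z))\<^sup>2) \<partial>omega) =
          (\<Sum>j. ennreal (2 ^ j / fact j) * (\<integral>\<^sup>+y. ennreal ((cmod (?V (Complex (real j / 2) y)))\<^sup>2) \<partial>lborel))"
        by (intro nn_integral_omega) (simp add: measurable_cong_sets[OF sets_omega refl])
      also have "\<dots> = (\<Sum>j\<in>{0}. ennreal (2 ^ j / fact j) * (\<integral>\<^sup>+y. ennreal ((cmod (?V (Complex (real j / 2) y)))\<^sup>2) \<partial>lborel))"
        by (rule suminf_finite) auto
      also have "\<dots> = (\<integral>\<^sup>+y. ennreal ((cmod (?b y))\<^sup>2) \<partial>lborel)"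
        by (simp add: ext_eq norm_minus_commute)
      also have "\<dots> = ennreal (L2sq lborel ?b)" by (rule nn_L2sq[OF sb])
      also have "\<dots> \<le> ennreal (4 * err n)" by (intro ennreal_leI boundary_error bval)
      finally show "square_integrable omega ?V" "L2sq omega ?V \<le> 4 * err n"
        using square_integrable_nn[OF m, of "4 * err n"] err_pos[of n] by auto
    qed
    have eq: "?d = (\<lambda>z. ?H z + ?V z)" by auto
    have "square_integrable omega ?d" unfolding eq by (rule square_integrable_add[OF H(1) V(1)])
    moreover have "L2sq omega ?d \<le> 2 * L2sq omega ?H + 2 * L2sq omega ?V"
      unfolding eq by (rule L2sq_triangle[OF H(1) V(1)])
    ultimately show ?thesis using H(2) V(2) by auto
  qed
  show "square_integrable omega ext"
    using square_integrable_add[OF conjunct1[OF *[of 0]] poly_mellin_omega(1)[of "T 0"]] by simp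
  show "L2sq omega (\<lambda>z. poly_mellin (T n) z - ext z) \<le> 10 * err n"
    using * by (simp add: L2sq_commute)
qed

lemma ext_tendsto: "(\<lambda>n. L2sq omega (\<lambda>z. poly_mellin (T n) z - ext z)) \<longlonglongrightarrow> 0"
proof -
  have "(\<lambda>n. 10 * err n) \<longlonglongrightarrow> 0" using tendsto_mult_left[OF err_tendsto, of 10] by simp
  then show ?thesis
    by (rule Lim_null_comparison[rotated]) (simp add: ext_error)
qed

end

lemma bergman_isometric_omega: "bergman_isometric omega"
  unfolding bergman_isometric_def
proof (intro ballI)
  fix f g assume f: "f \<in> bergman_space" and g: "g \<in> bergman_space"
  obtain a c where a: "has_coeffs f a" and c: "has_coeffs g c"
    using bergman_space_has_coeffs f g by meson
  interpret F: taylor_approximation f a by unfold_locales (rule f a)+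
  interpret G: taylor_approximation g c by unfold_locales (rule g c)+
  have "(\<lambda>n. LINT z|omega. poly_mellin (F.T n) z * cnj (poly_mellin (G.T n) z)) \<longlonglongrightarrow> (LINT z|omega. F.ext z * cnj (G.ext z))"
    by (rule L2_inner_tendsto[OF poly_mellin_omega(1) F.ext_error(1) poly_mellin_omega(1) G.ext_error(1) F.ext_tendsto G.ext_tendsto])
  moreover have "(\<lambda>n. 2 * (LINT z|disc. poly (F.T n) z * cnj (poly (G.T n) z))) \<longlonglongrightarrow> 2 * (LINT z|disc. f z * cnj (g z))"
    by (intro tendsto_mult tendsto_const
        L2_inner_tendsto[OF poly_square_integrable_disc F.f_square_integrable poly_square_integrable_disc
          G.f_square_integrable taylor_poly_tendsto[OF f a] taylor_poly_tendsto[OF g c]])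
  ultimately have "(LINT z|omega. F.ext z * cnj (G.ext z)) = 2 * (LINT z|disc. f z * cnj (g z))"
    unfolding poly_mellin_inner_omega by (rule LIMSEQ_unique)
  then have "bergman_inner f g = L2_inner omega F.ext G.ext"
    by (simp add: L2_inner_def bergman_inner_altdef)
  then show "square_integrable omega F.ext \<and> square_integrable omega G.ext \<and>
      bergman_inner f g = L2_inner omega F.ext G.ext"
    using F.ext_error(1) G.ext_error(1) by blast
qed

section \<open>Uniqueness of the measure\<close>

text \<open>On a bounded interval the characteristic function is the sum of its moment series.\<close>

lemma real_distribution_eq_moments:
  assumes M: "real_distribution M" "real_distribution N"
    and supp: "AE v in M. v \<in> {0..1}" "AE v in N. v \<in> {0..1}"
    and moments: "\<And>k. (\<integral>\<^sup>+v. ennreal (v ^ k) \<partial>M) = (\<integral>\<^sup>+v. ennreal (v ^ k) \<partial>N)"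
  shows "M = N"
proof (rule Levy_uniqueness[OF M])
  have char: "char M t = (\<Sum>k. (\<i> * of_real t) ^ k / fact k * of_real (enn2real (\<integral>\<^sup>+v. ennreal (v ^ k) \<partial>M)))"
    if M: "real_distribution M" and supp: "AE v in M. v \<in> {0..1}" for M t
  proof -
    interpret real_distribution M by (rule M)
    let ?h = "\<lambda>k v. (\<i> * of_real t) ^ k / fact k * complex_of_real (v ^ k)"
    have m: "(\<lambda>v. v ^ k) \<in> borel_measurable M" for k by simp
    have i: "integrable M (\<lambda>v. v ^ k)" for k
    proof (rule integrable_const_bound[where B = 1])
      show "AE v in M. norm (v ^ k) \<le> 1"
        using supp by eventually_elim (auto simp: power_le_one)
    qed (rule m)
    have int: "(LINT v|M. v ^ k) = enn2real (\<integral>\<^sup>+v. ennreal (v ^ k) \<partial>M)" for k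
    proof (rule integral_eq_nn_integral[OF m])
      show "AE v in M. 0 \<le> v ^ k" using supp by eventually_elim auto
    qed
    have hi: "integrable M (?h k)" for k
      by (intro integrable_mult_right integrable_of_real i)
    have sm: "summable (\<lambda>k. \<bar>t\<bar> ^ k / fact k)"
      using summable_exp[of "\<bar>t\<bar>"] by (simp add: divide_inverse mult.commute)
    have n: "norm (?h k v) \<le> \<bar>t\<bar> ^ k / fact k" if "v \<in> {0..1}" for k v
    proof -
      have "norm (?h k v) = (\<bar>t\<bar> ^ k * v ^ k) / fact k"
        using that by (simp add: norm_mult norm_divide norm_power)
      also have "\<dots> \<le> \<bar>t\<bar> ^ k / fact k"
        using that by (intro divide_right_mono mult_left_le power_le_one) auto
      finally show ?thesis .
    qed
    have "char M t = (LINT v|M. (\<Sum>k. ?h k v))"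
      unfolding char_def
    proof (rule Bochner_Integration.integral_cong[OF refl])
      fix v
      have "(\<lambda>k. (\<i> * of_real (t * v)) ^ k /\<^sub>R fact k) sums iexp (t * v)"
        using exp_converges[of "\<i> * of_real (t * v)"] by simp
      moreover have "(\<i> * of_real (t * v)) ^ k /\<^sub>R fact k = ?h k v" for k
        by (simp add: power_mult_distrib scaleR_conv_of_real field_simps)
      ultimately show "iexp (t * v) = (\<Sum>k. ?h k v)" by (simp add: sums_iff)
    qed
    also have "\<dots> = (\<Sum>k. LINT v|M. ?h k v)"
    proof (rule integral_suminf[OF hi])
      show "AE v in M. summable (\<lambda>k. norm (?h k v))"
        using supp
      proof eventually_elim
        case (elim v)
        show ?case by (rule summable_comparison_test'[OF sm, of 0]) (use n[OF elim] in simp)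
      qed
      show "summable (\<lambda>k. LINT v|M. norm (?h k v))"
      proof (rule summable_comparison_test'[OF sm, of 0])
        fix k
        have "(LINT v|M. norm (?h k v)) \<le> (LINT v|M. \<bar>t\<bar> ^ k / fact k)"
        proof (rule integral_mono_AE)
          show "AE v in M. norm (?h k v) \<le> \<bar>t\<bar> ^ k / fact k"
            using supp by eventually_elim (rule n)
        qed (rule integrable_norm[OF hi], simp)
        then show "norm (LINT v|M. norm (?h k v)) \<le> \<bar>t\<bar> ^ k / fact k"
          using prob_space by simp
      qed
    qed
    also have "\<dots> = (\<Sum>k. (\<i> * of_real t) ^ k / fact k * of_real (enn2real (\<integral>\<^sup>+v. ennreal (v ^ k) \<partial>M)))"
      by (simp only: integral_mult_right_zero integral_complex_of_real int)
    finally show ?thesis .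
  qed
  show "char M = char N"
    by (rule ext) (simp only: char[OF assms(1) supp(1)] char[OF assms(2) supp(2)] moments)
qed

text \<open>The squared norm of \<open>Gamma (z + 1) / 2 powr z\<close> on the line \<open>Re z = x\<close>. It has to be positive and finite for
the base measure to be recovered from its product with this weight.\<close>

definition line_weight :: "real \<Rightarrow> ennreal" where
  "line_weight x = (\<integral>\<^sup>+y. ennreal ((cmod (poly_mellin 1 (Complex x y)))\<^sup>2) \<partial>lborel)"

lemma poly_mellin_1_nonzero:
  assumes "0 \<le> Re z"
  shows "poly_mellin 1 z \<noteq> 0"
proof -
  have "z + 1 \<notin> \<int>\<^sub>\<le>\<^sub>0" using assms by (auto elim!: nonpos_Ints_cases simp: complex_eq_iff)
  then show ?thesis by (simp add: poly_mellin_def gamma_sum_def Gamma_eq_zero_iff add.commute)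
qed

lemma line_weight_pos_finite:
  assumes x: "0 \<le> x"
  shows "0 < line_weight x" "line_weight x < \<infinity>"
proof -
  have cont: "continuous_on {z. - 1 < Re z} (poly_mellin 1)"
    using strip_decay_poly_mellin[of 1] by (simp add: strip_decay_def)
  note [measurable] = borel_measurable_on_line[OF cont x]
  have "line_weight x \<noteq> 0"
  proof
    assume "line_weight x = 0"
    then have "AE y in lborel. ennreal ((cmod (poly_mellin 1 (Complex x y)))\<^sup>2) = 0"
      unfolding line_weight_def by (subst (asm) nn_integral_0_iff_AE) measurable
    then have "AE y in (lborel::real measure). False"
      by eventually_elim (use poly_mellin_1_nonzero[of "Complex x _"] x in simp)
    then obtain N where "UNIV \<subseteq> N" "emeasure lborel N = 0" "N \<in> sets (lborel :: real measure)"
      by (auto elim!: AE_E)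
    then have "emeasure lborel (UNIV :: real set) = 0" by (simp add: top.extremum_unique)
    then show False by simp
  qed
  then show "0 < line_weight x" by (simp add: zero_less_iff_neq_zero)
  have "line_weight x \<le> (\<integral>\<^sup>+y. ennreal ((cmod (gamma_sum 1 (Complex x y)))\<^sup>2) \<partial>lborel)"
    unfolding line_weight_def
  proof (intro nn_integral_mono ennreal_leI power_mono)
    fix y
    have "1 \<le> 2 powr x" using x by (simp add: ge_one_powr_ge_zero)
    then have "cmod (gamma_sum 1 (Complex x y)) / 2 powr x \<le> cmod (gamma_sum 1 (Complex x y)) / 1"
      by (intro divide_left_mono) auto
    then show "cmod (poly_mellin 1 (Complex x y)) \<le> cmod (gamma_sum 1 (Complex x y))"
      by (simp add: poly_mellin_def norm_divide cmod_2_powr)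
  qed simp
  also have "\<dots> < \<infinity>" by (simp add: nn_L2sq[OF gamma_sum_line(1)[OF x]])
  finally show "line_weight x < \<infinity>" .
qed

lemma line_weight_measurable:
  assumes "sets \<nu> = sets (borel_on {0..})"
  shows "line_weight \<in> borel_measurable \<nu>"
proof -
  have cont: "continuous_on {z. - 1 < Re z} (poly_mellin 1)"
    using strip_decay_poly_mellin[of 1] by (simp add: strip_decay_def)
  have "(\<lambda>z. ennreal ((cmod (poly_mellin 1 z))\<^sup>2)) \<in> borel_measurable (borel_on (closure right_half_plane))"
    using continuous_borel_measurable_closure[OF cont] by measurable
  from borel_measurable_line_nn_integral[OF assms this] show ?thesis
    by (simp add: line_weight_def[abs_def])
qed

text \<open>On the line \<open>Re z = x\<close> the kernel at \<open>\<eta> = 2 ^ (- k)\<close> contributes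
\<open>(\<eta> powr (x - 1))\<^sup>2 = 4 ^ k * (4 powr (- x)) ^ k\<close>.\<close>

lemma isometric_kernel_moments:
  assumes \<nu>: "sets \<nu> = sets (borel_on {0..})" and iso: "bergman_isometric (vertical_product \<nu>)"
  shows "(\<integral>\<^sup>+x. ennreal ((4 powr - x) ^ k) * line_weight x \<partial>\<nu>) =
    ennreal (2 * pi * Re (bergman_inner (disc_kernel ((1 / 2) ^ k)) (disc_kernel ((1 / 2) ^ k))) / 4 ^ k)"
proof -
  define \<eta> :: real where "\<eta> = (1 / 2) ^ k"
  have "\<eta> \<le> 1" unfolding \<eta>_def by (intro power_le_one) auto
  then have \<eta>: "0 < \<eta>" "\<eta> < 2" by (auto simp: \<eta>_def)
  let ?K = "disc_kernel \<eta>" and ?\<mu> = "vertical_product \<nu>"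
  let ?E = "boundary_extension (weighted_mellin ?K)"
  note K = disc_kernel_bergman_space[OF \<eta>]
  have sq: "square_integrable ?\<mu> ?E" and inner: "bergman_inner ?K ?K = L2_inner ?\<mu> ?E ?E"
    using iso K unfolding bergman_isometric_def by auto
  have "L2_inner ?\<mu> ?E ?E = of_real (L2sq ?\<mu> ?E / (2 * pi))"
    by (simp add: L2_inner_def L2sq_def complex_norm_square[symmetric] flip: of_real_power)
  then have L: "L2sq ?\<mu> ?E = 2 * pi * Re (bergman_inner ?K ?K)"
    unfolding inner by simp
  have Emeas: "?E \<in> borel_measurable (borel_on (closure right_half_plane))"
    using square_integrableD(1)[OF sq] by (simp add: measurable_cong_sets[OF sets_vertical_product refl])
  have line: "(\<integral>\<^sup>+y. ennreal ((cmod (?E (Complex x y)))\<^sup>2) \<partial>lborel) =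
      ennreal (4 ^ k) * (ennreal ((4 powr - x) ^ k) * line_weight x)" if x: "0 \<le> x" for x
  proof -
    have "AE y in lborel. ?E (Complex x y) = kernel_mellin \<eta> (Complex x y)"
    proof (cases "0 < x")
      case True
      then show ?thesis by (simp add: boundary_extension_def weighted_mellin_disc_kernel[OF \<eta>])
    next
      case False
      then have x0: "x = 0" using x by simp
      have b: "is_boundary_value (weighted_mellin ?K) (\<lambda>y. kernel_mellin \<eta> (Complex 0 y))"
        by (rule strip_decay_is_boundary_value[OF strip_decay_kernel_mellin[OF \<eta>(1)] weighted_mellin_disc_kernel[OF \<eta>]])
      have "AE y in lborel. (SOME b. is_boundary_value (weighted_mellin ?K) b) y = kernel_mellin \<eta> (Complex 0 y)"
        by (rule boundary_value_unique[OF someI[of "is_boundary_value (weighted_mellin ?K)", OF b] b])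
      then show ?thesis by (simp add: x0 boundary_extension_def)
    qed
    then have "(\<integral>\<^sup>+y. ennreal ((cmod (?E (Complex x y)))\<^sup>2) \<partial>lborel) =
        (\<integral>\<^sup>+y. ennreal ((cmod (kernel_mellin \<eta> (Complex x y)))\<^sup>2) \<partial>lborel)"
      by (intro nn_integral_cong_AE) (auto elim!: eventually_mono)
    also have "\<dots> = (\<integral>\<^sup>+y. ennreal (4 ^ k * (4 powr - x) ^ k) * ennreal ((cmod (poly_mellin 1 (Complex x y)))\<^sup>2) \<partial>lborel)"
    proof (rule nn_integral_cong)
      fix y
      have \<eta>2: "\<eta> = 2 powr - real k"
        by (simp add: \<eta>_def powr_minus powr_realpow power_one_over inverse_eq_divide)
      have "(\<eta> powr (x - 1))\<^sup>2 = 4 ^ k * (4 powr - x) ^ k"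
      proof -
        have "(\<eta> powr (x - 1))\<^sup>2 = 2 powr (2 * real k - 2 * real k * x)"
          unfolding \<eta>2 power2_eq_square by (simp add: powr_powr algebra_simps flip: powr_add)
        moreover have "(4::real) = 2 powr 2" by simp
        then have "(4 powr - x) ^ k = 2 powr (- (2 * real k * x))" "(4::real) ^ k = 2 powr (2 * real k)"
          by (simp_all only: powr_powr powr_power) (simp_all add: mult_ac)
        ultimately show ?thesis by (simp flip: powr_add)
      qed
      then have "(cmod (kernel_mellin \<eta> (Complex x y)))\<^sup>2 = 4 ^ k * (4 powr - x) ^ k * (cmod (poly_mellin 1 (Complex x y)))\<^sup>2"
        using \<eta>(1) by (simp add: kernel_mellin_eq norm_mult power_mult_distrib norm_powr_real_powr mult_ac)
      then show "ennreal ((cmod (kernel_mellin \<eta> (Complex x y)))\<^sup>2) =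
          ennreal (4 ^ k * (4 powr - x) ^ k) * ennreal ((cmod (poly_mellin 1 (Complex x y)))\<^sup>2)"
        by (simp flip: ennreal_mult)
    qed
    also have "\<dots> = ennreal (4 ^ k * (4 powr - x) ^ k) * line_weight x"
    proof -
      have "continuous_on {z. - 1 < Re z} (poly_mellin 1)"
        using strip_decay_poly_mellin[of 1] by (simp add: strip_decay_def)
      note [measurable] = borel_measurable_on_line[OF this x]
      show ?thesis unfolding line_weight_def by (rule nn_integral_cmult) measurable
    qed
    finally show ?thesis by (simp add: ennreal_mult mult.assoc)
  qed
  have sp: "space \<nu> = {0..}" using sets_eq_imp_space_eq[OF \<nu>] by simp
  have Vm: "(\<lambda>x. ennreal ((4 powr - x) ^ k)) \<in> borel_measurable \<nu>"
    unfolding measurable_cong_sets[OF \<nu> refl] borel_on_def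
    by (rule measurable_restrict_space1) measurable
  note [measurable] = Vm line_weight_measurable[OF \<nu>]
  have "ennreal (L2sq ?\<mu> ?E) = (\<integral>\<^sup>+x. \<integral>\<^sup>+y. ennreal ((cmod (?E (Complex x y)))\<^sup>2) \<partial>lborel \<partial>\<nu>)"
    unfolding nn_L2sq[OF sq, symmetric]
    using Emeas by (intro nn_integral_vertical_product[OF \<nu>]) measurable
  also have "\<dots> = (\<integral>\<^sup>+x. ennreal (4 ^ k) * (ennreal ((4 powr - x) ^ k) * line_weight x) \<partial>\<nu>)"
    by (intro nn_integral_cong line) (simp add: sp)
  also have "\<dots> = ennreal (4 ^ k) * (\<integral>\<^sup>+x. ennreal ((4 powr - x) ^ k) * line_weight x \<partial>\<nu>)"
    by (rule nn_integral_cmult) measurable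
  finally have eq: "ennreal (4 ^ k) * (\<integral>\<^sup>+x. ennreal ((4 powr - x) ^ k) * line_weight x \<partial>\<nu>) = ennreal (L2sq ?\<mu> ?E)" ..
  have "(\<integral>\<^sup>+x. ennreal ((4 powr - x) ^ k) * line_weight x \<partial>\<nu>) =
      ennreal (1 / 4 ^ k) * (ennreal (4 ^ k) * (\<integral>\<^sup>+x. ennreal ((4 powr - x) ^ k) * line_weight x \<partial>\<nu>))"
    by (simp add: mult.assoc[symmetric] flip: ennreal_mult)
  also have "\<dots> = ennreal (L2sq ?\<mu> ?E / 4 ^ k)"
    unfolding eq by (simp add: mult.commute flip: ennreal_mult)
  finally show ?thesis unfolding L unfolding \<eta>_def .
qed

lemma bergman_inner_disc_kernel_1: "bergman_inner (disc_kernel 1) (disc_kernel 1) = 1"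
proof -
  have eq: "disc_kernel 1 = poly 1" by (simp add: disc_kernel_def fun_eq_iff)
  have "bergman_inner (poly 1) (poly 1) = of_real (laguerre_energy 1)" by (rule bergman_inner_poly_self)
  then show ?thesis unfolding eq laguerre_energy(2) by simp
qed

text \<open>The factor \<open>1 / (2 * pi)\<close> makes the total mass \<open>1\<close> if \<open>\<nu>\<close> gives rise to an isometry: the mass is then the norm of the constant function \<open>1\<close>, the kernel at \<open>\<eta> = 1\<close>.\<close>

definition line_distribution :: "real measure \<Rightarrow> real measure" where
  "line_distribution \<nu> =
    distr (density \<nu> (\<lambda>x. ennreal (1 / (2 * pi)) * line_weight x)) borel (\<lambda>x. 4 powr - x)"

lemma powr_measurable_half_line:
  assumes "sets \<nu> = sets (borel_on {0..})"
  shows "(\<lambda>x. (4::real) powr - x) \<in> borel_measurable \<nu>"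
  unfolding measurable_cong_sets[OF assms refl] borel_on_def
  by (rule measurable_restrict_space1) measurable

lemma nn_integral_line_distribution:
  assumes \<nu>: "sets \<nu> = sets (borel_on {0..})" and [measurable]: "h \<in> borel_measurable borel"
  shows "(\<integral>\<^sup>+v. h v \<partial>line_distribution \<nu>) =
    (\<integral>\<^sup>+x. ennreal (1 / (2 * pi)) * line_weight x * h (4 powr - x) \<partial>\<nu>)"
proof -
  note [measurable] = line_weight_measurable[OF \<nu>] powr_measurable_half_line[OF \<nu>]
  show ?thesis
    unfolding line_distribution_def
    by (subst nn_integral_distr) (simp_all add: nn_integral_density)
qed

lemma line_distribution_moments:
  assumes \<nu>: "sets \<nu> = sets (borel_on {0..})" and iso: "bergman_isometric (vertical_product \<nu>)"
  shows "(\<integral>\<^sup>+v. ennreal (v ^ k) \<partial>line_distribution \<nu>) = ennreal (1 / (2 * pi)) *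
    ennreal (2 * pi * Re (bergman_inner (disc_kernel ((1 / 2) ^ k)) (disc_kernel ((1 / 2) ^ k))) / 4 ^ k)"
proof -
  note [measurable] = line_weight_measurable[OF \<nu>] powr_measurable_half_line[OF \<nu>]
  have "(\<integral>\<^sup>+v. ennreal (v ^ k) \<partial>line_distribution \<nu>) =
      (\<integral>\<^sup>+x. ennreal (1 / (2 * pi)) * (ennreal ((4 powr - x) ^ k) * line_weight x) \<partial>\<nu>)"
    by (subst nn_integral_line_distribution[OF \<nu>]) (auto simp: mult_ac)
  also have "\<dots> = ennreal (1 / (2 * pi)) * (\<integral>\<^sup>+x. ennreal ((4 powr - x) ^ k) * line_weight x \<partial>\<nu>)"
    by (rule nn_integral_cmult) measurable
  finally show ?thesis unfolding isometric_kernel_moments[OF \<nu> iso] .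
qed

lemma real_distribution_line_distribution:
  assumes \<nu>: "sets \<nu> = sets (borel_on {0..})" and iso: "bergman_isometric (vertical_product \<nu>)"
  shows "real_distribution (line_distribution \<nu>)"
proof -
  have "emeasure (line_distribution \<nu>) (space (line_distribution \<nu>)) = (\<integral>\<^sup>+v. ennreal (v ^ 0) \<partial>line_distribution \<nu>)"
    by simp
  also have "\<dots> = 1"
    unfolding line_distribution_moments[OF \<nu> iso] by (simp add: bergman_inner_disc_kernel_1 flip: ennreal_mult)
  finally have "prob_space (line_distribution \<nu>)" by (rule prob_spaceI)
  then show ?thesis
    by (simp add: real_distribution_def real_distribution_axioms_def line_distribution_def)
qed

lemma line_distribution_support:
  assumes \<nu>: "sets \<nu> = sets (borel_on {0..})"
  shows "AE v in line_distribution \<nu>. v \<in> {0..1}"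
proof -
  note [measurable] = line_weight_measurable[OF \<nu>] powr_measurable_half_line[OF \<nu>]
  have sp: "space \<nu> = {0..}" using sets_eq_imp_space_eq[OF \<nu>] by simp
  have "(4::real) powr - x \<le> 1" if "0 \<le> x" for x
    using powr_mono[of "- x" 0 "4::real"] that by simp
  then show ?thesis
    unfolding line_distribution_def
    by (subst AE_distr_iff) (auto intro!: AE_I2 simp: sp)
qed

text \<open>The map \<open>x \<mapsto> 4 powr (- x)\<close> is injective with Borel measurable inverse, and the weight can be divided out.\<close>

lemma line_distribution_inj:
  assumes \<nu>: "sets \<nu> = sets (borel_on {0..})" and \<nu>': "sets \<nu>' = sets (borel_on {0..})"
    and eq: "line_distribution \<nu> = line_distribution \<nu>'"
  shows "\<nu> = \<nu>'"
proof -
  define w where "w x = ennreal (1 / (2 * pi)) * line_weight x" for x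
  have w: "w x * (1 / w x) = 1" if "0 \<le> x" for x
  proof -
    have "0 < w x" "w x < top"
      using line_weight_pos_finite[OF that] by (auto simp: w_def ennreal_zero_less_mult_iff ennreal_mult_less_top)
    then show ?thesis by (simp add: ennreal_times_divide ennreal_divide_self)
  qed
  have wm: "w \<in> borel_measurable \<nu>" if "sets \<nu> = sets (borel_on {0..})" for \<nu>
    using line_weight_measurable[OF that] unfolding w_def[abs_def] by measurable
  have recover: "density (density \<nu> w) (\<lambda>x. 1 / w x) = \<nu>" if \<nu>: "sets \<nu> = sets (borel_on {0..})" for \<nu>
  proof -
    note [measurable] = wm[OF \<nu>]
    have sp: "space \<nu> = {0..}" using sets_eq_imp_space_eq[OF \<nu>] by simp
    have "density (density \<nu> w) (\<lambda>x. 1 / w x) = density \<nu> (\<lambda>x. w x * (1 / w x))"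
      by (rule density_density_eq) measurable
    also have "\<dots> = density \<nu> (\<lambda>x. 1)"
      by (rule density_cong) (auto simp: sp w)
    finally show ?thesis by (simp add: density_1)
  qed
  have dens: "density \<nu> w = density \<nu>' w"
  proof (rule measure_eqI)
    fix A assume "A \<in> sets (density \<nu> w)"
    then have A: "A \<in> sets (borel_on {0..})" by (simp add: \<nu>)
    then have A': "A \<in> sets borel" "A \<subseteq> {0..}"
      by (auto simp: borel_on_def sets_restrict_space_iff)
    \<comment> \<open>The image of \<open>A\<close> under \<open>x \<mapsto> 4 powr (- x)\<close>, written as a preimage to make it measurable.\<close>
    define B where "B = {v. 0 < v \<and> - log 4 v \<in> A}"
    have [measurable]: "B \<in> sets borel"
    proof -
      have "(\<lambda>v. - log 4 v) -` A \<in> sets borel"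
        by (rule measurable_sets_borel[OF _ A'(1)]) measurable
      moreover have "B = {0<..} \<inter> (\<lambda>v. - log 4 v) -` A" by (auto simp: B_def)
      ultimately show ?thesis by simp
    qed
    have em: "emeasure (density \<nu> w) A = emeasure (line_distribution \<nu>) B" if \<nu>: "sets \<nu> = sets (borel_on {0..})" for \<nu>
    proof -
      have sp: "space \<nu> = {0..}" using sets_eq_imp_space_eq[OF \<nu>] by simp
      note [measurable] = powr_measurable_half_line[OF \<nu>]
      have "(\<lambda>x. 4 powr - x) -` B \<inter> space (density \<nu> w) = A"
        using A'(2) by (auto simp: B_def sp)
      then show ?thesis
        unfolding line_distribution_def w_def[abs_def, symmetric]
        by (subst emeasure_distr) simp_all
    qed
    show "emeasure (density \<nu> w) A = emeasure (density \<nu>' w) A"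
      unfolding em[OF \<nu>] em[OF \<nu>'] eq ..
  qed (simp add: \<nu> \<nu>')
  have "\<nu> = density (density \<nu> w) (\<lambda>x. 1 / w x)" by (rule recover[OF \<nu>, symmetric])
  also have "\<dots> = density (density \<nu>' w) (\<lambda>x. 1 / w x)" by (simp only: dens)
  also have "\<dots> = \<nu>'" by (rule recover[OF \<nu>'])
  finally show ?thesis .
qed

lemma isometric_base_measure_unique:
  assumes \<nu>: "sets \<nu> = sets (borel_on {0..})" "bergman_isometric (vertical_product \<nu>)"
    and \<nu>': "sets \<nu>' = sets (borel_on {0..})" "bergman_isometric (vertical_product \<nu>')"
  shows "\<nu> = \<nu>'"
proof (rule line_distribution_inj[OF \<nu>(1) \<nu>'(1)])
  show "line_distribution \<nu> = line_distribution \<nu>'"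
    by (rule real_distribution_eq_moments)
       (simp_all only: real_distribution_line_distribution \<nu> \<nu>' line_distribution_support line_distribution_moments)
qed

theorem theorem5:
  shows "(\<forall>f\<in>bergman_space. \<exists>b. is_boundary_value (weighted_mellin f) b) \<and>
    translation_invariant omega \<and> bergman_isometric omega \<and>
    (\<forall>\<mu>. translation_invariant \<mu> \<and> bergman_isometric \<mu> \<longrightarrow> \<mu> = omega)"
proof (intro conjI ballI allI impI)
  fix f assume f: "f \<in> bergman_space"
  then obtain a where "has_coeffs f a" using bergman_space_has_coeffs by blast
  with f interpret taylor_approximation f a by unfold_locales
  show "\<exists>b. is_boundary_value (weighted_mellin f) b" by (rule boundary_value_exists)
next
  show "translation_invariant omega"
    unfolding translation_invariant_def omega_def using sets_omega_base by blast
next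
  show "bergman_isometric omega" by (rule bergman_isometric_omega)
next
  fix \<mu> assume \<mu>: "translation_invariant \<mu> \<and> bergman_isometric \<mu>"
  then obtain \<nu> where \<nu>: "sets \<nu> = sets (borel_on {0..})" "\<mu> = vertical_product \<nu>"
    by (auto simp: translation_invariant_def)
  have "\<nu> = omega_base"
    using \<mu> \<nu> bergman_isometric_omega
    by (intro isometric_base_measure_unique) (simp_all add: omega_def)
  then show "\<mu> = omega" by (simp add: \<nu>(2) omega_def)
qed

end
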